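(* Let $M$ be a strongly regular sequence, $\Omega\subset\mathbb{R}^n$ open, let $\varphi$ be a non-zero element of $\mathcal{C}_M(\Omega)$, let $X$ be its zero set and $X_\infty=\{a\in X: T_a\varphi=0\}$ its set of points of flatness. Put $\mathcal{I}=\varphi\,\mathcal{C}_M(\Omega)$. The following are equivalent: (A') $\varphi$ satisfies the $\mathcal{C}_M$ Łojasiewicz condition; (B') $\underline{m}^\infty_{X,M}\subset\mathcal{I}$ and $X\setminus X_\infty$ is dense in $\partial X$; (C') $\underline{m}^\infty_{X,M}=\mathcal{I}\,\underline{m}^\infty_{X,M}$.
   Context: Multi-index notation: $J=(j_1,\dots,j_n)$, $j=j_1+\dots+j_n$, $J!=j_1!\cdots j_n!$, $D^J=\partial^j/\partial x_1^{j_1}\cdots\partial x_n^{j_n}$. $T_a\varphi=\sum_J\frac{1}{J!}D^J\varphi(a)x^J$ is the formal Taylor series at $a$; a function is flat at $a$ if its Taylor series at $a$ is $0$. A sequence $M=(M_j)_{j\ge0}$ of reals is strongly regular if: $M$ is increasing with $M_0=1$; $M_{j+1}/M_j$ is increasing; there is $A>0$ with $M_{j+k}\le A^{j+k}M_jM_k$ for all $j,k$; and there is $A>0$ with $\sum_{j\ge k}\frac{M_j}{(j+1)M_{j+1}}\le A\frac{M_k}{M_{k+1}}$ for all $k$. $h_M(t)=\inf_{j\ge0}t^jM_j$ for $t>0$, $h_M(0)=0$. $\mathcal{C}_M(\Omega)$ is the algebra of $f\in\mathcal{C}^\infty(\Omega)$ such that for every compact $K\subset\Omega$ there are $C,\sigma>0$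 with $\vert D^Jf(x)\vert\le C\sigma^j j!M_j$ for all $J$, $x\in K$. $\underline{m}^\infty_{X,M}$ denotes the ideal of elements of $\mathcal{C}_M(\Omega)$ flat at every point of $X$, and $\mathcal{I}\,\underline{m}^\infty_{X,M}$ is the product ideal (here equal to $\{\varphi g: g\in\underline{m}^\infty_{X,M}\}$). A non-zero $\varphi\in\mathcal{C}_M(\Omega)$ with zero set $X$ satisfies the $\mathcal{C}_M$ Łojasiewicz condition if for every compact $K\subset\Omega$ and every real $\lambda>0$ there exist $C,\sigma>0$ such that for all $J\in\mathbb{N}^n$ and all $x\in K\setminus X$, $\vert D^J(1/\varphi)(x)\vert\le \dfrac{C\sigma^j j!M_j}{h_M(\lambda\,\mathrm{dist}(x,X))}$. *)

theory Defs
  imports "HOL-Analysis.Analysis"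
begin

text \<open>Functions on R^n are modelled as total functions real^'n => real;
  only their values on the open set Omega matter.\<close>

definition partial_deriv :: "'n::finite \<Rightarrow> (real^'n \<Rightarrow> real) \<Rightarrow> real^'n \<Rightarrow> real" where
  "partial_deriv i f x = deriv (\<lambda>t. f (x + t *\<^sub>R axis i 1)) 0"

fun iter_partial :: "'n::finite list \<Rightarrow> (real^'n \<Rightarrow> real) \<Rightarrow> real^'n \<Rightarrow> real" where
  "iter_partial [] f = f"
| "iter_partial (i # is) f = partial_deriv i (iter_partial is f)"

definition mi_order :: "('n::finite \<Rightarrow> nat) \<Rightarrow> nat" where
  "mi_order J = (\<Sum>i\<in>UNIV. J i)"

definition mi_fact :: "('n::finite \<Rightarrow> nat) \<Rightarrow> real" where
  "mi_fact J = (\<Prod>i\<in>UNIV. fact (J i))"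

definition mi_list :: "('n::finite \<Rightarrow> nat) \<Rightarrow> 'n list" where
  "mi_list J = (SOME is. \<forall>i. length (filter ((=) i) is) = J i)"

definition DJ :: "('n::finite \<Rightarrow> nat) \<Rightarrow> (real^'n \<Rightarrow> real) \<Rightarrow> real^'n \<Rightarrow> real" where
  "DJ J f = iter_partial (mi_list J) f"

definition smooth_on :: "(real^'n::finite) set \<Rightarrow> (real^'n \<Rightarrow> real) \<Rightarrow> bool" where
  "smooth_on \<Omega> f \<longleftrightarrow> (\<forall>is. \<forall>x\<in>\<Omega>. iter_partial is f differentiable (at x))"

definition flat_at :: "(real^'n::finite \<Rightarrow> real) \<Rightarrow> real^'n \<Rightarrow> bool" where
  "flat_at f a \<longleftrightarrow> (\<forall>J. DJ J f a = 0)"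

definition strongly_regular :: "(nat \<Rightarrow> real) \<Rightarrow> bool" where
  "strongly_regular M \<longleftrightarrow>
     mono M \<and> M 0 = 1 \<and>
     mono (\<lambda>j. M (Suc j) / M j) \<and>
     (\<exists>A>0. \<forall>j k. M (j + k) \<le> A ^ (j + k) * M j * M k) \<and>
     (\<exists>A>0. \<forall>k. summable (\<lambda>j. M (j + k) / (real (j + k + 1) * M (j + k + 1))) \<and>
                (\<Sum>j. M (j + k) / (real (j + k + 1) * M (j + k + 1))) \<le> A * (M k / M (k + 1)))"

definition hM :: "(nat \<Rightarrow> real) \<Rightarrow> real \<Rightarrow> real" where
  "hM M t = (if t = 0 then 0 else (INF j. t ^ j * M j))"

definition CM :: "(nat \<Rightarrow> real) \<Rightarrow> (real^'n::finite) set \<Rightarrow> (real^'n \<Rightarrow> real) set" where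
  "CM M \<Omega> = {f. smooth_on \<Omega> f \<and>
     (\<forall>K. compact K \<and> K \<subseteq> \<Omega> \<longrightarrow>
        (\<exists>C>0. \<exists>\<sigma>>0. \<forall>J. \<forall>x\<in>K.
           \<bar>DJ J f x\<bar> \<le> C * \<sigma> ^ mi_order J * fact (mi_order J) * M (mi_order J)))}"

definition zero_set :: "(real^'n::finite) set \<Rightarrow> (real^'n \<Rightarrow> real) \<Rightarrow> (real^'n) set" where
  "zero_set \<Omega> \<phi> = {x\<in>\<Omega>. \<phi> x = 0}"

definition flat_points :: "(real^'n::finite) set \<Rightarrow> (real^'n \<Rightarrow> real) \<Rightarrow> (real^'n) set" where
  "flat_points \<Omega> \<phi> = {a\<in>zero_set \<Omega> \<phi>. flat_at \<phi> a}"

definition flat_ideal :: "(nat \<Rightarrow> real) \<Rightarrow> (real^'n::finite) set \<Rightarrow> (real^'n) set \<Rightarrow> (real^'n \<Rightarrow> real) set" where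
  "flat_ideal M \<Omega> X = {f\<in>CM M \<Omega>. \<forall>a\<in>X. flat_at f a}"

text \<open>phi * S, functions identified by their values on Omega.\<close>
definition mult_set :: "(real^'n::finite) set \<Rightarrow> (real^'n \<Rightarrow> real) \<Rightarrow> (real^'n \<Rightarrow> real) set \<Rightarrow> (real^'n \<Rightarrow> real) set" where
  "mult_set \<Omega> \<phi> S = {f. \<exists>g\<in>S. \<forall>x\<in>\<Omega>. f x = \<phi> x * g x}"

text \<open>C_M Lojasiewicz condition.  If X is empty, dist(x,X) = +infinity and
  h_M(+infinity) = 1 (since h_M(t) = 1 for t >= 1).\<close>
definition CM_lojasiewicz :: "(nat \<Rightarrow> real) \<Rightarrow> (real^'n::finite) set \<Rightarrow> (real^'n \<Rightarrow> real) \<Rightarrow> bool" where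
  "CM_lojasiewicz M \<Omega> \<phi> \<longleftrightarrow>
     (\<forall>K. compact K \<and> K \<subseteq> \<Omega> \<longrightarrow> (\<forall>lam>0. \<exists>C>0. \<exists>\<sigma>>0. \<forall>J. \<forall>x\<in>K - zero_set \<Omega> \<phi>.
        \<bar>DJ J (\<lambda>y. 1 / \<phi> y) x\<bar> \<le>
          C * \<sigma> ^ mi_order J * fact (mi_order J) * M (mi_order J) /
          (if zero_set \<Omega> \<phi> = {} then 1 else hM M (lam * infdist x (zero_set \<Omega> \<phi>)))))"

end

theory Submission
  imports Defs
begin

text \<open>
  The inclusion \<open>flat_ideal M \<Omega> X \<subseteq> I\<close> alone already forces the Lojasiewicz condition. By a gliding
  hump argument, division by \<open>\<phi>\<close> is bounded, uniformly over compact sets, on the functions that are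
  flat on \<open>X\<close> and satisfy the \<open>C\<^sub>M\<close> estimates with fixed constants. Strong regularity provides, at each
  point \<open>x\<close> off \<open>X\<close>, a function equal to \<open>1\<close> near \<open>x\<close>, vanishing near \<open>X\<close>, whose size in \<open>C\<^sub>M\<close> is at most
  \<open>1 / hM M (\<lambda> dist(x, X))\<close>; dividing it by \<open>\<phi>\<close> gives the required bound for the derivatives of
  \<open>1 / \<phi>\<close> at \<open>x\<close>.

  Conversely, Taylor's formula bounds the derivatives of a function \<open>f\<close> flat on \<open>X\<close> by a multiple of
  \<open>hM M (\<lambda> dist(x, X))\<close>, and moderate growth gives \<open>hM M t \<le> (hM M (A t))\<^sup>2\<close>. Under the Lojasiewicz
  condition one factor compensates the growth of \<open>1 / \<phi>\<close>, while the other makes \<open>f / \<phi>\<close> extend by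
  zero to a flat function. The same estimate with \<open>f = \<phi>\<close> excludes that \<open>\<phi>\<close> is flat at all zeros near
  a boundary point of \<open>X\<close>.

  Symmetry of mixed derivatives makes it possible to work with lists of indices throughout.
\<close>

section \<open>Iterated partial derivatives\<close>

text \<open>The obstacle is uniformity: the constants \<open>C\<close> and \<open>\<sigma>\<close>
  of a quotient depend on the function that is divided. The hump argument therefore fixes
  \<open>\<sigma>\<close>, works in one unit ball \<open>flat_ball\<close> of globally defined
  functions, and contradicts the inclusion by a single explicit series. Only points off
  \<open>X\<close> are tested, since \<open>\<phi>\<close> may vanish on an open set and determines
  the quotient only off \<open>X\<close>.

  For the same reason the cutoffs need a \<open>\<sigma>\<close> that depends neither on the point
  nor on its distance to \<open>X\<close>: after multiplication by \<open>hM\<close> all of them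
  must lie in one such ball. They arise by convolving a trapezoid with infinitely many boxes, whose
  widths are adapted to the index realising the infimum \<open>hM\<close>.

  All losses (a factor 2 in a distance, the constant \<open>A\<close> of moderate growth, an
  \<open>n\<close>th power from a product over coordinates) are moved into the argument of
  \<open>hM\<close>. This is harmless because the Lojasiewicz condition quantifies over every
  \<open>lam\<close>.\<close>

lemma partial_deriv_eq:
  assumes "(f has_derivative f') (at x)"
  shows "partial_deriv i f x = f' (axis i 1)"
proof -
  have l: "linear f'" using assms by (rule has_derivative_linear)
  have a: "((\<lambda>t. x + t *\<^sub>R axis i 1) has_derivative (\<lambda>t. t *\<^sub>R axis i 1)) (at (0::real))"
    by (auto intro!: derivative_eq_intros)
  have "(f has_derivative f') (at (x + (0::real) *\<^sub>R axis i 1))" using assms by simp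
  then have "((\<lambda>t. f (x + t *\<^sub>R axis i 1)) has_derivative (\<lambda>t. f' (t *\<^sub>R axis i 1))) (at (0::real))"
    by (rule has_derivative_compose[OF a])
  then have "((\<lambda>t. f (x + t *\<^sub>R axis i 1)) has_derivative (*) (f' (axis i 1))) (at (0::real))"
    by (rule has_derivative_eq_rhs) (simp add: fun_eq_iff linear_scale[OF l])
  then show ?thesis
    unfolding partial_deriv_def by (simp add: DERIV_imp_deriv has_field_derivative_def)
qed

lemma has_derivative_partials:
  assumes "f differentiable (at x)"
  shows "(f has_derivative (\<lambda>h. \<Sum>i\<in>UNIV. h $ i * partial_deriv i f x)) (at x)"
proof -
  obtain f' where f': "(f has_derivative f') (at x)"
    using assms by (auto simp: differentiable_def)
  have l: "linear f'" using f' by (rule has_derivative_linear)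
  have "f' h = (\<Sum>i\<in>UNIV. h $ i * partial_deriv i f x)" for h
  proof -
    have "f' h = f' (\<Sum>i\<in>UNIV. h $ i *\<^sub>R axis i 1)"
      using basis_expansion[of h] by (simp add: scalar_mult_eq_scaleR)
    also have "\<dots> = (\<Sum>i\<in>UNIV. h $ i * f' (axis i 1))"
      by (simp add: linear_sum[OF l] linear_scale[OF l])
    finally show ?thesis by (simp add: partial_deriv_eq[OF f'])
  qed
  then have "f' = (\<lambda>h. \<Sum>i\<in>UNIV. h $ i * partial_deriv i f x)" by blast
  then show ?thesis using f' by simp
qed

lemma has_real_derivative_along_line:
  assumes "f differentiable (at (a + t *\<^sub>R v))"
  shows "((\<lambda>s. f (a + s *\<^sub>R v)) has_real_derivative
           (\<Sum>i\<in>UNIV. v $ i * partial_deriv i f (a + t *\<^sub>R v))) (at t)"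
proof -
  have a: "((\<lambda>s. a + s *\<^sub>R v) has_derivative (\<lambda>s. s *\<^sub>R v)) (at t)"
    by (auto intro!: derivative_eq_intros)
  have "((\<lambda>s. f (a + s *\<^sub>R v)) has_derivative
     (\<lambda>s. \<Sum>i\<in>UNIV. (s *\<^sub>R v) $ i * partial_deriv i f (a + t *\<^sub>R v))) (at t)"
    by (rule has_derivative_compose[OF a has_derivative_partials[OF assms]])
  then show ?thesis unfolding has_field_derivative_def
    by (rule has_derivative_eq_rhs) (simp add: fun_eq_iff sum_distrib_left mult_ac)
qed

lemma has_real_derivative_along_axis:
  assumes "f differentiable (at (a + t *\<^sub>R axis i 1))"
  shows "((\<lambda>s. f (a + s *\<^sub>R axis i 1)) has_real_derivative
           partial_deriv i f (a + t *\<^sub>R axis i 1)) (at t)"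
proof -
  have "(\<Sum>j\<in>UNIV. axis i 1 $ j * partial_deriv j f (a + t *\<^sub>R axis i 1)) =
      partial_deriv i f (a + t *\<^sub>R axis i (1::real))"
    by (subst sum.remove[of _ i]) (auto simp: axis_def intro!: sum.neutral)
  then show ?thesis using has_real_derivative_along_line[OF assms] by simp
qed

lemma partial_deriv_cong:
  assumes "open U" "x \<in> U" "\<And>y. y \<in> U \<Longrightarrow> f y = g y"
  shows "partial_deriv i f x = partial_deriv i g x"
proof -
  have "((\<lambda>t. x + t *\<^sub>R axis i 1) \<longlongrightarrow> x + 0 *\<^sub>R axis i 1) (at (0::real))"
    by (intro tendsto_intros)
  then have "\<forall>\<^sub>F t in at (0::real). x + t *\<^sub>R axis i 1 \<in> U"
    using assms(1,2) by (metis add.right_neutral scale_zero_left topological_tendstoD)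
  then have "\<forall>\<^sub>F t in nhds (0::real). x + t *\<^sub>R axis i 1 \<in> U"
    using assms(2) by (simp add: eventually_nhds_conv_at)
  then have "\<forall>\<^sub>F t in nhds (0::real). f (x + t *\<^sub>R axis i 1) = g (x + t *\<^sub>R axis i 1)"
    by eventually_elim (use assms(3) in blast)
  then show ?thesis unfolding partial_deriv_def by (intro deriv_cong_ev) auto
qed

text \<open>Functions are total, while identities such as \<open>F = \<phi> * g\<close> hold only on
  an open set; they reach the derivatives through this localisation.\<close>

lemma iter_partial_cong:
  assumes "open U" "\<And>y. y \<in> U \<Longrightarrow> f y = g y" "x \<in> U"
  shows "iter_partial is f x = iter_partial is g x"
  using assms(3)
proof (induction "is" arbitrary: x)
  case Nil then show ?case using assms by simp
next
  case (Cons i "is")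
  then show ?case
    using partial_deriv_cong[where f = "iter_partial is f" and g = "iter_partial is g", OF assms(1) Cons.prems Cons.IH]
    by simp
qed

lemma iter_partial_append: "iter_partial (is @ js) f = iter_partial is (iter_partial js f)"
  by (induction "is") auto

lemma differentiable_cong_open:
  assumes "open U" "x \<in> U" "\<And>y. y \<in> U \<Longrightarrow> f y = g y" "f differentiable (at x)"
  shows "g differentiable (at x)"
  using assms unfolding differentiable_def
  by (metis has_derivative_transform_within_open)

lemma smooth_onD: "smooth_on U f \<Longrightarrow> x \<in> U \<Longrightarrow> iter_partial is f differentiable (at x)"
  by (auto simp: smooth_on_def)

lemma smooth_on_cong:
  assumes "open U" "\<And>y. y \<in> U \<Longrightarrow> f y = g y" "smooth_on U f"
  shows "smooth_on U g"
  unfolding smooth_on_def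
proof (intro allI ballI)
  fix "is" x assume x: "x \<in> U"
  show "iter_partial is g differentiable at x"
    by (rule differentiable_cong_open[OF assms(1) x _ smooth_onD[OF assms(3) x]])
       (rule iter_partial_cong[OF assms(1,2)])
qed

lemma smooth_on_subset: "smooth_on U f \<Longrightarrow> V \<subseteq> U \<Longrightarrow> smooth_on V f"
  by (auto simp: smooth_on_def)

lemma smooth_on_iter_partial: "smooth_on U f \<Longrightarrow> smooth_on U (iter_partial js f)"
  by (simp add: smooth_on_def iter_partial_append[symmetric])

lemma sum_list_differentiable:
  fixes F :: "'a \<Rightarrow> real^'n::finite \<Rightarrow> real"
  assumes "\<And>p. p \<in> set ps \<Longrightarrow> F p differentiable (at x)"
  shows "(\<lambda>y. \<Sum>p\<leftarrow>ps. F p y) differentiable (at x) \<and>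
         partial_deriv i (\<lambda>y. \<Sum>p\<leftarrow>ps. F p y) x = (\<Sum>p\<leftarrow>ps. partial_deriv i (F p) x)"
proof -
  have "((\<lambda>y. \<Sum>p\<leftarrow>ps. F p y) has_derivative
     (\<lambda>h. \<Sum>p\<leftarrow>ps. \<Sum>j\<in>UNIV. h $ j * partial_deriv j (F p) x)) (at x)" (is "(_ has_derivative ?f') _")
    using assms by (induction ps) (auto intro!: has_derivative_add has_derivative_partials)
  moreover have "?f' (axis i 1) = (\<Sum>p\<leftarrow>ps. partial_deriv i (F p) x)"
  proof -
    have "(\<Sum>j\<in>UNIV. axis i 1 $ j * partial_deriv j f x) = partial_deriv i f (x::real^'n)" for f
      by (subst sum.remove[of _ i]) (auto simp: axis_def intro!: sum.neutral)
    then show ?thesis by simp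
  qed
  ultimately show ?thesis
    using partial_deriv_eq[of "\<lambda>y. \<Sum>p\<leftarrow>ps. F p y" ?f' x i] differentiableI by fastforce
qed

lemma mult_differentiable:
  fixes f g :: "real^'n::finite \<Rightarrow> real"
  assumes "f differentiable (at x)" "g differentiable (at x)"
  shows "(\<lambda>y. f y * g y) differentiable (at x)"
    and "partial_deriv i (\<lambda>y. f y * g y) x = partial_deriv i f x * g x + f x * partial_deriv i g x"
proof -
  obtain f' g' where d: "(f has_derivative f') (at x)" "(g has_derivative g') (at x)"
    using assms by (auto simp: differentiable_def)
  then have *: "((\<lambda>y. f y * g y) has_derivative (\<lambda>h. f x * g' h + f' h * g x)) (at x)"
    by (rule has_derivative_mult)
  then show "(\<lambda>y. f y * g y) differentiable (at x)" by (rule differentiableI)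
  show "partial_deriv i (\<lambda>y. f y * g y) x = partial_deriv i f x * g x + f x * partial_deriv i g x"
    using partial_deriv_eq[OF *, of i] partial_deriv_eq[OF d(1), of i] partial_deriv_eq[OF d(2), of i]
    by simp
qed

text \<open>Leibniz bookkeeping: each entry of the index list is sent to one of the two factors.
  Keeping all choices in a list, with repetitions, takes the place of binomial coefficients.\<close>

fun splits :: "'a list \<Rightarrow> ('a list \<times> 'a list) list" where
  "splits [] = [([], [])]"
| "splits (i # is) = map (\<lambda>(a, b). (i # a, b)) (splits is) @ map (\<lambda>(a, b). (a, i # b)) (splits is)"

lemma splits_length: "p \<in> set (splits is) \<Longrightarrow> length (fst p) + length (snd p) = length is"
  by (induction "is" arbitrary: p) auto

text \<open>With \<open>n = length is\<close>, there are \<open>n choose a\<close> splittings whose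
  first part has length \<open>a\<close>, each contributing \<open>a! (n - a)!\<close>. So each of
  the \<open>n + 1\<close> possible lengths contributes \<open>n!\<close>, and a product costs only
  a factor \<open>n + 1\<close>.\<close>

lemma splits_sum_fact:
  "(\<Sum>p\<leftarrow>splits is. fact (length (fst p)) * fact (length (snd p))) = (fact (Suc (length is)) :: real)"
proof (induction "is")
  case Nil then show ?case by simp
next
  case (Cons i "is")
  have "(\<Sum>p\<leftarrow>splits (i # is). fact (length (fst p)) * fact (length (snd p))) =
    (\<Sum>p\<leftarrow>splits is. (fact (Suc (length (fst p))) * fact (length (snd p)) :: real)
       + fact (length (fst p)) * fact (Suc (length (snd p))))"
    by (simp add: comp_def case_prod_unfold sum_list_addf del: fact_Suc)
  also have "\<dots> = (\<Sum>p\<leftarrow>splits is. (real (length is) + 2) * (fact (length (fst p)) * fact (length (snd p))))"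
  proof (intro arg_cong[of _ _ sum_list] map_cong refl)
    fix p assume "p \<in> set (splits is)"
    then have "length is = length (fst p) + length (snd p)" by (simp add: splits_length)
    then show "(fact (Suc (length (fst p))) * fact (length (snd p)) :: real)
       + fact (length (fst p)) * fact (Suc (length (snd p)))
       = (real (length is) + 2) * (fact (length (fst p)) * fact (length (snd p)))"
      by (simp add: algebra_simps)
  qed
  also have "\<dots> = (real (length is) + 2) * fact (Suc (length is))"
    by (simp add: sum_list_const_mult Cons.IH del: fact_Suc)
  finally show ?case by (simp add: algebra_simps)
qed

lemma iter_partial_mult:
  fixes f g :: "real^'n::finite \<Rightarrow> real"
  assumes U: "open U" "smooth_on U f" "smooth_on U g" and x: "x \<in> U"
  shows "iter_partial is (\<lambda>y. f y * g y) x =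
           (\<Sum>p\<leftarrow>splits is. iter_partial (fst p) f x * iter_partial (snd p) g x)"
  using x
proof (induction "is" arbitrary: x)
  case Nil then show ?case by simp
next
  case (Cons i "is")
  let ?F = "\<lambda>p y. iter_partial (fst p) f y * iter_partial (snd p) g y"
  have d: "iter_partial js f differentiable (at x)" "iter_partial js g differentiable (at x)" for js
    using U Cons.prems by (auto intro: smooth_onD)
  have "iter_partial (i # is) (\<lambda>y. f y * g y) x = partial_deriv i (\<lambda>y. \<Sum>p\<leftarrow>splits is. ?F p y) x"
    using partial_deriv_cong[OF U(1) Cons.prems Cons.IH] by simp
  also have "\<dots> = (\<Sum>p\<leftarrow>splits is. partial_deriv i (?F p) x)"
    using sum_list_differentiable[of "splits is" ?F x i] mult_differentiable(1)[OF d] by blast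
  also have "\<dots> = (\<Sum>p\<leftarrow>splits (i # is). ?F p x)"
    by (simp add: comp_def case_prod_unfold sum_list_addf[symmetric] mult_differentiable(2)[OF d])
  finally show ?case .
qed

lemma smooth_on_mult:
  fixes f g :: "real^'n::finite \<Rightarrow> real"
  assumes U: "open U" "smooth_on U f" "smooth_on U g"
  shows "smooth_on U (\<lambda>y. f y * g y)"
  unfolding smooth_on_def
proof (intro allI ballI)
  fix "is" x assume x: "x \<in> U"
  let ?F = "\<lambda>p y. iter_partial (fst p) f y * iter_partial (snd p) g y"
  have "(\<lambda>y. \<Sum>p\<leftarrow>splits is. ?F p y) differentiable (at x)"
    using sum_list_differentiable[of "splits is" ?F x]
      mult_differentiable(1)[OF smooth_onD[OF U(2) x] smooth_onD[OF U(3) x]] by blast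
  then show "iter_partial is (\<lambda>y. f y * g y) differentiable at x"
    by (rule differentiable_cong_open[OF U(1) x, rotated]) (simp add: iter_partial_mult[OF U])
qed

lemma iter_partial_linear:
  fixes f g :: "real^'n::finite \<Rightarrow> real"
  assumes U: "open U" "smooth_on U f" "smooth_on U g" and x: "x \<in> U"
  shows "iter_partial is (\<lambda>y. a * f y + b * g y) x = a * iter_partial is f x + b * iter_partial is g x"
    and "iter_partial is (\<lambda>y. a * f y + b * g y) differentiable (at x)"
proof -
  have *: "((\<lambda>y. a * iter_partial is f y + b * iter_partial is g y) has_derivative
     (\<lambda>h. a * frechet_derivative (iter_partial is f) (at x) h + b * frechet_derivative (iter_partial is g) (at x) h)) (at x)"
    if "x \<in> U" for "is" x
    using that U by (auto intro!: derivative_eq_intros smooth_onD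
        simp: frechet_derivative_works[symmetric])
  have 1: "iter_partial is (\<lambda>y. a * f y + b * g y) x = a * iter_partial is f x + b * iter_partial is g x"
    if "x \<in> U" for x "is" using that
  proof (induction "is" arbitrary: x)
    case (Cons i "is")
    have "iter_partial (i # is) (\<lambda>y. a * f y + b * g y) x
        = partial_deriv i (\<lambda>y. a * iter_partial is f y + b * iter_partial is g y) x"
      using partial_deriv_cong[OF U(1) Cons.prems Cons.IH] by simp
    also have "\<dots> = a * iter_partial (i # is) f x + b * iter_partial (i # is) g x"
      using partial_deriv_eq[OF *[OF Cons.prems], of i "is"]
        partial_deriv_eq[OF smooth_onD[OF U(2) Cons.prems, unfolded frechet_derivative_works], of i "is"]
        partial_deriv_eq[OF smooth_onD[OF U(3) Cons.prems, unfolded frechet_derivative_works], of i "is"]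
      by simp
    finally show ?case .
  qed simp
  show "iter_partial is (\<lambda>y. a * f y + b * g y) x = a * iter_partial is f x + b * iter_partial is g x"
    using 1[OF x] .
  show "iter_partial is (\<lambda>y. a * f y + b * g y) differentiable (at x)"
    by (rule differentiable_cong_open[OF U(1) x _ differentiableI[OF *[OF x, of "is"]]]) (simp add: 1)
qed

lemma smooth_on_linear:
  fixes f g :: "real^'n::finite \<Rightarrow> real"
  assumes "open U" "smooth_on U f" "smooth_on U g"
  shows "smooth_on U (\<lambda>y. a * f y + b * g y)"
  using iter_partial_linear(2)[OF assms] by (auto simp: smooth_on_def)

lemma iter_partial_const:
  fixes c :: real
  shows "iter_partial is (\<lambda>y. c) = (\<lambda>y :: real^'n::finite. if is = [] then c else 0)"
proof (induction "is")
  case (Cons i "is")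
  have "partial_deriv i (\<lambda>y. c) x = 0" for c :: real and i and x :: "real^'n"
    by (rule partial_deriv_eq[of _ "\<lambda>h. 0", THEN trans]) auto
  then show ?case unfolding iter_partial.simps Cons.IH by (cases "is = []") (auto simp: fun_eq_iff)
qed auto

lemma smooth_on_const: "smooth_on U (\<lambda>y. c)"
  by (simp add: smooth_on_def iter_partial_const)

lemma smooth_on_inverse:
  fixes f :: "real^'n::finite \<Rightarrow> real"
  assumes U: "open U" "smooth_on U f" and nz: "\<And>x. x \<in> U \<Longrightarrow> f x \<noteq> 0"
  shows "smooth_on U (\<lambda>y. 1 / f y)"
proof -
  let ?u = "\<lambda>y. 1 / f y"
  have d: "f differentiable (at x)" if "x \<in> U" for x using smooth_onD[OF U(2) that, of "[]"] by simp
  have du: "?u differentiable (at x)" 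
     "partial_deriv i ?u x = (- 1 * ?u x) * ?u x * partial_deriv i f x" if xU: "x \<in> U" for x i
  proof -
    obtain f' where f': "(f has_derivative f') (at x)" using d[OF xU] by (auto simp: differentiable_def)
    have *: "(?u has_derivative (\<lambda>h. - 1 * ?u x * ?u x * f' h)) (at x)"
      using nz[OF xU] f' by (auto intro!: derivative_eq_intros simp: field_simps)
    show "?u differentiable (at x)" using * by (rule differentiableI)
    show "partial_deriv i ?u x = (- 1 * ?u x) * ?u x * partial_deriv i f x"
      using partial_deriv_eq[OF *, of i] partial_deriv_eq[OF f', of i] by simp
  qed
  \<comment> \<open>The identity for \<open>partial_deriv i ?u\<close> lifts differentiability of order \<open>n\<close> to order \<open>n + 1\<close>.\<close>
  define D where "D = (\<lambda>n (g :: real^'n \<Rightarrow> real). \<forall>is x. length is \<le> n \<longrightarrow> x \<in> U \<longrightarrow> iter_partial is g differentiable (at x))"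
  have D_Suc: "D (Suc n) g" if "\<And>x. x \<in> U \<Longrightarrow> g differentiable (at x)" "\<And>i. D n (partial_deriv i g)" for n g
    unfolding D_def
  proof (intro allI impI)
    fix "is" :: "'n list" and x assume a: "length is \<le> Suc n" "x \<in> U"
    show "iter_partial is g differentiable at x"
    \<comment> \<open>The last entry of the list is the derivative that is applied first.\<close>
    proof (cases "is" rule: rev_cases)
      case Nil then show ?thesis using that a by simp
    next
      case (snoc js i)
      then show ?thesis using that(2)[of i] a by (auto simp: D_def iter_partial_append)
    qed
  qed
  have D_mono: "D n g" if "D m g" "n \<le> m" for n m g using that by (auto simp: D_def)
  have D_part: "D n (partial_deriv i g)" if "D (Suc n) g" for n g i
    unfolding D_def
  proof (intro allI impI)
    fix "is" :: "'n list" and x assume "length is \<le> n" "x \<in> U"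
    then show "iter_partial is (partial_deriv i g) differentiable at x"
      using that[unfolded D_def, rule_format, of "is @ [i]" x] by (simp add: iter_partial_append)
  qed
  have D_diff: "g differentiable (at x)" if "D n g" "x \<in> U" for n g x
    using that[unfolded D_def] by (metis iter_partial.simps(1) le0 list.size(3))
  have D_cong: "D n h" if "D n g" "\<And>x. x \<in> U \<Longrightarrow> g x = h x" for n g h
    unfolding D_def
  proof (intro allI impI)
    fix "is" :: "'n list" and x assume a: "length is \<le> n" "x \<in> U"
    show "iter_partial is h differentiable at x"
      by (rule differentiable_cong_open[OF U(1) a(2), of "iter_partial is g"])
        (use iter_partial_cong[OF U(1) that(2)] that(1) a in \<open>auto simp: D_def\<close>)
  qed
  have D_add: "D n g \<Longrightarrow> D n h \<Longrightarrow> D n (\<lambda>y. g y + h y)" for n g h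
  proof (induction n arbitrary: g h)
    case 0 then show ?case by (auto simp: D_def intro!: differentiable_add)
  next
    case (Suc n)
    show ?case
    proof (rule D_Suc)
      show "(\<lambda>y. g y + h y) differentiable at x" if "x \<in> U" for x
        using D_diff Suc.prems that by (intro differentiable_add) blast+
      show "D n (partial_deriv i (\<lambda>y. g y + h y))" for i
      proof (rule D_cong[OF Suc.IH[OF D_part[OF Suc.prems(1)] D_part[OF Suc.prems(2)]], of i i])
        fix x assume x: "x \<in> U"
        note dg = has_derivative_partials[OF D_diff[OF Suc.prems(1) x]]
        note dh = has_derivative_partials[OF D_diff[OF Suc.prems(2) x]]
        show "partial_deriv i g x + partial_deriv i h x = partial_deriv i (\<lambda>y. g y + h y) x"
          using partial_deriv_eq[OF has_derivative_add[OF dg dh], of i]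
             partial_deriv_eq[OF dg, of i] partial_deriv_eq[OF dh, of i] by simp
      qed
    qed
  qed
  have D_mult: "D n g \<Longrightarrow> D n h \<Longrightarrow> D n (\<lambda>y. g y * h y)" for n g h
  proof (induction n arbitrary: g h)
    case 0 then show ?case by (auto simp: D_def intro!: mult_differentiable)
  next
    case (Suc n)
    show ?case
    proof (rule D_Suc)
      show "(\<lambda>y. g y * h y) differentiable at x" if "x \<in> U" for x
        using D_diff Suc.prems that by (intro mult_differentiable) blast+
      show "D n (partial_deriv i (\<lambda>y. g y * h y))" for i
      proof (rule D_cong[OF D_add])
        show "D n (\<lambda>y. partial_deriv i g y * h y)" "D n (\<lambda>y. g y * partial_deriv i h y)"
          using Suc D_part D_mono[of "Suc n" _ n] by auto
        show "partial_deriv i g x * h x + g x * partial_deriv i h x = partial_deriv i (\<lambda>y. g y * h y) x"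
          if "x \<in> U" for x
          using mult_differentiable(2)[OF D_diff[OF Suc.prems(1) that] D_diff[OF Suc.prems(2) that], of i] by simp
      qed
    qed
  qed
  have "D n ?u" for n
  proof (induction n)
    case 0 show ?case using du by (simp add: D_def)
  next
    case (Suc n)
    show ?case
    proof (rule D_Suc)
      show "?u differentiable (at x)" if "x \<in> U" for x using du that by blast
      have f: "D n (partial_deriv i f)" for i using smooth_onD[OF smooth_on_iter_partial[OF U(2), of "[i]"]]
        by (simp add: D_def)
      have c: "D n (\<lambda>y. - 1)" using smooth_onD[OF smooth_on_const[of U "-1"]] by (simp add: D_def)
      show "D n (partial_deriv i ?u)" for i
        by (rule D_cong[OF D_mult[OF D_mult[OF D_mult[OF c Suc] Suc] f[of i]]]) (use du in auto)
    qed
  qed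
  then show ?thesis by (auto simp: D_def smooth_on_def)
qed

section \<open>Symmetry of mixed derivatives and Taylor bounds at flat points\<close>

text \<open>The mean value theorem is applied in direction \<open>i\<close> to the increment of
  \<open>f\<close> in direction \<open>j\<close>, and then in direction \<open>j\<close>. The left
  side is symmetric in \<open>i\<close> and \<open>j\<close>, the right side is not.\<close>

lemma mixed_difference_mvt:
  fixes f :: "real^'n::finite \<Rightarrow> real"
  assumes U: "\<And>s t. s \<in> {0..h} \<Longrightarrow> t \<in> {0..h} \<Longrightarrow> x + s *\<^sub>R axis i 1 + t *\<^sub>R axis j 1 \<in> U"
    and d: "\<And>y. y \<in> U \<Longrightarrow> f differentiable (at y)"
    and di: "\<And>y. y \<in> U \<Longrightarrow> partial_deriv i f differentiable (at y)"
    and h: "h > 0"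
  shows "\<exists>s\<in>{0<..<h}. \<exists>t\<in>{0<..<h}.
    f (x + h *\<^sub>R axis i 1 + h *\<^sub>R axis j 1) - f (x + h *\<^sub>R axis i 1) - f (x + h *\<^sub>R axis j 1) + f x
    = h * h * partial_deriv j (partial_deriv i f) (x + s *\<^sub>R axis i 1 + t *\<^sub>R axis j 1)"
proof -
  let ?p = "\<lambda>s t. x + s *\<^sub>R axis i 1 + t *\<^sub>R axis j (1::real)"
  let ?g = "\<lambda>s. f (?p s h) - f (?p s 0)"
  have A: "((\<lambda>s. f (?p s t)) has_real_derivative partial_deriv i f (?p s t)) (at s)"
    if "s \<in> {0..h}" "t \<in> {0..h}" for s t
    using has_real_derivative_along_axis[of f "x + t *\<^sub>R axis j 1" s i] d[OF U[OF that]]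
    by (simp add: algebra_simps)
  have "\<exists>s. 0 < s \<and> s < h \<and> ?g h - ?g 0 = (h - 0) * (partial_deriv i f (?p s h) - partial_deriv i f (?p s 0))"
    using h by (intro MVT2 DERIV_diff A) auto
  then obtain s where s: "0 < s" "s < h"
    and gs: "?g h - ?g 0 = h * (partial_deriv i f (?p s h) - partial_deriv i f (?p s 0))" by auto
  have B: "((\<lambda>t. partial_deriv i f (?p s t)) has_real_derivative partial_deriv j (partial_deriv i f) (?p s t)) (at t)"
    if "t \<in> {0..h}" for t
    by (rule has_real_derivative_along_axis) (use di U[of s t] s that in auto)
  have "\<exists>t. 0 < t \<and> t < h \<and> partial_deriv i f (?p s h) - partial_deriv i f (?p s 0)
      = (h - 0) * partial_deriv j (partial_deriv i f) (?p s t)"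
    using h by (intro MVT2 B) auto
  then obtain t where t: "0 < t" "t < h" and gt: "partial_deriv i f (?p s h) - partial_deriv i f (?p s 0)
      = h * partial_deriv j (partial_deriv i f) (?p s t)" by auto
  have "?g h - ?g 0 = h * h * partial_deriv j (partial_deriv i f) (?p s t)"
    unfolding gs gt by simp
  then show ?thesis using s t by (intro bexI[of _ s] bexI[of _ t]) auto
qed

text \<open>The second difference over a small square equals \<open>h * h\<close> times a nearby
  value of either mixed derivative. Both are continuous at \<open>x\<close>, being differentiable
  there, so their values at \<open>x\<close> cannot differ.\<close>

lemma partial_deriv_commute:
  fixes f :: "real^'n::finite \<Rightarrow> real"
  assumes "open U" "x \<in> U" and f: "smooth_on U f"
  shows "partial_deriv i (partial_deriv j f) x = partial_deriv j (partial_deriv i f) x"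
proof (rule ccontr)
  let ?a = "partial_deriv j (partial_deriv i f)" and ?b = "partial_deriv i (partial_deriv j f)"
  assume "?b x \<noteq> ?a x"
  define e where "e = \<bar>?b x - ?a x\<bar> / 2"
  have e: "e > 0" using \<open>?b x \<noteq> ?a x\<close> by (simp add: e_def)
  have d: "f differentiable (at y)" "partial_deriv k f differentiable (at y)"
    "partial_deriv l (partial_deriv k f) differentiable (at y)" if "y \<in> U" for y k l
    using smooth_onD[OF f that, of "[]"] smooth_onD[OF f that, of "[k]"] smooth_onD[OF f that, of "[l,k]"]
    by auto
  have c: "continuous (at x) ?a" "continuous (at x) ?b"
    using d assms(2) by (auto intro: differentiable_imp_continuous_within)
  obtain d1 where d1: "d1 > 0" "\<And>y. dist y x < d1 \<Longrightarrow> dist (?a y) (?a x) < e"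
    using c(1)[unfolded continuous_at_eps_delta] e by blast
  obtain d2 where d2: "d2 > 0" "\<And>y. dist y x < d2 \<Longrightarrow> dist (?b y) (?b x) < e"
    using c(2)[unfolded continuous_at_eps_delta] e by blast
  obtain d3 where d3: "d3 > 0" "ball x d3 \<subseteq> U"
    using assms(1,2) open_contains_ball by blast
  \<comment> \<open>Points of the square lie within \<open>2 * h\<close> of \<open>x\<close>; the
    division by 3 keeps this strictly below all three radii.\<close>
  define h where "h = min d1 (min d2 d3) / 3"
  have h: "h > 0" "2 * h < d1" "2 * h < d2" "2 * h < d3" using d1(1) d2(1) d3(1) by (auto simp: h_def)
  have near: "dist (x + s *\<^sub>R axis k 1 + t *\<^sub>R axis l 1) x \<le> 2 * h" if "s \<in> {0..h}" "t \<in> {0..h}"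
    for s t :: real and k l :: 'n
  proof -
    have "norm (s *\<^sub>R axis k 1 + t *\<^sub>R (axis l 1 :: real^'n)) \<le> norm (s *\<^sub>R (axis k 1 :: real^'n)) + norm (t *\<^sub>R (axis l 1 :: real^'n))"
      by (rule norm_triangle_ineq)
    also have "\<dots> \<le> 2 * h" using that by simp
    finally show ?thesis by (simp add: dist_norm add.assoc)
  qed
  have inU: "x + s *\<^sub>R axis k 1 + t *\<^sub>R axis l 1 \<in> U" if "s \<in> {0..h}" "t \<in> {0..h}" for s t k l
    using near[OF that, of k l] h d3(2) by (auto simp: dist_commute subset_iff)
  obtain s t where st: "s \<in> {0<..<h}" "t \<in> {0<..<h}"
    "f (x + h *\<^sub>R axis i 1 + h *\<^sub>R axis j 1) - f (x + h *\<^sub>R axis i 1) - f (x + h *\<^sub>R axis j 1) + f x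
    = h * h * ?a (x + s *\<^sub>R axis i 1 + t *\<^sub>R axis j 1)"
    using mixed_difference_mvt[where i = i and j = j, OF inU d(1) d(2) h(1)] by blast
  obtain s' t' where st': "s' \<in> {0<..<h}" "t' \<in> {0<..<h}"
    "f (x + h *\<^sub>R axis j 1 + h *\<^sub>R axis i 1) - f (x + h *\<^sub>R axis j 1) - f (x + h *\<^sub>R axis i 1) + f x
    = h * h * ?b (x + s' *\<^sub>R axis j 1 + t' *\<^sub>R axis i 1)"
    using mixed_difference_mvt[where i = j and j = i, OF inU d(1) d(2) h(1)] by blast
  have "h * h * ?a (x + s *\<^sub>R axis i 1 + t *\<^sub>R axis j 1) = h * h * ?b (x + s' *\<^sub>R axis j 1 + t' *\<^sub>R axis i 1)"
    using st(3) st'(3) by (simp add: algebra_simps)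
  then have eq: "?a (x + s *\<^sub>R axis i 1 + t *\<^sub>R axis j 1) = ?b (x + s' *\<^sub>R axis j 1 + t' *\<^sub>R axis i 1)"
    using h by simp
  have "dist (?a (x + s *\<^sub>R axis i 1 + t *\<^sub>R axis j 1)) (?a x) < e"
    using near[of s t i j] st h by (intro d1) auto
  moreover have "dist (?b (x + s' *\<^sub>R axis j 1 + t' *\<^sub>R axis i 1)) (?b x) < e"
    using near[of s' t' j i] st' h by (intro d2) auto
  ultimately have "dist (?b x) (?a x) < 2 * e"
    unfolding eq using dist_triangle_half_r[of _ "?b x" "2 * e" "?a x"] by force
  then show False by (simp add: e_def dist_real_def)
qed

lemma iter_partial_move:
  fixes f :: "real^'n::finite \<Rightarrow> real"
  assumes "open U" "smooth_on U f" "x \<in> U"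
  shows "iter_partial (as @ i # bs) f x = iter_partial (i # as @ bs) f x"
  using assms(3)
proof (induction as arbitrary: x)
  case Nil then show ?case by simp
next
  case (Cons a as)
  have "iter_partial ((a # as) @ i # bs) f x = partial_deriv a (iter_partial (i # as @ bs) f) x"
    using partial_deriv_cong[where f = "iter_partial (as @ i # bs) f" and g = "iter_partial (i # as @ bs) f",
        OF assms(1) Cons.prems Cons.IH] by simp
  also have "\<dots> = partial_deriv i (partial_deriv a (iter_partial (as @ bs) f)) x"
    using partial_deriv_commute[OF assms(1) Cons.prems smooth_on_iter_partial[OF assms(2)]] by simp
  finally show ?case by simp
qed

lemma iter_partial_perm:
  fixes f :: "real^'n::finite \<Rightarrow> real"
  assumes "open U" "smooth_on U f" "x \<in> U" "mset is = mset js"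
  shows "iter_partial is f x = iter_partial js f x"
  using assms(3,4)
proof (induction "is" arbitrary: x js)
  case Nil then show ?case by simp
next
  case (Cons i "is")
  then have "i \<in> set js" by (metis list.set_intros(1) mset_eq_setD)
  then obtain as bs where js: "js = as @ i # bs" by (meson split_list)
  then have "mset is = mset (as @ bs)" using Cons.prems(2) by simp
  then have "partial_deriv i (iter_partial is f) x = partial_deriv i (iter_partial (as @ bs) f) x"
    using Cons.IH by (intro partial_deriv_cong[OF assms(1) Cons.prems(1)])
  then show ?case using iter_partial_move[OF assms(1,2) Cons.prems(1), of as i bs] js by simp
qed

text \<open>\<open>mi_list\<close> is an arbitrary choice. Its multiset of entries is determined,
  and that is all that matters once mixed derivatives commute.\<close>

lemma count_mi_list: "count (mset (mi_list J)) i = J i"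
proof -
  obtain xs where xs: "mset xs = (\<Sum>i\<in>UNIV. replicate_mset (J i) i)" using ex_mset by blast
  have "count (mset xs) i = J i" for i
    unfolding xs by (simp add: count_sum sum.remove[of _ i])
  then have "\<forall>i. length (filter ((=) i) xs) = J i" by (simp add: count_mset count_list_eq_length_filter)
  then have "\<forall>i. length (filter ((=) i) (mi_list J)) = J i"
    unfolding mi_list_def by (rule someI[of "\<lambda>is. \<forall>i. length (filter ((=) i) is) = J i"])
  then show ?thesis by (simp add: count_mset count_list_eq_length_filter)
qed

lemma length_eq_sum_count: "length is = (\<Sum>i\<in>UNIV. count (mset is) (i :: 'n::finite))"
proof -
  have "length is = (\<Sum>i\<in>set_mset (mset is). count (mset is) i)"
    by (metis size_mset size_multiset_overloaded_eq)
  also have "\<dots> = (\<Sum>i\<in>UNIV. count (mset is) i)"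
    by (rule sum.mono_neutral_left) (auto simp: count_eq_zero_iff)
  finally show ?thesis .
qed

lemma length_mi_list: "length (mi_list J) = mi_order J"
  by (simp add: length_eq_sum_count count_mi_list mi_order_def)

text \<open>Every list is a permutation of the list chosen for its counts. Since \<open>P\<close>
  sees only an order and a value, one transfer serves flatness, the \<open>C\<^sub>M\<close>
  estimates and the Lojasiewicz condition.\<close>

lemma all_DJ_iff:
  fixes f :: "real^'n::finite \<Rightarrow> real"
  assumes "open U" "smooth_on U f" "x \<in> U"
  shows "(\<forall>J. P (mi_order J) (DJ J f x)) \<longleftrightarrow> (\<forall>is. P (length is) (iter_partial is f x))"
proof
  assume L: "\<forall>J. P (mi_order J) (DJ J f x)"
  show "\<forall>is. P (length is) (iter_partial is f x)"
  proof
    fix "is" :: "'n list"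
    let ?J = "count (mset is)"
    have "mset (mi_list ?J) = mset is" by (rule multiset_eqI) (simp add: count_mi_list)
    then have "DJ ?J f x = iter_partial is f x" "mi_order ?J = length is"
      unfolding DJ_def using iter_partial_perm[OF assms] mset_eq_length[of "mi_list ?J" "is"]
      by (blast, simp add: length_mi_list)
    then show "P (length is) (iter_partial is f x)" using L by metis
  qed
next
  assume "\<forall>is. P (length is) (iter_partial is f x)"
  then show "\<forall>J. P (mi_order J) (DJ J f x)"
    unfolding DJ_def length_mi_list[symmetric] by blast
qed

section \<open>Flatness, the class and the Lojasiewicz condition in terms of index lists\<close>

lemma flat_at_iff:
  fixes f :: "real^'n::finite \<Rightarrow> real"
  assumes "open U" "smooth_on U f" "x \<in> U"
  shows "flat_at f x \<longleftrightarrow> (\<forall>is. iter_partial is f x = 0)"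
  using all_DJ_iff[OF assms, of "\<lambda>_ y. y = 0"] by (simp add: flat_at_def)

lemma CM_iff:
  fixes f :: "real^'n::finite \<Rightarrow> real"
  assumes "open \<Omega>"
  shows "f \<in> CM M \<Omega> \<longleftrightarrow> smooth_on \<Omega> f \<and>
     (\<forall>K. compact K \<and> K \<subseteq> \<Omega> \<longrightarrow>
        (\<exists>C>0. \<exists>\<sigma>>0. \<forall>x\<in>K. \<forall>is.
           \<bar>iter_partial is f x\<bar> \<le> C * \<sigma> ^ length is * fact (length is) * M (length is)))"
proof (cases "smooth_on \<Omega> f")
  case True
  have "(\<forall>J. \<forall>x\<in>K. \<bar>DJ J f x\<bar> \<le> C * \<sigma> ^ mi_order J * fact (mi_order J) * M (mi_order J)) \<longleftrightarrow>
    (\<forall>x\<in>K. \<forall>is. \<bar>iter_partial is f x\<bar> \<le> C * \<sigma> ^ length is * fact (length is) * M (length is))"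
    if "K \<subseteq> \<Omega>" for K C \<sigma>
    using all_DJ_iff[OF assms True, of _ "\<lambda>j y. \<bar>y\<bar> \<le> C * \<sigma> ^ j * fact j * M j"] that by blast
  then show ?thesis unfolding CM_def using True by (auto 4 0)
qed (simp add: CM_def)

lemma CM_lojasiewicz_iff:
  fixes \<phi> :: "real^'n::finite \<Rightarrow> real"
  assumes "open (\<Omega> - zero_set \<Omega> \<phi>)" "smooth_on (\<Omega> - zero_set \<Omega> \<phi>) (\<lambda>y. 1 / \<phi> y)"
  shows "CM_lojasiewicz M \<Omega> \<phi> \<longleftrightarrow>
     (\<forall>K. compact K \<and> K \<subseteq> \<Omega> \<longrightarrow> (\<forall>lam>0. \<exists>C>0. \<exists>\<sigma>>0. \<forall>x\<in>K - zero_set \<Omega> \<phi>. \<forall>is.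
        \<bar>iter_partial is (\<lambda>y. 1 / \<phi> y) x\<bar> \<le>
          C * \<sigma> ^ length is * fact (length is) * M (length is) /
          (if zero_set \<Omega> \<phi> = {} then 1 else hM M (lam * infdist x (zero_set \<Omega> \<phi>)))))"
proof -
  have "(\<forall>J. \<forall>x\<in>K - zero_set \<Omega> \<phi>. \<bar>DJ J (\<lambda>y. 1 / \<phi> y) x\<bar> \<le>
          C * \<sigma> ^ mi_order J * fact (mi_order J) * M (mi_order J) /
          (if zero_set \<Omega> \<phi> = {} then 1 else hM M (lam * infdist x (zero_set \<Omega> \<phi>)))) \<longleftrightarrow>
    (\<forall>x\<in>K - zero_set \<Omega> \<phi>. \<forall>is. \<bar>iter_partial is (\<lambda>y. 1 / \<phi> y) x\<bar> \<le>
          C * \<sigma> ^ length is * fact (length is) * M (length is) /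
          (if zero_set \<Omega> \<phi> = {} then 1 else hM M (lam * infdist x (zero_set \<Omega> \<phi>))))"
    if "K \<subseteq> \<Omega>" for K C \<sigma> lam
    using all_DJ_iff[OF assms, of _ "\<lambda>j y. \<bar>y\<bar> \<le> C * \<sigma> ^ j * fact j * M j /
          (if zero_set \<Omega> \<phi> = {} then 1 else hM M (lam * infdist x (zero_set \<Omega> \<phi>)))" for x] that by blast
  then show ?thesis unfolding CM_lojasiewicz_def by (simp cong: conj_cong imp_cong)
qed

text \<open>Induction on \<open>k\<close>: the partial derivatives of \<open>f\<close> satisfy the
  hypotheses for the smaller order, and integrating their bound along the segment from
  \<open>a\<close> adds a power of the distance and a divisor \<open>k + 1\<close>. Summing over the
  coordinates gives one factor \<open>CARD('n)\<close> per order.\<close>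

lemma flat_taylor_bound:
  fixes f :: "real^'n::finite \<Rightarrow> real"
  assumes U: "open U" "smooth_on U f" "cball a R \<subseteq> U"
    and flat: "\<And>is. iter_partial is f a = 0"
    and bd: "\<And>is y. length is = k \<Longrightarrow> y \<in> cball a R \<Longrightarrow> \<bar>iter_partial is f y\<bar> \<le> B"
    and y: "y \<in> cball a R"
  shows "\<bar>f y\<bar> \<le> B * (real CARD('n) * dist a y) ^ k / fact k"
  using U(2) flat bd y
proof (induction k arbitrary: f y)
  case 0 then show ?case using "0.prems"(3)[of "[]" y] by simp
next
  case (Suc k)
  define N where "N = real CARD('n)"
  define v where "v = y - a"
  have yv: "dist a y = norm v" by (simp add: v_def dist_norm norm_minus_commute)
  have R: "norm v \<le> R" using Suc.prems(4) yv by simp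
  \<comment> \<open>Any list of length \<open>Suc k\<close> is a witness; \<open>undefined\<close>
    is an arbitrary coordinate.\<close>
  have B: "0 \<le> B" using Suc.prems(3)[of "replicate (Suc k) undefined" y] Suc.prems(4) by (smt (verit) length_replicate)
  have inR: "a + t *\<^sub>R v \<in> cball a R" if "0 \<le> t" "t \<le> 1" for t
  proof -
    have "t * norm v \<le> 1 * norm v" using that by (intro mult_right_mono) auto
    then show ?thesis using that R by (simp add: dist_norm)
  qed
  have d: "f differentiable (at (a + t *\<^sub>R v))" if "0 \<le> t" "t \<le> 1" for t
    using smooth_onD[OF Suc.prems(1), of _ "[]"] inR[OF that] U(3) by auto
  let ?g = "\<lambda>t. f (a + t *\<^sub>R v)" and ?g' = "\<lambda>t. \<Sum>i\<in>UNIV. v $ i * partial_deriv i f (a + t *\<^sub>R v)"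
  \<comment> \<open>The primitive, vanishing at 0, of the bound \<open>?h'\<close> for the
    derivative along the segment; its value at 1 is the claimed bound.\<close>
  let ?h = "\<lambda>t. B * (N * norm v) ^ Suc k * t ^ Suc k / fact (Suc k)"
  let ?h' = "\<lambda>t. B * (N * norm v) ^ Suc k * t ^ k / fact k"
  have pd: "\<bar>partial_deriv i f (a + t *\<^sub>R v)\<bar> \<le> B * (N * (t * norm v)) ^ k / fact k"
    if t: "0 \<le> t" "t \<le> 1" for i t
  proof -
    have "\<bar>partial_deriv i f (a + t *\<^sub>R v)\<bar> \<le> B * (real CARD('n) * dist a (a + t *\<^sub>R v)) ^ k / fact k"
    proof (rule Suc.IH)
      show "smooth_on U (partial_deriv i f)"
        using smooth_on_iter_partial[OF Suc.prems(1), of "[i]"] by simp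
      show "iter_partial is (partial_deriv i f) a = 0" for "is"
        using Suc.prems(2)[of "is @ [i]"] by (simp add: iter_partial_append)
      show "\<bar>iter_partial is (partial_deriv i f) y\<bar> \<le> B" if "length is = k" "y \<in> cball a R" for "is" y
        using Suc.prems(3)[of "is @ [i]" y] that by (simp add: iter_partial_append)
      show "a + t *\<^sub>R v \<in> cball a R" using inR t by blast
    qed
    then show ?thesis using t by (simp add: N_def dist_norm)
  qed
  have "norm (?g 1 - ?g 0) \<le> ?h 1 - ?h 0"
  proof (rule differentiable_bound_general[OF zero_less_one, where f' = ?g' and \<phi>' = ?h'])
    have gd: "(?g has_real_derivative ?g' t) (at t)" if "0 \<le> t" "t \<le> 1" for t
      by (rule has_real_derivative_along_line[OF d[OF that]])
    show "continuous_on {0..1} ?g"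
      using gd by (intro continuous_at_imp_continuous_on ballI DERIV_isCont) auto
    show "continuous_on {0..1} ?h" by (intro continuous_intros) auto
    show "(?g has_vector_derivative ?g' t) (at t)" if "0 < t" "t < 1" for t
      using gd that by (simp add: has_real_derivative_iff_has_vector_derivative)
    show "(?h has_vector_derivative ?h' t) (at t)" if "0 < t" "t < 1" for t
    proof -
      have "((\<lambda>t. B * (N * norm v) ^ Suc k / fact (Suc k) * t ^ Suc k) has_real_derivative
        B * (N * norm v) ^ Suc k / fact (Suc k) * (real (Suc k) * t ^ k)) (at t)"
        using DERIV_pow[of "Suc k" t UNIV] by (intro DERIV_cmult) (simp del: power_Suc of_nat_Suc)
      moreover have "c / fact (Suc k) * (real (Suc k) * s) = c * s / fact k" for c s :: real
        unfolding fact_Suc of_nat_mult by (simp del: of_nat_Suc)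
      ultimately show ?thesis
        by (simp add: has_real_derivative_iff_has_vector_derivative del: fact_Suc of_nat_Suc power_Suc)
    qed
    show "norm (?g' t) \<le> ?h' t" if t: "0 < t" "t < 1" for t
    proof -
      have "norm (?g' t) \<le> (\<Sum>i::'n\<in>UNIV. norm v * (B * (N * (t * norm v)) ^ k / fact k))"
      proof (rule order.trans[OF norm_sum], rule sum_mono)
        fix i :: 'n
        show "norm (v $ i * partial_deriv i f (a + t *\<^sub>R v)) \<le> norm v * (B * (N * (t * norm v)) ^ k / fact k)"
          unfolding real_norm_def abs_mult
          using pd[of t i] t component_le_norm_cart[of v i] by (intro mult_mono) auto
      qed
      also have "\<dots> = N * (norm v * (B * (N * (t * norm v)) ^ k / fact k))" by (simp add: N_def)
      also have "\<dots> = ?h' t" by (simp add: power_mult_distrib)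
      finally show ?thesis .
    qed
  qed
  moreover have "?g 1 = f y" "?g 0 = 0" using Suc.prems(2)[of "[]"] by (auto simp: v_def)
  ultimately show ?case by (simp add: yv N_def)
qed

section \<open>Strongly regular sequences\<close>

lemma fact_mult_le: "fact j * fact k \<le> (fact (j + k) :: real)"
proof -
  have "fact j * fact k \<le> (fact (j + k) :: nat)" by (intro dvd_imp_le fact_fact_dvd_fact) simp
  then have "real (fact j * fact k) \<le> real (fact (j + k))" by (simp only: of_nat_le_iff)
  then show ?thesis by (simp only: of_nat_fact of_nat_mult)
qed

lemma fact_add_le: "fact (j + k) \<le> (2 ^ (j + k) * (fact j * fact k) :: real)"
proof -
  have "fact (j + k) = fact j * fact k * ((j + k) choose j)"
    using binomial_fact_lemma[of j "j + k"] by simp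
  also have "\<dots> \<le> fact j * fact k * 2 ^ (j + k)"
    by (intro mult_left_mono binomial_le_pow2) simp
  finally have "fact (j + k) \<le> (2 ^ (j + k) * (fact j * fact k) :: nat)" by (simp only: mult_ac)
  then have "real (fact (j + k)) \<le> real (2 ^ (j + k) * (fact j * fact k))" by (simp only: of_nat_le_iff)
  then show ?thesis by (simp only: of_nat_fact of_nat_mult of_nat_power of_nat_numeral)
qed

text \<open>One term of the exponential series at \<open>k\<close>. It will turn the powers coming
  from \<open>k\<close> boxes of equal width into a factorial, at a price that is only geometric in
  \<open>k\<close>.\<close>

lemma power_le_fact_exp: "real k ^ j \<le> fact j * exp 1 ^ k"
proof -
  have "real k ^ j /\<^sub>R fact j \<le> exp (real k)"
    unfolding exp_def using sum_le_suminf[OF summable_exp_generic[of "real k"], of "{j}"] by simp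
  then have "real k ^ j \<le> fact j * exp (real k)" by (simp add: field_simps)
  then show ?thesis by (simp add: exp_of_nat_mult[symmetric])
qed

lemma CM_bounds:
  fixes f :: "real^'n::finite \<Rightarrow> real"
  assumes O: "open \<Omega>" and f: "f \<in> CM M \<Omega>" and K: "compact K" "K \<subseteq> \<Omega>"
  obtains C \<sigma> where "C > 0" "\<sigma> > 0"
    "\<And>x is. x \<in> K \<Longrightarrow> \<bar>iter_partial is f x\<bar> \<le> C * \<sigma> ^ length is * fact (length is) * M (length is)"
proof -
  have "\<exists>C>0. \<exists>\<sigma>>0. \<forall>x\<in>K. \<forall>is. \<bar>iter_partial is f x\<bar> \<le> C * \<sigma> ^ length is * fact (length is) * M (length is)"
    using f[unfolded CM_iff[OF O], THEN conjunct2, rule_format, OF conjI[OF K]] .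
  then show thesis using that by meson
qed

text \<open>Taylor estimates at points of \<open>X\<close> near \<open>K\<close> need bounds on a
  whole neighbourhood of \<open>K\<close>.\<close>

lemma compact_thickening:
  fixes K :: "(real^'n::finite) set"
  assumes "open \<Omega>" "compact K" "K \<subseteq> \<Omega>"
  obtains e K' where "e > 0" "compact K'" "K' \<subseteq> \<Omega>" "\<And>x. x \<in> K \<Longrightarrow> cball x e \<subseteq> K'"
proof -
  obtain e where e: "e > 0" "(\<Union>x\<in>K. cball x e) \<subseteq> \<Omega>"
    using compact_subset_open_imp_cball_epsilon_subset assms by metis
  let ?K' = "{x + y | x y. x \<in> K \<and> y \<in> cball (0 :: real^'n) e}"
  have "compact ?K'" using assms(2) compact_cball by (rule compact_sums)
  moreover have "?K' \<subseteq> \<Omega>"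
  proof clarify
    fix x y :: "real^'n" assume "x \<in> K" "y \<in> cball 0 e"
    then have "x + y \<in> cball x e" by (simp add: dist_norm)
    then show "x + y \<in> \<Omega>" using e(2) \<open>x \<in> K\<close> by blast
  qed
  moreover have "cball x e \<subseteq> ?K'" if "x \<in> K" for x
  proof
    fix z assume "z \<in> cball x e"
    then have "z - x \<in> cball 0 e" by (simp add: dist_norm norm_minus_commute)
    then show "z \<in> ?K'" using that by (intro CollectI exI[of _ x] exI[of _ "z - x"]) auto
  qed
  ultimately show thesis using that e(1) by blast
qed

lemma infdist_near_point:
  assumes "X \<noteq> {}" "infdist x X < d"
  obtains b where "b \<in> X" "dist x b < d"
proof -
  have "(INF b\<in>X. dist x b) < d" using assms by (simp add: infdist_notempty)
  then obtain b where "b \<in> X" "dist x b < d"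
    using assms(1) cInf_lessD[of "dist x ` X" d] by auto
  then show thesis by (rule that)
qed

locale strongly_regular_seq =
  fixes M :: "nat \<Rightarrow> real"
  assumes strongly_regular: "strongly_regular M"
begin

lemma M_0: "M 0 = 1" and M_mono: "mono M" and M_ratio_mono: "mono (\<lambda>j. M (Suc j) / M j)"
  using strongly_regular by (auto simp: strongly_regular_def)

lemma M_ge_1: "1 \<le> M j"
  using monoD[OF M_mono, of 0 j] M_0 by simp

lemma M_pos: "0 < M j"
  using M_ge_1[of j] by linarith

lemma M_nonneg: "0 \<le> M j"
  using M_pos[of j] by linarith

text \<open>Log-convexity: raising \<open>k\<close> by one multiplies the left side by the ratio at
  \<open>k\<close>, and the right side by the ratio at \<open>j + k\<close>, which is at least as
  large.\<close>

lemma M_mult_le: "M j * M k \<le> M (j + k)"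
proof (induction k)
  case 0 then show ?case by (simp add: M_0)
next
  case (Suc k)
  have "M j * M (Suc k) = M (Suc k) / M k * (M j * M k)" using M_pos[of k] by simp
  also have "\<dots> \<le> M (Suc (j + k)) / M (j + k) * M (j + k)"
    using monoD[OF M_ratio_mono, of k "j + k"] Suc M_nonneg
    by (intro mult_mono) (auto intro!: mult_nonneg_nonneg divide_nonneg_nonneg)
  also have "\<dots> = M (j + Suc k)" using M_pos[of "j + k"] by simp
  finally show ?case .
qed

lemma moderate_growth:
  obtains A where "A \<ge> 1" "\<And>j k. M (j + k) \<le> A ^ (j + k) * M j * M k"
proof -
  obtain A where A: "A > 0" "\<And>j k. M (j + k) \<le> A ^ (j + k) * M j * M k"
    using strongly_regular by (auto simp: strongly_regular_def)
  have "M (j + k) \<le> max 1 A ^ (j + k) * M j * M k" for j k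
  proof -
    have "A ^ (j + k) \<le> max 1 A ^ (j + k)" using A(1) by (intro power_mono) auto
    then have "A ^ (j + k) * M j * M k \<le> max 1 A ^ (j + k) * M j * M k"
      using M_nonneg by (intro mult_right_mono) auto
    then show ?thesis using A(2)[of j k] by linarith
  qed
  then show thesis using that[of "max 1 A"] by auto
qed

lemma ratio_tail_sum:
  obtains A where "A > 0"
    "\<And>k. summable (\<lambda>j. M (j + k) / (real (j + k + 1) * M (j + k + 1)))"
    "\<And>k. (\<Sum>j. M (j + k) / (real (j + k + 1) * M (j + k + 1))) \<le> A * (M k / M (k + 1))"
  using strongly_regular unfolding strongly_regular_def by blast

text \<open>If the ratios were bounded, the series of the strong regularity condition would dominate
  a multiple of the harmonic series.\<close>

lemma ratio_unbounded: "\<exists>k. M (Suc k) / M k > b"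
proof (rule ccontr)
  assume "\<not> ?thesis"
  then have b: "M (Suc k) / M k \<le> b" for k by (simp add: not_less)
  have "b > 0" using b[of 0] divide_pos_pos[OF M_pos M_pos, of "Suc 0" 0] by linarith
  obtain A where "\<And>k. summable (\<lambda>j. M (j + k) / (real (j + k + 1) * M (j + k + 1)))"
    using ratio_tail_sum by blast
  from this[of 0] have s: "summable (\<lambda>j. M j / (real (j + 1) * M (j + 1)))" by simp
  have "summable (\<lambda>j. 1 / b * inverse (real (Suc j)))"
  proof (rule summable_comparison_test'[OF s])
    fix j :: nat
    have "M (Suc j) \<le> b * M j" using b[of j] M_pos[of j] by (simp add: field_simps)
    then have "1 / b \<le> M j / M (Suc j)"
      using M_pos[of "Suc j"] \<open>b > 0\<close> by (simp add: divide_simps mult.commute)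
    then have "1 / b * inverse (real (Suc j)) \<le> M j / M (Suc j) * inverse (real (Suc j))"
      by (intro mult_right_mono) auto
    then show "norm (1 / b * inverse (real (Suc j))) \<le> M j / (real (j + 1) * M (j + 1))"
      using \<open>b > 0\<close> by (simp add: divide_inverse mult_ac)
  qed
  then have "summable (\<lambda>j. b * (1 / b * inverse (real (Suc j))))" by (rule summable_mult)
  then have "summable (\<lambda>j. inverse (real (Suc j)))" using \<open>b > 0\<close> by simp
  then show False using not_summable_harmonic[where 'a = real] summable_Suc_iff[of "\<lambda>n. inverse (real n)"] by simp
qed

text \<open>Passing from \<open>j\<close> to \<open>j + 1\<close> multiplies
  \<open>t ^ j * M j\<close> by a factor that is nondecreasing in \<open>j\<close>, so the minimum
  sits at the first index where this factor exceeds 1. The strict inequality is recorded because it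
  later controls the tail of the box widths.\<close>

lemma optimal_index:
  assumes t: "t > 0"
  obtains k where "M (Suc k) / M k * t > 1" "\<And>j. t ^ k * M k \<le> t ^ j * M j"
proof -
  let ?P = "\<lambda>k. M (Suc k) / M k * t > 1"
  obtain k0 where "M (Suc k0) / M k0 > 1 / t" using ratio_unbounded by blast
  then have "?P k0" using t by (simp add: field_simps)
  define k where "k = (LEAST k. ?P k)"
  have k: "?P k" unfolding k_def by (rule LeastI[of ?P, OF \<open>?P k0\<close>])
  have step: "t ^ Suc j * M (Suc j) = (M (Suc j) / M j * t) * (t ^ j * M j)" for j
    using M_pos[of j] by simp
  have pos: "t ^ j * M j > 0" for j using t M_pos by simp
  have up: "t ^ k * M k \<le> t ^ (k + j) * M (k + j)" for j
  proof (induction j)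
    case (Suc j)
    have "M (Suc k) / M k \<le> M (Suc (k + j)) / M (k + j)" using monoD[OF M_ratio_mono, of k "k + j"] by simp
    then have "M (Suc k) / M k * t \<le> M (Suc (k + j)) / M (k + j) * t" using t by (intro mult_right_mono) auto
    then have "1 * (t ^ (k + j) * M (k + j)) \<le> (M (Suc (k + j)) / M (k + j) * t) * (t ^ (k + j) * M (k + j))"
      using pos[of "k + j"] k by (intro mult_right_mono) auto
    then show ?case using Suc.IH step[of "k + j"] by simp
  qed simp
  have down: "t ^ k * M k \<le> t ^ (k - j) * M (k - j)" for j
  proof (induction j)
    case (Suc j)
    show ?case
    proof (cases "k - j")
      case 0 then show ?thesis using Suc by simp
    next
      case (Suc i)
      then have "\<not> ?P i" unfolding k_def by (intro not_less_Least) simp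
      then have "(M (Suc i) / M i * t) * (t ^ i * M i) \<le> 1 * (t ^ i * M i)"
        using pos[of i] by (intro mult_right_mono) auto
      then have "t ^ Suc i * M (Suc i) \<le> t ^ i * M i" using step[of i] by simp
      moreover have "k - Suc j = i" using Suc by simp
      ultimately show ?thesis using Suc.IH \<open>k - j = Suc i\<close> by simp
    qed
  qed simp
  have "t ^ k * M k \<le> t ^ j * M j" for j
    using up[of "j - k"] down[of "k - j"] by (cases "j \<le> k") auto
  then show thesis using k that by blast
qed

section \<open>The function \<open>hM\<close> and moderate growth\<close>

lemma hM_le: "t > 0 \<Longrightarrow> hM M t \<le> t ^ j * M j"
  unfolding hM_def using M_nonneg
  by (auto intro!: cINF_lower bdd_belowI2[of _ 0])

lemma hM_ge: "t > 0 \<Longrightarrow> (\<And>j. c \<le> t ^ j * M j) \<Longrightarrow> c \<le> hM M t"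
  unfolding hM_def by (auto intro!: cINF_greatest)

lemma hM_attained:
  assumes "t > 0" obtains k where "hM M t = t ^ k * M k"
proof -
  obtain k where "\<And>j. t ^ k * M k \<le> t ^ j * M j" using optimal_index[OF assms] by blast
  then have "hM M t = t ^ k * M k" using hM_le[OF assms] hM_ge[OF assms] by (meson order.antisym)
  then show thesis by (rule that)
qed

lemma hM_pos: "t > 0 \<Longrightarrow> hM M t > 0"
  by (rule hM_attained[of t]) (auto simp: M_pos)

lemma hM_le_1: "t > 0 \<Longrightarrow> hM M t \<le> 1"
  using hM_le[of t 0] by (simp add: M_0)

lemma hM_mono: "0 < s \<Longrightarrow> s \<le> t \<Longrightarrow> hM M s \<le> hM M t"
proof (rule hM_ge)
  fix j assume st: "0 < s" "s \<le> t"
  have "hM M s \<le> s ^ j * M j" using st by (intro hM_le)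
  also have "\<dots> \<le> t ^ j * M j" using st M_nonneg by (intro mult_right_mono power_mono) auto
  finally show "hM M s \<le> t ^ j * M j" .
qed auto

text \<open>If \<open>k\<close> realises the infimum at \<open>A * t\<close>, test the infimum at
  \<open>t\<close> with the index \<open>2 * k\<close> and split \<open>M (k + k)\<close> by
  moderate growth.\<close>

lemma hM_square:
  obtains A where "A \<ge> 1" "\<And>t. t > 0 \<Longrightarrow> hM M t \<le> hM M (A * t) ^ 2"
proof -
  obtain A where A: "A \<ge> 1" "\<And>j k. M (j + k) \<le> A ^ (j + k) * M j * M k" using moderate_growth by blast
  have "hM M t \<le> hM M (A * t) ^ 2" if t: "t > 0" for t
  proof -
    have "A * t > 0" using A t by simp
    then obtain k where k: "hM M (A * t) = (A * t) ^ k * M k" by (rule hM_attained)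
    have "hM M t \<le> t ^ (k + k) * M (k + k)" using t by (rule hM_le)
    also have "\<dots> \<le> t ^ (k + k) * (A ^ (k + k) * M k * M k)" using t A(2) by (intro mult_left_mono) auto
    also have "\<dots> = hM M (A * t) ^ 2"
      unfolding k by (simp only: power_add power2_eq_square power_mult_distrib mult_ac)
    finally show ?thesis .
  qed
  then show thesis using A(1) that by blast
qed

text \<open>Iterates \<open>hM_square\<close>, one factor per step, using monotonicity to give all
  factors the same argument. The power is needed because a product of one-dimensional cutoffs, one
  per coordinate, multiplies their bounds.\<close>

lemma hM_power:
  obtains B where "B \<ge> 1" "\<And>t. t > 0 \<Longrightarrow> hM M t \<le> hM M (B * t) ^ n"
proof (induction n arbitrary: thesis)
  case 0
  then show ?case using hM_le_1 by (intro "0.prems"[of 1]) auto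
next
  case (Suc n)
  obtain A where A: "A \<ge> 1" "\<And>t. t > 0 \<Longrightarrow> hM M t \<le> hM M (A * t) ^ 2" using hM_square by blast
  obtain B where B: "B \<ge> 1" "\<And>t. t > 0 \<Longrightarrow> hM M t \<le> hM M (B * t) ^ n" using Suc.IH by blast
  show ?case
  proof (rule Suc.prems[of "B * A"])
    show "1 \<le> B * A" using A B by (metis mult_mono' mult_1 zero_le_one)
    fix t :: real assume t: "t > 0"
    then have t': "A * t > 0" "B * A * t > 0" using A B by auto
    have "A * t \<le> B * A * t" using mult_right_mono[OF B(1), of "A * t"] t'(1) by (simp add: mult.assoc)
    have "hM M t \<le> hM M (A * t) * hM M (A * t)" using A(2)[OF t] by (simp add: power2_eq_square)
    also have "\<dots> \<le> hM M (B * A * t) * hM M (B * (A * t)) ^ n"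
      using hM_mono[OF t'(1) \<open>A * t \<le> B * A * t\<close>] B(2)[OF t'(1)] less_imp_le[OF hM_pos] t'
      by (intro mult_mono) auto
    finally show "hM M t \<le> hM M (B * A * t) ^ Suc n" by (simp add: mult.assoc)
  qed
qed

section \<open>Products in the class and decay near flat points\<close>

lemma weight_mult_le: "fact j * M j * (fact k * M k) \<le> fact (j + k) * M (j + k)"
proof -
  have "fact j * fact k * (M j * M k) \<le> fact (j + k) * M (j + k)"
    using M_mult_le fact_mult_le M_nonneg by (intro mult_mono) (auto intro!: mult_nonneg_nonneg)
  then show ?thesis by (simp only: mult_ac)
qed

text \<open>In each Leibniz term \<open>M_mult_le\<close> merges the weights, and
  \<open>splits_sum_fact\<close> adds up the factorials; the surplus \<open>n + 1\<close>, with
  \<open>n\<close> the order, is at most \<open>2 ^ n\<close>, whence the 2. The bound is pointwise,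
  so \<open>C\<close> and \<open>D\<close> may depend on \<open>x\<close>, as they do when they
  contain values of \<open>hM\<close>.\<close>

lemma iter_partial_mult_bound:
  fixes f g :: "real^'n::finite \<Rightarrow> real"
  assumes U: "open U" "smooth_on U f" "smooth_on U g" "x \<in> U"
    and f: "\<And>is. \<bar>iter_partial is f x\<bar> \<le> C * \<sigma> ^ length is * fact (length is) * M (length is)"
    and g: "\<And>is. \<bar>iter_partial is g x\<bar> \<le> D * \<tau> ^ length is * fact (length is) * M (length is)"
    and pos: "\<sigma> > 0" "\<tau> > 0"
  shows "\<bar>iter_partial is (\<lambda>y. f y * g y) x\<bar> \<le> C * D * (2 * max \<sigma> \<tau>) ^ length is * fact (length is) * M (length is)"
proof -
  define s where "s = max \<sigma> \<tau>"
  have s: "s > 0" using pos by (simp add: s_def)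
  have "0 \<le> \<bar>iter_partial [] f x\<bar>" "0 \<le> \<bar>iter_partial [] g x\<bar>" by simp_all
  then have C: "0 \<le> C" "0 \<le> D" using f[of "[]"] g[of "[]"] M_0 by simp_all
  let ?n = "length is"
  have "\<bar>iter_partial is (\<lambda>y. f y * g y) x\<bar> \<le> (\<Sum>p\<leftarrow>splits is. \<bar>iter_partial (fst p) f x * iter_partial (snd p) g x\<bar>)"
    unfolding iter_partial_mult[OF U] using sum_list_abs[of "map (\<lambda>p. iter_partial (fst p) f x * iter_partial (snd p) g x) (splits is)"]
    by (simp add: comp_def)
  also have "\<dots> \<le> (\<Sum>p\<leftarrow>splits is. C * D * s ^ ?n * M ?n * (fact (length (fst p)) * fact (length (snd p))))"
  proof (rule sum_list_mono)
    fix p assume "p \<in> set (splits is)"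
    then have n: "?n = length (fst p) + length (snd p)" by (simp add: splits_length)
    define a where "a = length (fst p)"
    define b where "b = length (snd p)"
    have n: "?n = a + b" using n by (simp add: a_def b_def)
    have le: "\<sigma> ^ a \<le> s ^ a" "\<tau> ^ b \<le> s ^ b" using pos by (auto simp: s_def intro!: power_mono)
    have "\<bar>iter_partial (fst p) f x * iter_partial (snd p) g x\<bar> \<le>
      (C * \<sigma> ^ a * fact a * M a) * (D * \<tau> ^ b * fact b * M b)"
      unfolding abs_mult using f[of "fst p"] g[of "snd p"]
      unfolding a_def[symmetric] b_def[symmetric]
      using C pos M_nonneg by (intro mult_mono) (auto intro!: mult_nonneg_nonneg)
    also have "\<dots> = C * D * (\<sigma> ^ a * \<tau> ^ b) * (M a * M b) * (fact a * fact b)" by (simp only: mult_ac)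
    also have "\<dots> \<le> C * D * (s ^ a * s ^ b) * M (a + b) * (fact a * fact b)"
      using C s pos le M_mult_le[of a b] M_nonneg
      by (intro mult_right_mono mult_mono) (auto intro!: mult_nonneg_nonneg)
    finally show "\<bar>iter_partial (fst p) f x * iter_partial (snd p) g x\<bar>
       \<le> C * D * s ^ ?n * M ?n * (fact (length (fst p)) * fact (length (snd p)))"
      unfolding n power_add a_def b_def .
  qed
  also have "\<dots> = C * D * s ^ ?n * M ?n * fact (Suc ?n)"
    unfolding sum_list_const_mult splits_sum_fact ..
  also have "\<dots> \<le> C * D * s ^ ?n * M ?n * (2 ^ ?n * fact ?n)"
  proof (intro mult_left_mono)
    have "real (Suc ?n) \<le> 2 ^ ?n"
      using less_exp[of ?n] by (metis Suc_leI of_nat_le_iff of_nat_numeral of_nat_power)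
    then show "fact (Suc ?n) \<le> (2 ^ ?n * fact ?n :: real)"
      unfolding fact_Suc by (intro mult_right_mono) auto
  qed (use C s M_nonneg in \<open>auto intro!: mult_nonneg_nonneg\<close>)
  also have "\<dots> = C * D * (2 * s) ^ ?n * fact ?n * M ?n" by (simp only: power_mult_distrib mult_ac)
  finally show ?thesis unfolding s_def .
qed

lemma CM_mult:
  fixes f g :: "real^'n::finite \<Rightarrow> real"
  assumes O: "open \<Omega>" and f: "f \<in> CM M \<Omega>" and g: "g \<in> CM M \<Omega>"
  shows "(\<lambda>y. f y * g y) \<in> CM M \<Omega>"
proof -
  have s: "smooth_on \<Omega> f" "smooth_on \<Omega> g" using f g by (auto simp: CM_def)
  show ?thesis unfolding CM_iff[OF O]
  proof (intro conjI allI impI)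
    show "smooth_on \<Omega> (\<lambda>y. f y * g y)" using O s by (rule smooth_on_mult)
    fix K assume K: "compact K \<and> K \<subseteq> \<Omega>"
    obtain C \<sigma> where 1: "C > 0" "\<sigma> > 0"
      "\<And>x is. x \<in> K \<Longrightarrow> \<bar>iter_partial is f x\<bar> \<le> C * \<sigma> ^ length is * fact (length is) * M (length is)"
      using CM_bounds[OF O f] K by blast
    obtain D \<tau> where 2: "D > 0" "\<tau> > 0"
      "\<And>x is. x \<in> K \<Longrightarrow> \<bar>iter_partial is g x\<bar> \<le> D * \<tau> ^ length is * fact (length is) * M (length is)"
      using CM_bounds[OF O g] K by blast
    show "\<exists>C>0. \<exists>\<sigma>>0. \<forall>x\<in>K. \<forall>is. \<bar>iter_partial is (\<lambda>y. f y * g y) x\<bar> \<le> C * \<sigma> ^ length is * fact (length is) * M (length is)"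
    proof (rule exI[of _ "C * D"], rule conjI, simp add: 1 2, rule exI[of _ "2 * max \<sigma> \<tau>"], intro conjI ballI allI)
      fix x and "is" :: "'n list" assume "x \<in> K"
      then show "\<bar>iter_partial is (\<lambda>y. f y * g y) x\<bar> \<le> C * D * (2 * max \<sigma> \<tau>) ^ length is * fact (length is) * M (length is)"
        using K 1 2 by (intro iter_partial_mult_bound[OF O s]) auto
    qed (use 1 2 in auto)
  qed
qed

text \<open>Taylor's bound is used for all orders \<open>k\<close> at once. The weight at
  \<open>j + k\<close> splits into weights at \<open>j\<close> and \<open>k\<close>, at the cost of
  2 (factorials) and \<open>A\<close> (moderate growth) per order; the best choice of
  \<open>k\<close> then produces \<open>hM\<close>, and \<open>CARD('n)\<close> is inherited from
  Taylor.\<close>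

lemma flat_estimate_at:
  fixes f :: "real^'n::finite \<Rightarrow> real"
  assumes O: "open \<Omega>" "smooth_on \<Omega> f" "cball b R \<subseteq> \<Omega>"
    and flat: "\<And>is. iter_partial is f b = 0"
    and bd: "\<And>is y. y \<in> cball b R \<Longrightarrow> \<bar>iter_partial is f y\<bar> \<le> C * \<sigma> ^ length is * fact (length is) * M (length is)"
    and pos: "C > 0" "\<sigma> > 0" and x: "x \<in> cball b R" "x \<noteq> b"
    and A: "A \<ge> 1" "\<And>j k. M (j + k) \<le> A ^ (j + k) * M j * M k"
  shows "\<bar>iter_partial is f x\<bar> \<le>
    C * (2 * A * \<sigma>) ^ length is * fact (length is) * M (length is) * hM M (2 * A * \<sigma> * real CARD('n) * dist b x)"
proof -
  define j where "j = length is"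
  define W where "W = C * (2 * A * \<sigma>) ^ j * fact j * M j"
  define N where "N = real CARD('n)"
  have N: "N > 0" by (simp add: N_def)
  have W: "W > 0" using pos A(1) M_pos[of j] by (auto simp: W_def)
  let ?d = "dist b x"
  have d: "?d > 0" using x by auto
  have "\<bar>iter_partial is f x\<bar> / W \<le> hM M (2 * A * \<sigma> * N * ?d)"
  proof (rule hM_ge)
    show "0 < 2 * A * \<sigma> * N * ?d" using pos A d N by simp
    fix k
    have "\<bar>iter_partial is f x\<bar> \<le> (C * \<sigma> ^ (j + k) * fact (j + k) * M (j + k)) * (N * ?d) ^ k / fact k"
      unfolding N_def
    proof (rule flat_taylor_bound[OF O(1) smooth_on_iter_partial[OF O(2)] O(3)])
      show "iter_partial is' (iter_partial is f) b = 0" for is'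
        using flat[of "is' @ is"] by (simp add: iter_partial_append)
      show "\<bar>iter_partial is' (iter_partial is f) y\<bar> \<le> C * \<sigma> ^ (j + k) * fact (j + k) * M (j + k)"
        if "length is' = k" "y \<in> cball b R" for is' y
        using bd[OF that(2), of "is' @ is"] that by (simp add: iter_partial_append j_def add.commute)
    qed (use x in auto)
    also have "\<dots> \<le> (C * \<sigma> ^ (j + k) * (2 ^ (j + k) * (fact j * fact k)) * (A ^ (j + k) * M j * M k)) * (N * ?d) ^ k / fact k"
      using pos A M_nonneg fact_add_le[of j k] N d
      by (intro divide_right_mono mult_right_mono mult_mono mult_left_mono) (auto intro!: mult_nonneg_nonneg)
    also have "\<dots> = W * ((2 * A * \<sigma> * N * ?d) ^ k * M k)"
      unfolding W_def power_mult_distrib power_add by (simp only: mult_ac times_divide_eq_right) simp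
    finally have "\<bar>iter_partial is f x\<bar> \<le> W * ((2 * A * \<sigma> * N * ?d) ^ k * M k)" .
    then show "\<bar>iter_partial is f x\<bar> / W \<le> (2 * A * \<sigma> * N * ?d) ^ k * M k"
      using W by (simp add: pos_divide_le_eq mult.commute)
  qed
  then have "\<bar>iter_partial is f x\<bar> \<le> W * hM M (2 * A * \<sigma> * N * ?d)"
    using W by (simp add: pos_divide_le_eq mult.commute)
  then show ?thesis by (simp add: W_def j_def N_def)
qed

text \<open>Near \<open>X\<close> the expansion is made at a point \<open>b\<close> of
  \<open>X\<close> at less than twice the distance, since the infimum of the distances need not be
  attained in \<open>X\<close>. Away from \<open>X\<close> the factor \<open>hM\<close> is bounded
  below, and the plain bounds for \<open>f\<close> suffice.\<close>

lemma flat_estimate: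
  fixes f :: "real^'n::finite \<Rightarrow> real"
  assumes O: "open \<Omega>" and f: "f \<in> CM M \<Omega>" and X: "X \<noteq> {}" "X \<subseteq> \<Omega>"
    and flat: "\<And>a is. a \<in> X \<Longrightarrow> iter_partial is f a = 0"
    and K: "compact K" "K \<subseteq> \<Omega>"
  obtains C \<sigma> lam where "C > 0" "\<sigma> > 0" "lam > 0"
    "\<And>x is. x \<in> K \<Longrightarrow> infdist x X > 0 \<Longrightarrow> \<bar>iter_partial is f x\<bar> \<le>
      C * \<sigma> ^ length is * fact (length is) * M (length is) * hM M (lam * infdist x X)"
proof -
  have s: "smooth_on \<Omega> f" using f by (simp add: CM_def)
  obtain e K' where K': "e > 0" "compact K'" "K' \<subseteq> \<Omega>" "\<And>x. x \<in> K \<Longrightarrow> cball x e \<subseteq> K'"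
    using compact_thickening[OF O K] by blast
  obtain C \<sigma> where pos: "C > 0" "\<sigma> > 0" and
    bd: "\<And>x is. x \<in> K' \<Longrightarrow> \<bar>iter_partial is f x\<bar> \<le> C * \<sigma> ^ length is * fact (length is) * M (length is)"
    using CM_bounds[OF O f K'(2,3)] by blast
  obtain A where A: "A \<ge> 1" "\<And>j k. M (j + k) \<le> A ^ (j + k) * M j * M k" using moderate_growth by blast
  define N where "N = real CARD('n)"
  have N: "N > 0" by (simp add: N_def)
  \<comment> \<open>The last 2 pays for \<open>dist x b < 2 * d\<close>.\<close>
  define lam where "lam = 2 * A * \<sigma> * N * 2"
  have lam: "lam > 0" using A pos N by (simp add: lam_def)
  \<comment> \<open>The two cases meet at distance \<open>e / 4\<close>: below it, the ball of
    radius \<open>2 * d\<close> around \<open>b\<close> stays within \<open>e\<close> of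
    \<open>x\<close>; beyond it, \<open>hM\<close> is at least \<open>H\<close>, which the constant
    \<open>C / H\<close> compensates.\<close>
  define H where "H = hM M (lam * (e / 4))"
  have H: "H > 0" "H \<le> 1" using hM_pos hM_le_1 lam K' by (auto simp: H_def)
  show thesis
  proof (rule that[of "C / H" "2 * A * \<sigma>" lam])
    show "C / H > 0" "2 * A * \<sigma> > 0" "lam > 0" using pos H A lam by auto
    fix x and "is" :: "'n list" assume x: "x \<in> K" and d0: "infdist x X > 0"
    define d where "d = infdist x X"
    define Q where "Q = (2 * A * \<sigma>) ^ length is * fact (length is) * M (length is)"
    have Q: "Q \<ge> 0" using A pos M_nonneg by (auto simp: Q_def intro!: mult_nonneg_nonneg)
    have d: "d > 0" using d0 by (simp add: d_def)
    have h: "hM M (lam * d) > 0" using lam d by (intro hM_pos) auto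
    have "\<bar>iter_partial is f x\<bar> \<le> C / H * Q * hM M (lam * d)"
    proof (cases "d < e / 4")
      case True
      obtain b where b: "b \<in> X" "dist x b < 2 * d"
        using infdist_near_point[of X x "2 * d"] X d unfolding d_def by auto
      have cb: "cball b (2 * d) \<subseteq> K'"
      proof
        fix y assume "y \<in> cball b (2 * d)"
        then have "dist x y \<le> e" using dist_triangle[of x y b] b True by simp
        then show "y \<in> K'" using K'(4)[OF x] by auto
      qed
      have "x \<noteq> b" using d b unfolding d_def by auto
      have "\<bar>iter_partial is f x\<bar> \<le> C * (2 * A * \<sigma>) ^ length is * fact (length is) * M (length is) * hM M (2 * A * \<sigma> * real CARD('n) * dist b x)"
        by (rule flat_estimate_at[OF O s order.trans[OF cb K'(3)] flat[OF b(1)] bd[OF subsetD[OF cb]] pos _ \<open>x \<noteq> b\<close> A])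
          (use b in \<open>auto simp: dist_commute\<close>)
      also have "\<dots> = C * Q * hM M (2 * A * \<sigma> * N * dist b x)" by (simp add: Q_def N_def)
      also have "\<dots> \<le> C * Q * hM M (lam * d)"
      proof (intro mult_left_mono hM_mono)
        show "0 < 2 * A * \<sigma> * N * dist b x" using A pos N \<open>x \<noteq> b\<close> by auto
        have "2 * A * \<sigma> * N * dist b x \<le> 2 * A * \<sigma> * N * (2 * d)"
          using A pos N b by (intro mult_left_mono) (auto simp: dist_commute)
        then show "2 * A * \<sigma> * N * dist b x \<le> lam * d" by (simp add: lam_def mult.assoc)
      qed (use pos Q in auto)
      also have "\<dots> \<le> C / H * Q * hM M (lam * d)"
        using H pos Q h by (intro mult_right_mono) (auto simp: pos_le_divide_eq mult_left_le)
      finally show ?thesis .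
    next
      case False
      have "\<sigma> ^ length is \<le> (2 * A * \<sigma>) ^ length is"
        using A pos by (intro power_mono) auto
      then have "C * \<sigma> ^ length is * fact (length is) * M (length is) \<le> C * (2 * A * \<sigma>) ^ length is * fact (length is) * M (length is)"
        using pos M_nonneg by (intro mult_right_mono mult_left_mono) auto
      then have "\<bar>iter_partial is f x\<bar> \<le> C * Q"
        using bd[of x "is"] K'(4)[OF x] K'(1) by (force simp: Q_def mult_ac)
      also have "\<dots> = C / H * Q * H" using H by simp
      also have "\<dots> \<le> C / H * Q * hM M (lam * d)"
        unfolding H_def using False lam K'(1) pos H Q H_def
        by (intro mult_left_mono hM_mono) auto
      finally show ?thesis .
    qed
    then show "\<bar>iter_partial is f x\<bar> \<le> C / H * (2 * A * \<sigma>) ^ length is * fact (length is) * M (length is) * hM M (lam * infdist x X)"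
      by (simp add: Q_def d_def mult_ac)
  qed
qed

end

section \<open>Consequences of the Lojasiewicz condition\<close>

lemma CM_subset: "f \<in> CM M \<Omega> \<Longrightarrow> \<Omega>' \<subseteq> \<Omega> \<Longrightarrow> f \<in> CM M \<Omega>'"
  unfolding CM_def by (auto intro: smooth_on_subset)

lemma CM_cong:
  fixes f g :: "real^'n::finite \<Rightarrow> real"
  assumes O: "open \<Omega>" and eq: "\<And>x. x \<in> \<Omega> \<Longrightarrow> f x = g x" and f: "f \<in> CM M \<Omega>"
  shows "g \<in> CM M \<Omega>"
proof -
  have "iter_partial is f x = iter_partial is g x" if "x \<in> \<Omega>" for x "is"
    using O eq that by (rule iter_partial_cong)
  then have D: "DJ J f x = DJ J g x" if "x \<in> \<Omega>" for x J using that by (simp add: DJ_def)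
  have "smooth_on \<Omega> g" using f smooth_on_cong[OF O eq] by (simp add: CM_def)
  moreover have "\<exists>C>0. \<exists>\<sigma>>0. \<forall>J. \<forall>x\<in>K. \<bar>DJ J g x\<bar> \<le> C * \<sigma> ^ mi_order J * fact (mi_order J) * M (mi_order J)"
    if K: "compact K \<and> K \<subseteq> \<Omega>" for K
  proof -
    have "\<exists>C>0. \<exists>\<sigma>>0. \<forall>J. \<forall>x\<in>K. \<bar>DJ J f x\<bar> \<le> C * \<sigma> ^ mi_order J * fact (mi_order J) * M (mi_order J)"
      using f K unfolding CM_def by blast
    moreover have "\<forall>J. \<forall>x\<in>K. DJ J f x = DJ J g x" using D K by blast
    ultimately show ?thesis by simp
  qed
  ultimately show ?thesis by (simp add: CM_def)
qed

lemma flat_ideal_iff: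
  fixes f :: "real^'n::finite \<Rightarrow> real"
  assumes "open \<Omega>" "X \<subseteq> \<Omega>"
  shows "f \<in> flat_ideal M \<Omega> X \<longleftrightarrow> f \<in> CM M \<Omega> \<and> (\<forall>a\<in>X. \<forall>is. iter_partial is f a = 0)"
proof -
  have "smooth_on \<Omega> f \<Longrightarrow> a \<in> X \<Longrightarrow> flat_at f a \<longleftrightarrow> (\<forall>is. iter_partial is f a = 0)" for a
    using flat_at_iff[OF assms(1)] assms(2) by blast
  then show ?thesis by (auto simp: flat_ideal_def CM_def)
qed

lemma zero_set_subset: "zero_set \<Omega> \<phi> \<subseteq> \<Omega>"
  by (auto simp: zero_set_def)

lemma open_minus_zero_set:
  fixes \<phi> :: "real^'n::finite \<Rightarrow> real"
  assumes "open \<Omega>" "smooth_on \<Omega> \<phi>"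
  shows "open (\<Omega> - zero_set \<Omega> \<phi>)"
proof -
  have "continuous_on \<Omega> \<phi>"
    using smooth_onD[OF assms(2), of _ "[]"] assms(1)
    by (simp add: continuous_on_eq_continuous_at differentiable_imp_continuous_within)
  then have "open (\<Omega> \<inter> \<phi> -` (- {0}))"
    using assms(1) by (intro continuous_open_preimage) auto
  moreover have "\<Omega> - zero_set \<Omega> \<phi> = \<Omega> \<inter> \<phi> -` (- {0})" by (auto simp: zero_set_def)
  ultimately show ?thesis by simp
qed

lemma infdist_zero_set_pos:
  fixes \<phi> :: "real^'n::finite \<Rightarrow> real"
  assumes "open \<Omega>" "smooth_on \<Omega> \<phi>" "x \<in> \<Omega> - zero_set \<Omega> \<phi>" "zero_set \<Omega> \<phi> \<noteq> {}"
  shows "infdist x (zero_set \<Omega> \<phi>) > 0"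
proof -
  have "(\<Omega> - zero_set \<Omega> \<phi>) \<inter> zero_set \<Omega> \<phi> = {}" by blast
  then have "x \<notin> closure (zero_set \<Omega> \<phi>)"
    using open_Int_closure_eq_empty[OF open_minus_zero_set[OF assms(1,2)]] assms(3) by blast
  then show ?thesis
    using in_closure_iff_infdist_zero[OF assms(4)] infdist_nonneg[of x "zero_set \<Omega> \<phi>"] by force
qed

lemma smooth_on_reciprocal:
  fixes \<phi> :: "real^'n::finite \<Rightarrow> real"
  assumes "open \<Omega>" "smooth_on \<Omega> \<phi>"
  shows "smooth_on (\<Omega> - zero_set \<Omega> \<phi>) (\<lambda>y. 1 / \<phi> y)"
  using open_minus_zero_set[OF assms]
  by (rule smooth_on_inverse) (auto intro: smooth_on_subset[OF assms(2)] simp: zero_set_def)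

lemma has_derivative_zero_of_square_bound:
  fixes G :: "'a::real_normed_vector \<Rightarrow> real"
  assumes "e > 0" "G a = 0" and G: "\<And>y. y \<in> cball a e \<Longrightarrow> \<bar>G y\<bar> \<le> c * dist y a ^ 2"
  shows "(G has_derivative (\<lambda>_. 0)) (at a)"
  unfolding has_derivative_within
proof (intro conjI)
  show "((\<lambda>y. (1 / norm (y - a)) *\<^sub>R (G y - (G a + 0))) \<longlongrightarrow> 0) (at a)"
  proof (rule Lim_null_comparison)
    show "\<forall>\<^sub>F y in at a. norm ((1 / norm (y - a)) *\<^sub>R (G y - (G a + 0))) \<le> c * norm (y - a)"
      unfolding eventually_at
    proof (intro exI[of _ e] conjI ballI impI)
      fix y assume "y \<noteq> a \<and> dist y a < e"
      then have "\<bar>G y\<bar> \<le> c * norm (y - a) ^ 2" "norm (y - a) > 0"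
        using G[of y] by (auto simp: dist_norm norm_minus_commute)
      then have "\<bar>G y\<bar> / norm (y - a) \<le> c * norm (y - a)"
        by (simp add: pos_divide_le_eq power2_eq_square mult.assoc)
      then show "norm ((1 / norm (y - a)) *\<^sub>R (G y - (G a + 0))) \<le> c * norm (y - a)"
        using assms(2) by simp
    qed (use assms in auto)
    show "((\<lambda>y. c * norm (y - a)) \<longlongrightarrow> 0) (at a)"
      by (rule tendsto_eq_intros tendsto_mult_right_zero LIM_zero tendsto_norm_zero | simp)+
  qed
qed simp

context strongly_regular_seq
begin

lemma mult_flat_ideal_subset:
  fixes \<phi> :: "real^'n::finite \<Rightarrow> real"
  assumes O: "open \<Omega>" and \<phi>: "\<phi> \<in> CM M \<Omega>" and X: "X \<subseteq> \<Omega>"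
  shows "mult_set \<Omega> \<phi> (flat_ideal M \<Omega> X) \<subseteq> flat_ideal M \<Omega> X"
proof
  fix f assume "f \<in> mult_set \<Omega> \<phi> (flat_ideal M \<Omega> X)"
  then obtain g where "g \<in> flat_ideal M \<Omega> X" and fg: "\<And>x. x \<in> \<Omega> \<Longrightarrow> f x = \<phi> x * g x"
    unfolding mult_set_def by auto
  then have g: "g \<in> CM M \<Omega>" "\<And>a is. a \<in> X \<Longrightarrow> iter_partial is g a = 0"
    by (auto simp: flat_ideal_iff[OF O X])
  note f = fg[symmetric]
  have s: "smooth_on \<Omega> \<phi>" "smooth_on \<Omega> g" using \<phi> g by (auto simp: CM_def)
  have "f \<in> CM M \<Omega>" by (rule CM_cong[OF O f CM_mult[OF O \<phi> g(1)]])
  moreover have "iter_partial is f a = 0" if a: "a \<in> X" for a "is"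
  proof -
    have "iter_partial is f a = iter_partial is (\<lambda>x. \<phi> x * g x) a"
      by (rule iter_partial_cong[OF O fg]) (use X a in auto)
    also have "\<dots> = (\<Sum>p\<leftarrow>splits is. iter_partial (fst p) \<phi> a * iter_partial (snd p) g a)"
      by (rule iter_partial_mult[OF O s]) (use X a in auto)
    also have "\<dots> = 0" using g(2)[OF a] by (induction "splits is") auto
    finally show ?thesis .
  qed
  ultimately show "f \<in> flat_ideal M \<Omega> X" by (simp add: flat_ideal_iff[OF O X])
qed

lemma lojasiewicz_quotient_bound:
  fixes \<phi> :: "real^'n::finite \<Rightarrow> real"
  assumes O: "open \<Omega>" and \<phi>: "\<phi> \<in> CM M \<Omega>" and loj: "CM_lojasiewicz M \<Omega> \<phi>"
    and f: "f \<in> flat_ideal M \<Omega> (zero_set \<Omega> \<phi>)" and K: "compact K" "K \<subseteq> \<Omega>"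
  obtains C \<sigma> \<mu> where "C > 0" "\<sigma> > 0" "\<mu> > 0"
    "\<And>x is. x \<in> K - zero_set \<Omega> \<phi> \<Longrightarrow> \<bar>iter_partial is (\<lambda>y. f y * (1 / \<phi> y)) x\<bar> \<le>
       C * (if zero_set \<Omega> \<phi> = {} then 1 else hM M (\<mu> * infdist x (zero_set \<Omega> \<phi>))) *
       \<sigma> ^ length is * fact (length is) * M (length is)"
proof -
  define X where "X = zero_set \<Omega> \<phi>"
  define V where "V = \<Omega> - X"
  have X: "X \<subseteq> \<Omega>" by (simp add: X_def zero_set_subset)
  have s\<phi>: "smooth_on \<Omega> \<phi>" using \<phi> by (simp add: CM_def)
  have V: "open V" "smooth_on V (\<lambda>y. 1 / \<phi> y)"
    using open_minus_zero_set[OF O s\<phi>] smooth_on_reciprocal[OF O s\<phi>] by (auto simp: V_def X_def)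
  have fC: "f \<in> CM M \<Omega>" and flat: "\<And>a is. a \<in> X \<Longrightarrow> iter_partial is f a = 0"
    using f flat_ideal_iff[OF O X] by (auto simp: X_def)
  have sf: "smooth_on V f" using fC by (auto simp: CM_def V_def intro: smooth_on_subset)
  note loj' = loj[unfolded CM_lojasiewicz_iff[OF V[unfolded V_def X_def]], folded X_def]
  obtain A where A: "A \<ge> 1" "\<And>t. t > 0 \<Longrightarrow> hM M t \<le> hM M (A * t) ^ 2" using hM_square by blast
  obtain C1 \<sigma>1 lam where 1: "C1 > 0" "\<sigma>1 > 0" "lam > 0" and
    b1: "\<And>x is. x \<in> K - X \<Longrightarrow> \<bar>iter_partial is f x\<bar> \<le>
      (C1 * (if X = {} then 1 else hM M (lam * infdist x X))) * \<sigma>1 ^ length is * fact (length is) * M (length is)"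
  proof (cases "X = {}")
    case True
    obtain C \<sigma> where "C > 0" "\<sigma> > 0"
      "\<And>x is. x \<in> K \<Longrightarrow> \<bar>iter_partial is f x\<bar> \<le> C * \<sigma> ^ length is * fact (length is) * M (length is)"
      using CM_bounds[OF O fC K] by blast
    then show ?thesis using True by (intro that[of C \<sigma> 1]) auto
  next
    case False
    obtain C \<sigma> lam where "C > 0" "\<sigma> > 0" "lam > 0" and
      b: "\<And>x is. x \<in> K \<Longrightarrow> infdist x X > 0 \<Longrightarrow> \<bar>iter_partial is f x\<bar> \<le>
        C * \<sigma> ^ length is * fact (length is) * M (length is) * hM M (lam * infdist x X)"
      using flat_estimate[OF O fC False X flat K] by blast
    moreover have "infdist x X > 0" if "x \<in> K - X" for x
      using infdist_zero_set_pos[OF O s\<phi>] that K False by (auto simp: X_def)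
    ultimately show ?thesis using False
      by (intro that[of C \<sigma> lam]) (auto simp: mult_ac)
  qed
  \<comment> \<open>The condition is used with \<open>A * lam\<close>, so that
    \<open>hM_square\<close> gives \<open>H1 \<le> H2 * H2\<close> below and one factor
    \<open>H2\<close> survives the division.\<close>
  have "A * lam > 0" using A 1 by simp
  then have "\<exists>C>0. \<exists>\<sigma>>0. \<forall>x\<in>K - X. \<forall>is. \<bar>iter_partial is (\<lambda>y. 1 / \<phi> y) x\<bar> \<le>
          C * \<sigma> ^ length is * fact (length is) * M (length is) /
          (if X = {} then 1 else hM M ((A * lam) * infdist x X))"
    using loj'[rule_format, OF conjI[OF K]] by blast
  then obtain C2 \<sigma>2 where 2: "C2 > 0" "\<sigma>2 > 0" and
    b2: "\<And>x is. x \<in> K - X \<Longrightarrow> \<bar>iter_partial is (\<lambda>y. 1 / \<phi> y) x\<bar> \<le>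
          C2 * \<sigma>2 ^ length is * fact (length is) * M (length is) /
          (if X = {} then 1 else hM M ((A * lam) * infdist x X))" by meson
  show thesis
  proof (rule that[of "C1 * C2" "2 * max \<sigma>1 \<sigma>2" "A * lam", folded X_def])
    fix x and "is" :: "'n list" assume x: "x \<in> K - X"
    define H1 where "H1 = (if X = {} then 1 else hM M (lam * infdist x X))"
    define H2 where "H2 = (if X = {} then 1 else hM M ((A * lam) * infdist x X))"
    have H: "H2 > 0" "H1 \<le> H2 * H2"
    proof -
      have "infdist x X > 0" if "X \<noteq> {}"
        using infdist_zero_set_pos[OF O s\<phi>] that K x by (auto simp: X_def)
      then have "lam * infdist x X > 0" "A * (lam * infdist x X) > 0" if "X \<noteq> {}"
        using that 1 A by auto
      then show "H2 > 0" "H1 \<le> H2 * H2"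
        using A(2)[of "lam * infdist x X"] 1 \<open>A * lam > 0\<close>
        by (auto simp: H1_def H2_def power2_eq_square mult.assoc intro!: hM_pos)
    qed
    have "\<bar>iter_partial is (\<lambda>y. f y * (1 / \<phi> y)) x\<bar> \<le>
      (C1 * H1) * (C2 / H2) * (2 * max \<sigma>1 \<sigma>2) ^ length is * fact (length is) * M (length is)"
    proof (rule iter_partial_mult_bound[OF V(1) sf V(2) _ _ _ 1(2) 2(2)])
      show "x \<in> V" using x K by (auto simp: V_def)
      show "\<bar>iter_partial is f x\<bar> \<le> C1 * H1 * \<sigma>1 ^ length is * fact (length is) * M (length is)" for "is"
        using b1[OF x] by (simp add: H1_def)
      show "\<bar>iter_partial is (\<lambda>y. 1 / \<phi> y) x\<bar> \<le> C2 / H2 * \<sigma>2 ^ length is * fact (length is) * M (length is)" for "is"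
        using b2[OF x, of "is"] by (simp add: H2_def)
    qed
    also have "\<dots> \<le> (C1 * C2 * H2) * (2 * max \<sigma>1 \<sigma>2) ^ length is * fact (length is) * M (length is)"
    proof (intro mult_right_mono)
      have "H1 / H2 \<le> H2" using H by (simp add: pos_divide_le_eq)
      then have "C1 * C2 * (H1 / H2) \<le> C1 * C2 * H2" using 1 2 by (intro mult_left_mono) auto
      then show "C1 * H1 * (C2 / H2) \<le> C1 * C2 * H2" by (simp add: mult_ac)
    qed (use 1 2 M_nonneg in auto)
    finally show "\<bar>iter_partial is (\<lambda>y. f y * (1 / \<phi> y)) x\<bar> \<le> C1 * C2 * (if X = {} then 1 else hM M (A * lam * infdist x X)) *
       (2 * max \<sigma>1 \<sigma>2) ^ length is * fact (length is) * M (length is)"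
      by (simp add: H2_def)
  qed (use 1 2 \<open>A * lam > 0\<close> in auto)
qed

lemma lojasiewicz_division:
  fixes \<phi> :: "real^'n::finite \<Rightarrow> real"
  assumes O: "open \<Omega>" and \<phi>: "\<phi> \<in> CM M \<Omega>" and loj: "CM_lojasiewicz M \<Omega> \<phi>"
  shows "flat_ideal M \<Omega> (zero_set \<Omega> \<phi>) \<subseteq> mult_set \<Omega> \<phi> (flat_ideal M \<Omega> (zero_set \<Omega> \<phi>))"
proof
  fix f assume f: "f \<in> flat_ideal M \<Omega> (zero_set \<Omega> \<phi>)"
  define X where "X = zero_set \<Omega> \<phi>"
  define V where "V = \<Omega> - X"
  define v where "v = (\<lambda>y. f y * (1 / \<phi> y))"
  define g where "g = (\<lambda>y. if y \<in> X then 0 else v y)"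
  have X: "X \<subseteq> \<Omega>" by (simp add: X_def zero_set_subset)
  have s\<phi>: "smooth_on \<Omega> \<phi>" using \<phi> by (simp add: CM_def)
  have V: "open V" "smooth_on V (\<lambda>y. 1 / \<phi> y)"
    using open_minus_zero_set[OF O s\<phi>] smooth_on_reciprocal[OF O s\<phi>] by (auto simp: V_def X_def)
  have fC: "f \<in> CM M \<Omega>" and flat: "\<And>a is. a \<in> X \<Longrightarrow> iter_partial is f a = 0"
    using f flat_ideal_iff[OF O X] by (auto simp: X_def)
  have "smooth_on V f" using fC by (auto simp: CM_def V_def intro: smooth_on_subset)
  then have sv: "smooth_on V v" unfolding v_def using V by (intro smooth_on_mult)
  note quot = lojasiewicz_quotient_bound[OF O \<phi> loj f, folded X_def v_def]
  \<comment> \<open>The formula for \<open>iter_partial is g\<close> is a premise because it is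
    proved by induction on the list, and this fact for one list is what gives the formula on
    \<open>X\<close> for the next.\<close>
  have zero: "(iter_partial is g has_derivative (\<lambda>_. 0)) (at a)"
    if a: "a \<in> X" and eq: "\<And>y. y \<in> \<Omega> \<Longrightarrow> iter_partial is g y = (if y \<in> X then 0 else iter_partial is v y)"
    for a "is"
  proof -
    obtain e where e: "e > 0" "cball a e \<subseteq> \<Omega>"
      using O X a by (meson open_contains_cball subsetD)
    obtain C \<sigma> \<mu> where pos: "C > 0" "\<sigma> > 0" "\<mu> > 0" and
      b: "\<And>x is. x \<in> cball a e - X \<Longrightarrow> \<bar>iter_partial is v x\<bar> \<le>
         C * (if X = {} then 1 else hM M (\<mu> * infdist x X)) * \<sigma> ^ length is * fact (length is) * M (length is)"
      using quot[OF compact_cball e(2)] by blast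
    define B where "B = C * \<sigma> ^ length is * fact (length is) * M (length is)"
    have B: "B \<ge> 0" using pos M_nonneg by (auto simp: B_def)
    show ?thesis
    \<comment> \<open>The term of index 2 in the infimum \<open>hM\<close> gives quadratic decay
      towards \<open>a\<close>; index 1 would only give a Lipschitz bound.\<close>
    proof (rule has_derivative_zero_of_square_bound[OF e(1), of _ _ "B * (\<mu> ^ 2 * M 2)"])
      show "iter_partial is g a = 0" using eq a X by auto
      fix y assume y: "y \<in> cball a e"
      show "\<bar>iter_partial is g y\<bar> \<le> B * (\<mu>\<^sup>2 * M 2) * (dist y a)\<^sup>2"
      proof (cases "y \<in> X")
        case True then show ?thesis using eq y e B M_nonneg by auto
      next
        case False
        have d: "infdist y X > 0"
          using infdist_zero_set_pos[OF O s\<phi>, of y] False subsetD[OF e(2) y] a by (auto simp: X_def)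
        have "\<bar>iter_partial is g y\<bar> \<le> B * hM M (\<mu> * infdist y X)"
          using b[of y "is"] False y eq[OF subsetD[OF e(2) y]] a by (auto simp: B_def mult_ac split: if_splits)
        also have "\<dots> \<le> B * ((\<mu> * infdist y X) ^ 2 * M 2)"
          using B pos d by (intro mult_left_mono hM_le) auto
        also have "\<dots> \<le> B * ((\<mu> * dist y a) ^ 2 * M 2)"
          using B pos infdist_le[OF a, of y] M_nonneg infdist_nonneg
          by (intro mult_left_mono mult_right_mono power_mono) (auto intro!: mult_nonneg_nonneg)
        finally show ?thesis by (simp add: power_mult_distrib mult_ac)
      qed
    qed
  qed
  have eq: "iter_partial is g y = (if y \<in> X then 0 else iter_partial is v y)" if "y \<in> \<Omega>" for y "is"
    using that
  proof (induction "is" arbitrary: y)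
    case Nil then show ?case by (simp add: g_def)
  next
    case (Cons i "is")
    show ?case
    proof (cases "y \<in> X")
      case True
      then show ?thesis using partial_deriv_eq[OF zero[OF True Cons.IH], of i] by simp
    next
      case False
      have "partial_deriv i (iter_partial is g) y = partial_deriv i (iter_partial is v) y"
        by (rule partial_deriv_cong[OF V(1)]) (use False Cons in \<open>auto simp: V_def\<close>)
      then show ?thesis using False by simp
    qed
  qed
  have sg: "smooth_on \<Omega> g"
    unfolding smooth_on_def
  proof (intro allI ballI)
    fix "is" y assume y: "y \<in> \<Omega>"
    show "iter_partial is g differentiable (at y)"
    proof (cases "y \<in> X")
      case True then show ?thesis using differentiableI[OF zero[OF True eq]] by blast
    next
      case False
      show ?thesis
        by (rule differentiable_cong_open[OF V(1) _ _ smooth_onD[OF sv, of y "is"]])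
          (use False y eq in \<open>auto simp: V_def\<close>)
    qed
  qed
  have "g \<in> CM M \<Omega>"
    unfolding CM_iff[OF O]
  proof (intro conjI allI impI)
    fix K assume K: "compact K \<and> K \<subseteq> \<Omega>"
    obtain C \<sigma> \<mu> where pos: "C > 0" "\<sigma> > 0" "\<mu> > 0" and
      b: "\<And>x is. x \<in> K - X \<Longrightarrow> \<bar>iter_partial is v x\<bar> \<le>
         C * (if X = {} then 1 else hM M (\<mu> * infdist x X)) * \<sigma> ^ length is * fact (length is) * M (length is)"
      using quot K by blast
    have "\<bar>iter_partial is g x\<bar> \<le> C * \<sigma> ^ length is * fact (length is) * M (length is)" if x: "x \<in> K" for x "is"
    proof (cases "x \<in> X")
      case True then show ?thesis using eq K x pos M_nonneg by auto
    next
      case False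
      have "(if X = {} then 1 else hM M (\<mu> * infdist x X)) \<le> 1"
        using infdist_zero_set_pos[OF O s\<phi>, of x] False subsetD[OF conjunct2[OF K] x] pos
        by (auto simp: X_def intro!: hM_le_1 mult_pos_pos)
      then have "C * (if X = {} then 1 else hM M (\<mu> * infdist x X)) * \<sigma> ^ length is * fact (length is) * M (length is)
        \<le> C * 1 * \<sigma> ^ length is * fact (length is) * M (length is)"
        using pos M_nonneg by (intro mult_right_mono mult_left_mono) auto
      then show ?thesis using b[of x "is"] False x eq[of x "is"] K by auto
    qed
    then show "\<exists>C>0. \<exists>\<sigma>>0. \<forall>x\<in>K. \<forall>is. \<bar>iter_partial is g x\<bar> \<le> C * \<sigma> ^ length is * fact (length is) * M (length is)"
      using pos by blast
  qed (rule sg)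
  moreover have "\<forall>a\<in>X. \<forall>is. iter_partial is g a = 0" using eq X by auto
  ultimately have "g \<in> flat_ideal M \<Omega> X" by (simp add: flat_ideal_iff[OF O X])
  moreover have "f x = \<phi> x * g x" if "x \<in> \<Omega>" for x
    using that flat[of x "[]"] by (auto simp: g_def v_def X_def zero_set_def)
  ultimately show "f \<in> mult_set \<Omega> \<phi> (flat_ideal M \<Omega> (zero_set \<Omega> \<phi>))"
    unfolding mult_set_def X_def by blast
qed

text \<open>Suppose all zeros in a ball around \<open>a\<close> are flat. At points off
  \<open>X\<close> at distance \<open>d\<close> from \<open>X\<close>, the flat estimate in that
  ball bounds \<open>\<bar>\<phi>\<bar>\<close> by a multiple of the square of
  \<open>hM M (\<mu> * d)\<close>, while the condition bounds its reciprocal by a multiple of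
  \<open>1 / hM M (\<mu> * d)\<close>. The product of the two bounds tends to 0 as these points
  approach \<open>a\<close>, yet it must be at least 1.\<close>

lemma lojasiewicz_nonflat_dense:
  fixes \<phi> :: "real^'n::finite \<Rightarrow> real"
  assumes O: "open \<Omega>" and \<phi>: "\<phi> \<in> CM M \<Omega>" and loj: "CM_lojasiewicz M \<Omega> \<phi>"
  shows "frontier (zero_set \<Omega> \<phi>) \<inter> \<Omega> \<subseteq> closure (zero_set \<Omega> \<phi> - flat_points \<Omega> \<phi>)"
proof (rule subsetI, rule ccontr)
  define X where "X = zero_set \<Omega> \<phi>"
  fix a assume "a \<in> frontier (zero_set \<Omega> \<phi>) \<inter> \<Omega>" and nc: "a \<notin> closure (zero_set \<Omega> \<phi> - flat_points \<Omega> \<phi>)"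
  then have a: "a \<in> frontier X" "a \<in> \<Omega>" by (auto simp: X_def)
  have s\<phi>: "smooth_on \<Omega> \<phi>" using \<phi> by (simp add: CM_def)
  have V: "open (\<Omega> - X)" "smooth_on (\<Omega> - X) (\<lambda>y. 1 / \<phi> y)"
    using open_minus_zero_set[OF O s\<phi>] smooth_on_reciprocal[OF O s\<phi>] by (auto simp: X_def)
  note loj' = loj[unfolded CM_lojasiewicz_iff[OF V[unfolded X_def]], folded X_def]
  have "open (\<Omega> - closure (X - flat_points \<Omega> \<phi>))" using O by (simp add: open_Diff)
  then obtain r where r: "r > 0" "ball a r \<subseteq> \<Omega> - closure (X - flat_points \<Omega> \<phi>)"
    using a(2) nc by (metis DiffI X_def open_contains_ball)
  define Y where "Y = X \<inter> ball a r"
  have aX: "a \<in> X"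
  proof (rule ccontr)
    assume "a \<notin> X"
    then have "a \<in> \<Omega> - X" using a by simp
    moreover have "(\<Omega> - X) \<inter> closure X = {}" using open_Int_closure_eq_empty[OF V(1), of X] by blast
    ultimately show False using a(1) by (auto simp: frontier_def)
  qed
  have Y: "Y \<noteq> {}" "Y \<subseteq> ball a r" using aX r by (auto simp: Y_def)
  have flat: "iter_partial is \<phi> b = 0" if "b \<in> Y" for b "is"
  proof -
    have "b \<in> X" "b \<in> \<Omega>" "b \<notin> closure (X - flat_points \<Omega> \<phi>)" using that r by (auto simp: Y_def)
    then have "flat_at \<phi> b" using closure_subset[of "X - flat_points \<Omega> \<phi>"] by (auto simp: flat_points_def)
    then show ?thesis using flat_at_iff[OF O s\<phi> \<open>b \<in> \<Omega>\<close>] by blast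
  qed
  have "ball a r \<subseteq> \<Omega>" using r by blast
  then have \<phi>': "\<phi> \<in> CM M (ball a r)" using \<phi> CM_subset by blast
  have sub: "cball a (r / 2) \<subseteq> ball a r" using r by (auto simp: subset_iff)
  obtain C1 \<sigma>1 lam where 1: "C1 > 0" "\<sigma>1 > 0" "lam > 0" and
    b1: "\<And>x is. x \<in> cball a (r / 2) \<Longrightarrow> infdist x Y > 0 \<Longrightarrow> \<bar>iter_partial is \<phi> x\<bar> \<le>
        C1 * \<sigma>1 ^ length is * fact (length is) * M (length is) * hM M (lam * infdist x Y)"
    using flat_estimate[OF open_ball \<phi>' Y flat compact_cball sub] by blast
  obtain A where A: "A \<ge> 1" "\<And>t. t > 0 \<Longrightarrow> hM M t \<le> hM M (A * t) ^ 2" using hM_square by blast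
  \<comment> \<open>\<open>A\<close> comes from \<open>hM_square\<close>; the 2 is needed because
    the distance to \<open>Y\<close> is only known to be at most \<open>2 * d\<close>.\<close>
  define \<mu> where "\<mu> = A * (lam * 2)"
  have \<mu>: "\<mu> > 0" using A 1 by (simp add: \<mu>_def)
  have "\<exists>C>0. \<exists>\<sigma>>0. \<forall>x\<in>cball a (r / 2) - X. \<forall>is. \<bar>iter_partial is (\<lambda>y. 1 / \<phi> y) x\<bar> \<le>
          C * \<sigma> ^ length is * fact (length is) * M (length is) /
          (if X = {} then 1 else hM M (\<mu> * infdist x X))"
    using loj' \<mu> compact_cball order.trans[OF sub \<open>ball a r \<subseteq> \<Omega>\<close>] by blast
  then obtain C2 \<sigma>2 where 2: "C2 > 0" "\<sigma>2 > 0" and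
    b2: "\<And>x is. x \<in> cball a (r / 2) - X \<Longrightarrow> \<bar>iter_partial is (\<lambda>y. 1 / \<phi> y) x\<bar> \<le>
          C2 * \<sigma>2 ^ length is * fact (length is) * M (length is) /
          (if X = {} then 1 else hM M (\<mu> * infdist x X))" by meson
  \<comment> \<open>The first bound keeps the nearby zero \<open>b\<close> in the ball, since
    \<open>r / 4 + 2 * (r / 4) < r\<close>; the second makes the final product at most
    \<open>1 / 2\<close>.\<close>
  define e where "e = min (r / 4) (1 / (2 * (C1 * C2 * \<mu> * M 1)))"
  have e: "e > 0" using r 1 2 \<mu> M_pos by (simp add: e_def)
  have "a \<in> closure (- X)" using a(1) by (simp add: frontier_closures)
  then obtain x where x: "x \<notin> X" "dist x a < e" using e by (auto simp: closure_approachable)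
  have xr: "dist a x < r / 4" using x(2) by (simp add: e_def dist_commute)
  have x\<Omega>: "x \<in> \<Omega>" "x \<in> cball a (r / 2)" using xr r(1) \<open>ball a r \<subseteq> \<Omega>\<close> by auto
  define d where "d = infdist x X"
  have d: "d > 0" using infdist_zero_set_pos[OF O s\<phi>, of x] x x\<Omega> aX by (auto simp: d_def X_def)
  have dx: "d \<le> dist x a" unfolding d_def using aX by (rule infdist_le)
  obtain b where b: "b \<in> X" "dist x b < 2 * d"
    using infdist_near_point[of X x "2 * d"] aX d by (auto simp: d_def)
  have "dist a b < r" using dist_triangle[of a b x] b dx xr r(1) dist_commute[of x a] by linarith
  then have "b \<in> Y" using b by (simp add: Y_def)
  then have dY: "infdist x Y \<le> 2 * d" using b(2) infdist_le2[of b Y x "2 * d"] by simp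
  have "d \<le> infdist x Y" unfolding d_def by (rule infdist_mono) (use Y in \<open>auto simp: Y_def\<close>)
  then have dY0: "infdist x Y > 0" using d by simp
  have h: "hM M (\<mu> * d) > 0" using \<mu> d by (intro hM_pos) auto
  have "\<bar>\<phi> x\<bar> \<le> C1 * hM M (lam * infdist x Y)" using b1[OF x\<Omega>(2) dY0, of "[]"] by (simp add: M_0)
  also have "\<dots> \<le> C1 * hM M (lam * (2 * d))"
    using 1 dY dY0 by (intro mult_left_mono hM_mono) auto
  also have "\<dots> \<le> C1 * hM M (\<mu> * d) ^ 2"
    using A(2)[of "lam * (2 * d)"] 1 d by (intro mult_left_mono) (auto simp: \<mu>_def mult_ac)
  finally have p1: "\<bar>\<phi> x\<bar> \<le> C1 * hM M (\<mu> * d) ^ 2" .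
  have p2: "1 / \<bar>\<phi> x\<bar> \<le> C2 / hM M (\<mu> * d)"
    using b2[of x "[]"] x x\<Omega> aX by (auto simp: M_0 d_def split: if_splits)
  have "\<phi> x \<noteq> 0" using x x\<Omega> by (simp add: X_def zero_set_def)
  then have "1 = \<bar>\<phi> x\<bar> * (1 / \<bar>\<phi> x\<bar>)" by simp
  also have "\<dots> \<le> (C1 * hM M (\<mu> * d) ^ 2) * (C2 / hM M (\<mu> * d))"
    using 1 by (intro mult_mono p1 p2) auto
  also have "\<dots> = C1 * C2 * hM M (\<mu> * d)" using h by (simp add: power2_eq_square)
  also have "\<dots> \<le> C1 * C2 * ((\<mu> * d) ^ 1 * M 1)" using 1 2 \<mu> d by (intro mult_left_mono hM_le) auto
  also have "\<dots> = (C1 * C2 * \<mu> * M 1) * d" by (simp add: mult_ac)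
  also have "\<dots> \<le> (C1 * C2 * \<mu> * M 1) * (1 / (2 * (C1 * C2 * \<mu> * M 1)))"
    using dx x(2) 1 2 \<mu> M_nonneg by (intro mult_left_mono) (auto simp: e_def)
  also have "\<dots> = 1 / 2" using 1 2 \<mu> M_pos[of 1] by simp
  finally show False by simp
qed

end

section \<open>Uniform boundedness of division\<close>

text \<open>The supremum of \<open>\<bar>L f\<bar>\<close> need not be attained, but some element
  exceeds half of it, unless it is 0 and any element will do.\<close>

lemma near_norming:
  fixes L :: "'a \<Rightarrow> real"
  assumes E: "E \<noteq> {}" and N: "\<And>f. f \<in> E \<Longrightarrow> \<bar>L f\<bar> \<le> N"
  obtains u where "u \<in> E" "\<And>f. f \<in> E \<Longrightarrow> \<bar>L f\<bar> \<le> 2 * \<bar>L u\<bar>"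
proof -
  define S where "S = (SUP f\<in>E. \<bar>L f\<bar>)"
  have S: "\<bar>L f\<bar> \<le> S" if "f \<in> E" for f
    unfolding S_def using that N by (intro cSUP_upper bdd_aboveI2[of _ _ N])
  show thesis
  proof (cases "S > 0")
    case True
    then have "S / 2 < S" by simp
    then obtain u where "u \<in> E" "S / 2 < \<bar>L u\<bar>"
      unfolding S_def using less_cSUP_iff[OF E, of "\<lambda>f. \<bar>L f\<bar>"] N by (meson bdd_aboveI2)
    then show thesis using S that[of u] by fastforce
  next
    case False
    then show thesis using S E that by fastforce
  qed
qed

context strongly_regular_seq
begin

text \<open>The unit ball for the norm weighted by \<open>\<sigma> ^ j * j! * M j\<close>, with
  \<open>\<sigma>\<close> fixed. Bounds on the whole space allow series in it to be summed without
  an exhaustion by compact sets.\<close>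

definition flat_ball :: "real \<Rightarrow> (real^'n::finite) set \<Rightarrow> (real^'n \<Rightarrow> real) set" where
  "flat_ball \<sigma> X = {f. smooth_on UNIV f \<and>
     (\<forall>is x. \<bar>iter_partial is f x\<bar> \<le> \<sigma> ^ length is * fact (length is) * M (length is)) \<and>
     (\<forall>a\<in>X. \<forall>is. iter_partial is f a = 0)}"

text \<open>Completeness in concrete form: for each index list the differentiated series is
  dominated, uniformly in the point, by a multiple of the coefficient series, so it may be
  differentiated term by term.\<close>

lemma flat_ball_series:
  fixes u :: "nat \<Rightarrow> real^'n::finite \<Rightarrow> real"
  assumes u: "\<And>k. u k \<in> flat_ball \<sigma> X" and c: "summable (\<lambda>k. \<bar>c k\<bar>)" and \<sigma>: "\<sigma> > 0"
  shows "smooth_on UNIV (\<lambda>y. \<Sum>k. c k * u k y)"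
    and "\<And>is x. \<bar>iter_partial is (\<lambda>y. \<Sum>k. c k * u k y) x\<bar>
           \<le> (\<Sum>k. \<bar>c k\<bar>) * (\<sigma> ^ length is * fact (length is) * M (length is))"
    and "\<And>is a. a \<in> X \<Longrightarrow> iter_partial is (\<lambda>y. \<Sum>k. c k * u k y) a = 0"
    and "\<And>x. summable (\<lambda>k. c k * u k x)"
proof -
  define W where "W = (\<lambda>is :: 'n list. \<sigma> ^ length is * fact (length is) * M (length is))"
  define G where "G = (\<lambda>is x. \<Sum>k. c k * iter_partial is (u k) x)"
  have W: "W is \<ge> 0" for "is" using \<sigma> M_nonneg by (simp add: W_def)
  have su: "smooth_on UNIV (u k)" and bu: "\<bar>iter_partial is (u k) x\<bar> \<le> W is"
    and fu: "a \<in> X \<Longrightarrow> iter_partial is (u k) a = 0" for k "is" x a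
    using u[of k] by (auto simp: flat_ball_def W_def)
  have bt: "norm (c k * iter_partial is (u k) x) \<le> \<bar>c k\<bar> * W is" for k "is" x
    using bu by (auto simp: abs_mult intro!: mult_left_mono)
  have cW: "summable (\<lambda>k. \<bar>c (k + n)\<bar> * W is)" for n "is"
    using c by (intro summable_mult2) (simp add: summable_iff_shift[of "\<lambda>k. \<bar>c k\<bar>"])
  have sm: "summable (\<lambda>k. c k * iter_partial is (u k) x)" for "is" x
    by (rule summable_comparison_test'[of "\<lambda>k. \<bar>c k\<bar> * W is"]) (use cW[of 0] bt in auto)
  have bG: "\<bar>\<Sum>k. c (k + n) * iter_partial is (u (k + n)) x\<bar> \<le> (\<Sum>k. \<bar>c (k + n)\<bar>) * W is" for n "is" x
  proof -
    have "norm (\<Sum>k. c (k + n) * iter_partial is (u (k + n)) x) \<le> (\<Sum>k. \<bar>c (k + n)\<bar> * W is)"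
      using bt by (intro norm_suminf_le cW)
    also have "\<dots> = (\<Sum>k. \<bar>c (k + n)\<bar>) * W is"
      using c by (intro suminf_mult2[symmetric]) (simp add: summable_iff_shift[of "\<lambda>k. \<bar>c k\<bar>"])
    finally show ?thesis by simp
  qed
  have dG: "(G is has_derivative (\<lambda>h. \<Sum>i\<in>UNIV. h $ i * G (i # is) x)) (at x)" for "is" x
  proof -
    let ?f' = "\<lambda>n x h. c n * (\<Sum>i\<in>UNIV. h $ i * iter_partial (i # is) (u n) x)"
    have "\<exists>g. \<forall>x\<in>UNIV. (\<lambda>n. c n * iter_partial is (u n) x) sums (g x) \<and>
       (g has_derivative (\<lambda>h. \<Sum>i\<in>UNIV. h $ i * G (i # is) x)) (at x within UNIV)"
    proof (rule has_derivative_series[where f' = ?f'])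
      show "((\<lambda>y. c n * iter_partial is (u n) y) has_derivative ?f' n x) (at x within UNIV)" for n x
        using has_derivative_partials[OF smooth_onD[OF su], of x "is" n]
        by (intro has_derivative_mult_right) simp
      show "\<forall>\<^sub>F n in sequentially. \<forall>x\<in>UNIV. \<forall>h. norm (sum (\<lambda>i. ?f' i x h) {..<n} - (\<Sum>i\<in>UNIV. h $ i * G (i # is) x)) \<le> e * norm h"
        if e: "e > 0" for e
      proof -
        define B where "B = (\<Sum>i\<in>UNIV. W (i # is)) + 1"
        have B: "B > 0" using W by (simp add: B_def sum_nonneg add_nonneg_pos)
        obtain N where N: "\<And>n. n \<ge> N \<Longrightarrow> norm (\<Sum>k. \<bar>c (k + n)\<bar>) < e / B"
          using suminf_exist_split[OF divide_pos_pos[OF e B] c] by blast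
        show ?thesis unfolding eventually_sequentially
        proof (intro exI[of _ N] allI impI ballI)
          fix n x and h :: "real^'n" assume n: "N \<le> n"
          define T where "T = (\<Sum>k. \<bar>c (k + n)\<bar>)"
          have T: "0 \<le> T" "T \<le> e / B"
            using N[OF n] c by (auto simp: T_def summable_iff_shift[of "\<lambda>k. \<bar>c k\<bar>"] intro!: suminf_nonneg)
          have split: "G (i # is) x = (\<Sum>k. c (k + n) * iter_partial (i # is) (u (k + n)) x) + (\<Sum>k<n. c k * iter_partial (i # is) (u k) x)" for i
            unfolding G_def by (rule suminf_split_initial_segment[OF sm])
          have "sum (\<lambda>i. ?f' i x h) {..<n} = (\<Sum>i\<in>UNIV. h $ i * (\<Sum>k<n. c k * iter_partial (i # is) (u k) x))"
            unfolding sum_distrib_left by (subst sum.swap) (simp only: mult_ac)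
          then have "sum (\<lambda>i. ?f' i x h) {..<n} - (\<Sum>i\<in>UNIV. h $ i * G (i # is) x)
            = (\<Sum>i\<in>UNIV. h $ i * - (\<Sum>k. c (k + n) * iter_partial (i # is) (u (k + n)) x))"
            unfolding split by (simp add: sum_subtractf[symmetric] algebra_simps sum_negf)
          also have "norm \<dots> \<le> (\<Sum>i\<in>UNIV. norm h * (T * W (i # is)))"
          proof (rule order.trans[OF norm_sum], rule sum_mono)
            fix i
            show "norm (h $ i * - (\<Sum>k. c (k + n) * iter_partial (i # is) (u (k + n)) x)) \<le> norm h * (T * W (i # is))"
              unfolding norm_mult norm_minus_cancel
              using bG[of n "i # is" x] component_le_norm_cart[of h i] by (intro mult_mono) (auto simp: T_def)
          qed
          also have "\<dots> = norm h * T * (\<Sum>i\<in>UNIV. W (i # is))" by (simp only: sum_distrib_left mult_ac)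
          also have "\<dots> \<le> norm h * (e / B) * B"
          proof (intro mult_mono mult_left_mono)
            show "(\<Sum>i\<in>UNIV. W (i # is)) \<le> B" by (simp add: B_def)
            show "0 \<le> norm h * (e / B)" using e B by simp
          qed (use T W in \<open>auto simp: sum_nonneg\<close>)
          also have "\<dots> = e * norm h" using B by simp
          finally show "norm (sum (\<lambda>i. ?f' i x h) {..<n} - (\<Sum>i\<in>UNIV. h $ i * G (i # is) x)) \<le> e * norm h" .
        qed
      qed
      show "(\<lambda>n. c n * iter_partial is (u n) x) sums G is x" unfolding G_def using sm by (rule summable_sums)
    qed auto
    then obtain g where g: "\<And>x. (\<lambda>n. c n * iter_partial is (u n) x) sums (g x)"
      "(g has_derivative (\<lambda>h. \<Sum>i\<in>UNIV. h $ i * G (i # is) x)) (at x)" by auto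
    have "g = G is" using sums_unique[OF g(1)] by (auto simp: G_def)
    then show ?thesis using g(2) by simp
  qed
  have GI: "iter_partial is (\<lambda>y. \<Sum>k. c k * u k y) = G is" for "is"
  proof (induction "is")
    case Nil show ?case by (simp add: G_def)
  next
    case (Cons i "is")
    have "partial_deriv i (G is) x = G (i # is) x" for x
    proof -
      have "partial_deriv i (G is) x = (\<Sum>j\<in>UNIV. axis i 1 $ j * G (j # is) x)" by (rule partial_deriv_eq[OF dG])
      also have "\<dots> = G (i # is) x"
        by (subst sum.remove[of _ i]) (auto simp: axis_def intro!: sum.neutral)
      finally show ?thesis .
    qed
    then show ?case using Cons by auto
  qed
  show "smooth_on UNIV (\<lambda>y. \<Sum>k. c k * u k y)"
    unfolding smooth_on_def GI using differentiableI[OF dG] by blast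
  show "\<bar>iter_partial is (\<lambda>y. \<Sum>k. c k * u k y) x\<bar> \<le> (\<Sum>k. \<bar>c k\<bar>) * (\<sigma> ^ length is * fact (length is) * M (length is))" for "is" x
    unfolding GI using bG[of 0 "is" x] by (simp add: G_def W_def)
  show "iter_partial is (\<lambda>y. \<Sum>k. c k * u k y) a = 0" if "a \<in> X" for "is" a
    unfolding GI using fu[OF that] by (simp add: G_def)
  show "summable (\<lambda>k. c k * u k x)" for x using sm[of "[]" x] by simp
qed

text \<open>A gliding hump. If the quotients were not uniformly bounded, functionals
  \<open>f \<mapsto> D\<^sup>J(f/\<phi>)(x)\<close> with rapidly growing norms could be attained, up to a factor, by a single
  signed series of almost norming functions, whose quotient by \<open>\<phi>\<close> could then not be of class
  \<open>C\<^sub>M\<close>.\<close>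

lemma uniform_quotient_bound:
  fixes \<phi> :: "real^'n::finite \<Rightarrow> real"
  assumes O: "open \<Omega>" and \<phi>: "\<phi> \<in> CM M \<Omega>"
    and incl: "flat_ideal M \<Omega> (zero_set \<Omega> \<phi>) \<subseteq> mult_set \<Omega> \<phi> (CM M \<Omega>)"
    and K: "compact K" "K \<subseteq> \<Omega>" and \<sigma>: "\<sigma> > 0"
  obtains C \<tau> where "C > 0" "\<tau> > 0"
    "\<And>x is f. x \<in> K - zero_set \<Omega> \<phi> \<Longrightarrow> f \<in> flat_ball \<sigma> (zero_set \<Omega> \<phi>) \<Longrightarrow>
       \<bar>iter_partial is (\<lambda>y. f y * (1 / \<phi> y)) x\<bar> \<le> C * \<tau> ^ length is * fact (length is) * M (length is)"
proof (rule ccontr)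
  assume neg: "\<not> thesis"
  define X where "X = zero_set \<Omega> \<phi>"
  define V where "V = \<Omega> - X"
  define E where "E = flat_ball \<sigma> X"
  define L where "L = (\<lambda>is x f. iter_partial is (\<lambda>y. f y * (1 / \<phi> y)) (x :: real^'n))"
  have X: "X \<subseteq> \<Omega>" by (simp add: X_def zero_set_subset)
  have s\<phi>: "smooth_on \<Omega> \<phi>" using \<phi> by (simp add: CM_def)
  have V: "open V" "smooth_on V (\<lambda>y. 1 / \<phi> y)"
    using open_minus_zero_set[OF O s\<phi>] smooth_on_reciprocal[OF O s\<phi>] by (auto simp: V_def X_def)
  have sE: "smooth_on UNIV f" if "f \<in> E" for f using that by (simp add: E_def flat_ball_def)
  have sV: "smooth_on V f" if "smooth_on UNIV f" for f using that by (rule smooth_on_subset) simp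
  have L_lin: "L is x (\<lambda>y. a * f y + b * g y) = a * L is x f + b * L is x g"
    if "smooth_on UNIV f" "smooth_on UNIV g" "x \<in> V" for f g a b x "is"
  proof -
    have "(\<lambda>y. (a * f y + b * g y) * (1 / \<phi> y)) = (\<lambda>y. a * (f y * (1 / \<phi> y)) + b * (g y * (1 / \<phi> y)))"
      by (simp add: fun_eq_iff algebra_simps)
    then show ?thesis unfolding L_def
      using iter_partial_linear(1)[OF V(1) smooth_on_mult[OF V(1) sV[OF that(1)] V(2)] smooth_on_mult[OF V(1) sV[OF that(2)] V(2)] that(3)]
      by simp
  qed
  \<comment> \<open>For a fixed point and list Leibniz bounds the functional on \<open>E\<close>, so
    that almost norming functions exist; what is at stake is uniformity.\<close>
  have L_bd: "\<exists>N. \<forall>f\<in>E. \<bar>L is x f\<bar> \<le> N" if x: "x \<in> V" for "is" x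
  proof (intro exI ballI)
    fix f assume f: "f \<in> E"
    have "\<bar>L is x f\<bar> \<le> (\<Sum>p\<leftarrow>splits is. \<bar>iter_partial (fst p) f x * iter_partial (snd p) (\<lambda>y. 1 / \<phi> y) x\<bar>)"
      unfolding L_def iter_partial_mult[OF V(1) sV[OF sE[OF f]] V(2) x]
      using sum_list_abs[of "map (\<lambda>p. iter_partial (fst p) f x * iter_partial (snd p) (\<lambda>y. 1 / \<phi> y) x) (splits is)"]
      by (simp add: comp_def)
    also have "\<dots> \<le> (\<Sum>p\<leftarrow>splits is. \<sigma> ^ length (fst p) * fact (length (fst p)) * M (length (fst p)) * \<bar>iter_partial (snd p) (\<lambda>y. 1 / \<phi> y) x\<bar>)"
      unfolding abs_mult using f by (intro sum_list_mono mult_right_mono) (auto simp: E_def flat_ball_def)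
    finally show "\<bar>L is x f\<bar> \<le> (\<Sum>p\<leftarrow>splits is. \<sigma> ^ length (fst p) * fact (length (fst p)) * M (length (fst p)) * \<bar>iter_partial (snd p) (\<lambda>y. 1 / \<phi> y) x\<bar>)" .
  qed
  \<comment> \<open>The failing bound is tested with \<open>C = 4 ^ k * (k + 1)\<close> and
    \<open>\<tau> = k + 1\<close>: the power of 4 will cancel the coefficient \<open>q k\<close>,
    and \<open>k + 1\<close> eventually beats any fixed constants.\<close>
  have "\<exists>x is f. x \<in> K - X \<and> f \<in> E \<and>
    \<bar>L is x f\<bar> > (4 ^ k * (real k + 1)) * (real k + 1) ^ length is * fact (length is) * M (length is)" for k :: nat
  proof (rule ccontr)
    assume c: "\<nexists>x is f. x \<in> K - X \<and> f \<in> E \<and>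
      \<bar>L is x f\<bar> > (4 ^ k * (real k + 1)) * (real k + 1) ^ length is * fact (length is) * M (length is)"
    have thesis
    proof (rule that[of "4 ^ k * (real k + 1)" "real k + 1"])
      fix x "is" f assume "x \<in> K - zero_set \<Omega> \<phi>" "f \<in> flat_ball \<sigma> (zero_set \<Omega> \<phi>)"
      then show "\<bar>iter_partial is (\<lambda>y. f y * (1 / \<phi> y)) x\<bar> \<le> (4 ^ k * (real k + 1)) * (real k + 1) ^ length is * fact (length is) * M (length is)"
        using c unfolding X_def E_def L_def not_less[symmetric] by blast
    qed auto
    then show False using neg by contradiction
  qed
  then obtain x "is" f where x: "\<And>k. x k \<in> K - X" and f: "\<And>k. f k \<in> E" and
    big: "\<And>k :: nat. \<bar>L (is k) (x k) (f k)\<bar> > (4 ^ k * (real k + 1)) * (real k + 1) ^ length (is k) * fact (length (is k)) * M (length (is k))"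
    by metis
  have xV: "x k \<in> V" for k using x[of k] K by (auto simp: V_def)
  have "\<exists>u. u \<in> E \<and> (\<forall>g\<in>E. \<bar>L (is k) (x k) g\<bar> \<le> 2 * \<bar>L (is k) (x k) u\<bar>)" for k
  proof -
    obtain N where N: "\<And>g. g \<in> E \<Longrightarrow> \<bar>L (is k) (x k) g\<bar> \<le> N" using L_bd[OF xV[of k], of "is k"] by blast
    have "E \<noteq> {}" using f by blast
    then show ?thesis
    proof (rule near_norming[of E "L (is k) (x k)" N, OF _ N])
      fix v assume "v \<in> E" "\<And>g. g \<in> E \<Longrightarrow> \<bar>L (is k) (x k) g\<bar> \<le> 2 * \<bar>L (is k) (x k) v\<bar>"
      then show ?thesis by (intro exI[of _ v]) simp
    qed
  qed
  then have "\<exists>u. \<forall>k. u k \<in> E \<and> (\<forall>g\<in>E. \<bar>L (is k) (x k) g\<bar> \<le> 2 * \<bar>L (is k) (x k) (u k)\<bar>)"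
    by (intro choice) simp
  then obtain u where u0: "\<forall>k. u k \<in> E \<and> (\<forall>g\<in>E. \<bar>L (is k) (x k) g\<bar> \<le> 2 * \<bar>L (is k) (x k) (u k)\<bar>)" ..
  have u: "u k \<in> E" for k using u0 by simp
  have un: "\<bar>L (is k) (x k) g\<bar> \<le> 2 * \<bar>L (is k) (x k) (u k)\<bar>" if "g \<in> E" for k g using u0 that by simp
  \<comment> \<open>Ratio \<open>1 / 4\<close> makes the tail after \<open>k\<close> sum to
    \<open>q k / 3\<close>. Doubled by the near-norming factor, it can destroy at most two thirds of
    the \<open>k\<close>th hump.\<close>
  define q where "q = (\<lambda>k :: nat. (1 / 4 :: real) ^ k)"
  have q: "q k > 0" for k by (simp add: q_def)
  \<comment> \<open>Adding and subtracting the hump gives values of \<open>L\<close> that differ by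
    twice its size, so at least one sign leaves a value as large as the hump. The sign depends on
    the partial sum already built, hence the recursion for \<open>P\<close>.\<close>
  define sg where "sg = (\<lambda>k p. if \<bar>L (is k) (x k) (\<lambda>y. 1 * p y + q k * u k y)\<bar> \<ge> q k * \<bar>L (is k) (x k) (u k)\<bar> then 1 else - 1 :: real)"
  define P where "P = rec_nat (\<lambda>_. 0) (\<lambda>k p y. 1 * p y + (sg k p * q k) * u k y)"
  have P0: "P 0 = (\<lambda>_. 0)" and PS: "P (Suc k) = (\<lambda>y. 1 * P k y + (sg k (P k) * q k) * u k y)" for k
    by (simp_all add: P_def)
  define c where "c = (\<lambda>k. sg k (P k) * q k)"
  have absc: "\<bar>c k\<bar> = q k" for k using q[of k] by (simp add: c_def sg_def abs_mult)
  have sq: "(\<lambda>l. q (l + n)) sums (q n * (4 / 3))" for n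
  proof -
    have "(\<lambda>l. (1 / 4 :: real) ^ l) sums (1 / (1 - 1 / 4))" by (rule geometric_sums) simp
    then have "(\<lambda>l. q n * (1 / 4) ^ l) sums (q n * (4 / 3))" by (intro sums_mult) simp
    then show ?thesis by (simp add: q_def power_add mult.commute)
  qed
  have sP: "smooth_on UNIV (P k)" for k
  proof (induction k)
    case 0 show ?case by (simp add: P0 smooth_on_const)
  next
    case (Suc k)
    then show ?case unfolding PS using sE[OF u] by (intro smooth_on_linear) auto
  qed
  have Psum: "P k y = (\<Sum>l<k. c l * u l y)" for k y
    by (induction k) (simp_all add: P0 PS c_def)
  have LP: "\<bar>L (is k) (x k) (P (Suc k))\<bar> \<ge> q k * \<bar>L (is k) (x k) (u k)\<bar>" for k
  proof -
    let ?l = "L (is k) (x k)"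
    have lin: "?l (\<lambda>y. 1 * P k y + b * u k y) = ?l (P k) + b * ?l (u k)" for b
      using L_lin[OF sP sE[OF u] xV, of "is k" k 1 k b k] by simp
    have "\<bar>?l (P k) + q k * ?l (u k)\<bar> \<ge> q k * \<bar>?l (u k)\<bar> \<or> \<bar>?l (P k) - q k * ?l (u k)\<bar> \<ge> q k * \<bar>?l (u k)\<bar>"
    proof -
      have "\<bar>q k * ?l (u k)\<bar> = q k * \<bar>?l (u k)\<bar>" using q[of k] by (simp add: abs_mult)
      then show ?thesis by linarith
    qed
    then show ?thesis unfolding PS sg_def lin using lin[of "q k"] lin[of "- q k"] by auto
  qed
  define F where "F = (\<lambda>y. \<Sum>l. c l * u l y)"
  have u': "u k \<in> flat_ball \<sigma> X" for k using u by (simp add: E_def)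
  have sc: "summable (\<lambda>k. \<bar>c k\<bar>)" unfolding absc using sq[of 0] by (simp add: sums_iff)
  note ser = flat_ball_series[of u, OF u' sc \<sigma>, folded F_def]
  have F: "F \<in> flat_ideal M \<Omega> X"
    unfolding flat_ideal_iff[OF O X] CM_iff[OF O]
  proof (intro conjI allI impI ballI)
    show "smooth_on \<Omega> F" using ser(1) by (rule smooth_on_subset) simp
    show "iter_partial is F a = 0" if "a \<in> X" for a "is" using ser(3)[OF that] .
    have S: "(\<Sum>k. \<bar>c k\<bar>) = 4 / 3" unfolding absc using sq[of 0] by (simp add: sums_iff q_def)
    show "\<exists>C>0. \<exists>\<sigma>>0. \<forall>x\<in>K. \<forall>is. \<bar>iter_partial is F x\<bar> \<le> C * \<sigma> ^ length is * fact (length is) * M (length is)" for K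
      by (rule exI[of _ "4 / 3"], rule conjI, simp, rule exI[of _ \<sigma>], intro conjI ballI allI \<sigma>)
        (use ser(2)[unfolded S] in \<open>simp add: mult.assoc\<close>)
  qed
  have LF: "\<bar>L (is k) (x k) F\<bar> \<ge> q k / 3 * \<bar>L (is k) (x k) (u k)\<bar>" for k
  proof -
    let ?l = "L (is k) (x k)"
    \<comment> \<open>Rescales the tail after \<open>k\<close> so that its coefficients have
      absolute sum 1; the tail is then \<open>q k / 3\<close> times an element \<open>e\<close> of
      \<open>E\<close>, to which the near-norming inequality applies.\<close>
    define c' where "c' = (\<lambda>l. 3 / q k * c (l + Suc k))"
    define e where "e = (\<lambda>y. \<Sum>l. c' l * u (l + Suc k) y)"
    have abs': "\<bar>c' l\<bar> = 3 / q k * q (l + Suc k)" for l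
      using q[of k] absc by (simp add: c'_def abs_mult del: add_Suc_right)
    have "(\<lambda>l. \<bar>c' l\<bar>) sums (3 / q k * (q (Suc k) * (4 / 3)))"
      unfolding abs' by (intro sums_mult sq)
    moreover have "3 / q k * (q (Suc k) * (4 / 3)) = 1" using q[of k] by (simp add: q_def)
    ultimately have s1: "(\<lambda>l. \<bar>c' l\<bar>) sums 1" by simp
    note ser' = flat_ball_series[of "\<lambda>l. u (l + Suc k)", OF u' sums_summable[OF s1] \<sigma>, folded e_def]
    have eE: "e \<in> E"
      using ser' sums_unique[OF s1] by (auto simp: E_def flat_ball_def)
    have "F y = 1 * P (Suc k) y + q k / 3 * e y" for y
    proof -
      have "F y = (\<Sum>l. c (l + Suc k) * u (l + Suc k) y) + (\<Sum>l<Suc k. c l * u l y)"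
        unfolding F_def by (rule suminf_split_initial_segment[OF ser(4)])
      moreover have "q k / 3 * e y = (\<Sum>l. c (l + Suc k) * u (l + Suc k) y)"
      proof -
        have t: "q k / 3 * (c' l * u (l + Suc k) y) = c (l + Suc k) * u (l + Suc k) y" for l
          using q[of k] by (simp add: c'_def)
        have "q k / 3 * e y = (\<Sum>l. q k / 3 * (c' l * u (l + Suc k) y))"
          unfolding e_def using ser'(4) by (intro suminf_mult[symmetric])
        then show ?thesis unfolding t .
      qed
      ultimately show ?thesis unfolding Psum by (simp only: mult_1 add.commute)
    qed
    then have "F = (\<lambda>y. 1 * P (Suc k) y + q k / 3 * e y)" by blast
    then have "?l F = ?l (P (Suc k)) + q k / 3 * ?l e"
      using L_lin[OF sP[of "Suc k"] sE[OF eE] xV[of k], of "is k" 1 "q k / 3"] by (simp only: mult_1)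
    moreover have "\<bar>q k / 3 * ?l e\<bar> \<le> q k / 3 * (2 * \<bar>?l (u k)\<bar>)"
      using un[OF eE, of k] q[of k] by (simp add: abs_mult)
    ultimately show ?thesis using LP[of k] by argo
  qed
  obtain g where g: "g \<in> CM M \<Omega>" and Fg: "\<And>y. y \<in> \<Omega> \<Longrightarrow> F y = \<phi> y * g y"
    using F incl by (auto simp: X_def mult_set_def)
  obtain C \<tau> where pos: "C > 0" "\<tau> > 0" and
    bg: "\<And>x is. x \<in> K \<Longrightarrow> \<bar>iter_partial is g x\<bar> \<le> C * \<tau> ^ length is * fact (length is) * M (length is)"
    using CM_bounds[OF O g K] by blast
  \<comment> \<open>The 6 combines the third of the hump that survives in \<open>F\<close> with the
    factor 2 of near-norming.\<close>
  obtain k where k: "real k \<ge> max (6 * C) \<tau>" using real_arch_simple by blast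
  define j where "j = length (is k)"
  have "L (is k) (x k) F = iter_partial (is k) g (x k)"
    unfolding L_def
    by (rule iter_partial_cong[OF V(1) _ xV]) (use Fg in \<open>auto simp: V_def X_def zero_set_def\<close>)
  then have up: "\<bar>L (is k) (x k) F\<bar> \<le> C * \<tau> ^ j * (fact j * M j)"
    using bg[of "x k" "is k"] x[of k] by (simp add: j_def mult.assoc)
  have W: "fact j * M j > 0" using M_pos by simp
  have "C * \<tau> ^ j * (fact j * M j) \<le> (real k / 6) * (real k + 1) ^ j * (fact j * M j)"
    using pos k W by (intro mult_right_mono mult_mono power_mono) auto
  also have "\<dots> < ((real k + 1) / 6) * (real k + 1) ^ j * (fact j * M j)"
    using W by (intro mult_strict_right_mono) auto
  also have "\<dots> = q k / 6 * ((4 ^ k * (real k + 1)) * (real k + 1) ^ j * fact j * M j)"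
    by (simp add: q_def power_one_over)
  also have "\<dots> \<le> q k / 6 * \<bar>L (is k) (x k) (f k)\<bar>"
    using big[of k] q[of k] by (intro mult_left_mono) (auto simp: j_def)
  also have "\<dots> \<le> q k / 6 * (2 * \<bar>L (is k) (x k) (u k)\<bar>)"
    using un[OF f, of k k] q[of k] by (intro mult_left_mono) auto
  also have "\<dots> = q k / 3 * \<bar>L (is k) (x k) (u k)\<bar>" by simp
  also have "\<dots> \<le> \<bar>L (is k) (x k) F\<bar>" by (rule LF)
  finally show False using up by simp
qed

end

section \<open>Smoothing by iterated averages\<close>

text \<open>Some antiderivative; averages take differences of its values, in which the constant of
  integration cancels.\<close>

definition prim :: "(real \<Rightarrow> real) \<Rightarrow> real \<Rightarrow> real" where
  "prim f = (SOME F. \<forall>x. (F has_real_derivative f x) (at x))"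

lemma has_real_derivative_prim:
  assumes "\<And>x. isCont f x"
  shows "(prim f has_real_derivative f x) (at x)"
proof -
  have "\<exists>F. \<forall>x. (F has_real_derivative f x) (at x)"
    using einterval_antiderivative[of "-\<infinity>" "\<infinity>" f] assms
    by (simp add: has_real_derivative_iff_has_vector_derivative)
  then show ?thesis unfolding prim_def by (rule someI_ex[THEN spec])
qed

text \<open>Convolution with the normalised indicator of \<open>[-w, w]\<close>.\<close>

definition avg :: "real \<Rightarrow> (real \<Rightarrow> real) \<Rightarrow> real \<Rightarrow> real" where
  "avg w f x = (prim f (x + w) - prim f (x - w)) / (2 * w)"

text \<open>The derivative of \<open>avg w f\<close> for continuous \<open>f\<close>: after
  averaging, a derivative costs only a factor \<open>1 / w\<close> in the sup norm.\<close>

definition sym_diff_quot :: "real \<Rightarrow> (real \<Rightarrow> real) \<Rightarrow> real \<Rightarrow> real" where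
  "sym_diff_quot w f x = (f (x + w) - f (x - w)) / (2 * w)"

lemma sym_diff_quot_has_derivative:
  assumes "\<And>x. (g has_real_derivative g' x) (at x)"
  shows "(sym_diff_quot w g has_real_derivative sym_diff_quot w g' x) (at x)"
proof -
  have "((\<lambda>x. g (x + w)) has_real_derivative g' (x + w)) (at x)"
    "((\<lambda>x. g (x - w)) has_real_derivative g' (x - w)) (at x)"
    using DERIV_shift[of g "g' (x + w)" x w] DERIV_shift[of g "g' (x - w)" x "- w"] assms by auto
  then show ?thesis unfolding sym_diff_quot_def[abs_def]
    by (intro DERIV_cdivide DERIV_diff)
qed

lemma avg_has_derivative:
  assumes "\<And>x. isCont f x"
  shows "(avg w f has_real_derivative sym_diff_quot w f x) (at x)"
proof -
  have "avg w f = sym_diff_quot w (prim f)" by (auto simp: avg_def sym_diff_quot_def)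
  then show ?thesis using sym_diff_quot_has_derivative[OF has_real_derivative_prim[OF assms]] by simp
qed

text \<open>The mean value theorem for \<open>prim f - prim g\<close>. It shows that averaging does
  not increase the uniform distance between two functions.\<close>

lemma avg_diff_mvt:
  assumes f: "\<And>x. isCont f x" and g: "\<And>x. isCont g x" and w: "w > 0"
  shows "\<exists>z. \<bar>z - x\<bar> \<le> w \<and> avg w f x - avg w g x = f z - g z"
proof -
  let ?H = "\<lambda>x. prim f x - prim g x"
  have "\<exists>z. x - w < z \<and> z < x + w \<and> ?H (x + w) - ?H (x - w) = (x + w - (x - w)) * (f z - g z)"
    using w by (intro MVT2 DERIV_diff has_real_derivative_prim f g) auto
  then obtain z where "x - w < z" "z < x + w" "?H (x + w) - ?H (x - w) = 2 * w * (f z - g z)" by auto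
  moreover have "avg w f x - avg w g x = (?H (x + w) - ?H (x - w)) / (2 * w)"
    by (simp add: avg_def diff_divide_distrib)
  moreover have "2 * w * (f z - g z) / (2 * w) = f z - g z" using w by simp
  ultimately show ?thesis by (intro exI[of _ z]) auto
qed

lemma avg_mvt:
  assumes f: "\<And>x. isCont f x" and w: "w > 0"
  shows "\<exists>z. \<bar>z - x\<bar> \<le> w \<and> avg w f x = f z"
proof -
  have "\<exists>z. x - w < z \<and> z < x + w \<and> prim f (x + w) - prim f (x - w) = (x + w - (x - w)) * f z"
    using w by (intro MVT2 has_real_derivative_prim f) auto
  then obtain z where "x - w < z" "z < x + w" "prim f (x + w) - prim f (x - w) = 2 * w * f z" by auto
  moreover then have "avg w f x = f z"
    using w by (simp add: avg_def)
  ultimately show ?thesis by (intro exI[of _ z]) auto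
qed

text \<open>Averages of widths \<open>w j\<close>, ..., \<open>w (j + n - 1)\<close>, with
  \<open>w j\<close> outermost. The starting index is kept because differentiating removes the
  outermost average and leaves the process started at \<open>j + 1\<close>.\<close>

primrec iter_avg :: "(nat \<Rightarrow> real) \<Rightarrow> (real \<Rightarrow> real) \<Rightarrow> nat \<Rightarrow> nat \<Rightarrow> real \<Rightarrow> real" where
  "iter_avg w f 0 j = f"
| "iter_avg w f (Suc n) j = avg (w j) (iter_avg w f n (Suc j))"

lemma isCont_iter_avg: "(\<And>x. isCont f x) \<Longrightarrow> isCont (iter_avg w f n j) x"
proof (induction n arbitrary: j x)
  case (Suc n)
  show ?case unfolding iter_avg.simps by (rule DERIV_isCont[OF avg_has_derivative]) (rule Suc.IH[OF Suc.prems])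
qed simp

lemma iter_avg_mvt:
  assumes f: "\<And>x. isCont f x" and w: "\<And>j. w j > 0"
  shows "\<exists>z. \<bar>z - x\<bar> \<le> (\<Sum>l<n. w (j + l)) \<and> iter_avg w f n j x = f z"
proof (induction n arbitrary: j x)
  case 0 then show ?case by (intro exI[of _ x]) simp
next
  case (Suc n)
  obtain y where y: "\<bar>y - x\<bar> \<le> w j" "iter_avg w f (Suc n) j x = iter_avg w f n (Suc j) y"
    using avg_mvt[of "iter_avg w f n (Suc j)", OF isCont_iter_avg[OF f] w[of j], of x] by auto
  obtain z where z: "\<bar>z - y\<bar> \<le> (\<Sum>l<n. w (Suc j + l))" "iter_avg w f n (Suc j) y = f z"
    using Suc by blast
  have "(\<Sum>l<Suc n. w (j + l)) = w j + (\<Sum>l<n. w (Suc j + l))"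
    by (simp only: sum.lessThan_Suc_shift) simp
  then have "\<bar>z - x\<bar> \<le> (\<Sum>l<Suc n. w (j + l))" using y(1) z(1) by linarith
  then show ?case using y(2) z(2) by auto
qed

text \<open>The new average is the innermost one and acts directly on the Lipschitz function
  \<open>f\<close>, moving it by at most \<open>L * w (j + n)\<close>; the outer averages do not
  enlarge this.\<close>

lemma iter_avg_step:
  assumes f: "\<And>x. isCont f x" and w: "\<And>j. w j > 0" and L: "\<And>x y. \<bar>f x - f y\<bar> \<le> L * \<bar>x - y\<bar>" "L \<ge> 0"
  shows "\<bar>iter_avg w f (Suc n) j x - iter_avg w f n j x\<bar> \<le> L * w (j + n)"
proof (induction n arbitrary: j x)
  case 0
  obtain z where z: "\<bar>z - x\<bar> \<le> w j" "avg (w j) f x = f z" using avg_mvt[OF f w] by blast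
  have "\<bar>f z - f x\<bar> \<le> L * \<bar>z - x\<bar>" by (rule L)
  also have "\<dots> \<le> L * w j" using z L by (intro mult_left_mono)
  finally show ?case using z by simp
next
  case (Suc n)
  obtain z where z: "avg (w j) (iter_avg w f (Suc n) (Suc j)) x - avg (w j) (iter_avg w f n (Suc j)) x
     = iter_avg w f (Suc n) (Suc j) z - iter_avg w f n (Suc j) z"
    using avg_diff_mvt[of "iter_avg w f (Suc n) (Suc j)" "iter_avg w f n (Suc j)",
        OF isCont_iter_avg[OF f] isCont_iter_avg[OF f] w] by blast
  show ?case unfolding iter_avg.simps(2)[of w f "Suc n" j] iter_avg.simps(2)[of w f n j] z
    using Suc[of "Suc j" z] by simp
qed

text \<open>Infinite convolution with boxes. Summable widths give uniform convergence, and the value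
  at \<open>x\<close> depends on \<open>f\<close> only within the total width
  \<open>suminf w\<close>, which preserves plateaus. The Lipschitz constant enters the convergence
  but not the bound on \<open>G\<close>.\<close>

lemma smoothing_limit:
  fixes f :: "real \<Rightarrow> real"
  assumes f: "\<And>x. isCont f x" and w: "\<And>j. w j > 0" "summable w"
    and L: "\<And>x y. \<bar>f x - f y\<bar> \<le> L * \<bar>x - y\<bar>" "L \<ge> 0" and B: "\<And>x. \<bar>f x\<bar> \<le> B"
  obtains G where
    "\<And>j x. (G j has_real_derivative sym_diff_quot (w j) (G (Suc j)) x) (at x)"
    "\<And>j x. \<bar>G j x\<bar> \<le> B"
    "\<And>c x. (\<And>y. \<bar>y - x\<bar> \<le> suminf w \<Longrightarrow> f y = c) \<Longrightarrow> G 0 x = c"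
proof -
  let ?d = "\<lambda>j n x. iter_avg w f (Suc n) j x - iter_avg w f n j x"
  define G where "G = (\<lambda>j x. f x + (\<Sum>n. ?d j n x))"
  have tel: "iter_avg w f n j x = f x + (\<Sum>m<n. ?d j m x)" for n j x
    by (induction n) auto
  have sw: "summable (\<lambda>n. L * w (j + n))" for j
    using w(2) by (intro summable_mult) (simp add: summable_iff_shift add.commute[of j])
  have unif: "uniform_limit UNIV (\<lambda>n. iter_avg w f n j) (G j) sequentially" for j
  proof -
    have "uniform_limit UNIV (\<lambda>n x. \<Sum>m<n. ?d j m x) (\<lambda>x. \<Sum>m. ?d j m x) sequentially"
      by (rule Weierstrass_m_test[OF _ sw[of j]]) (use iter_avg_step[OF f w(1) L] in auto)
    then have "uniform_limit UNIV (\<lambda>n x. f x + (\<Sum>m<n. ?d j m x)) (G j) sequentially"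
      unfolding G_def by (intro uniform_limit_intros)
    then show ?thesis unfolding tel[symmetric] .
  qed
  have lim: "(\<lambda>n. iter_avg w f n j x) \<longlonglongrightarrow> G j x" for j x
    using tendsto_uniform_limitI[OF unif] by simp
  have contG: "isCont (G j) x" for j x
  proof -
    have "continuous_on UNIV (G j)"
      by (rule uniform_limit_theorem[OF _ unif])
        (auto intro!: always_eventually continuous_at_imp_continuous_on isCont_iter_avg f)
    then show ?thesis by (simp add: continuous_on_eq_continuous_at)
  qed
  \<comment> \<open>\<open>avg_diff_mvt\<close> carries the average through the uniform limit; this
    relation makes each \<open>G j\<close> differentiable.\<close>
  have G_avg: "G j x = avg (w j) (G (Suc j)) x" for j x
  proof (rule LIMSEQ_unique)
    show "(\<lambda>n. iter_avg w f (Suc n) j x) \<longlonglongrightarrow> G j x" using lim by (rule LIMSEQ_Suc)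
    show "(\<lambda>n. iter_avg w f (Suc n) j x) \<longlonglongrightarrow> avg (w j) (G (Suc j)) x"
    proof (rule metric_LIMSEQ_I)
      fix e :: real assume e: "e > 0"
      obtain N where N: "\<And>n y. n \<ge> N \<Longrightarrow> dist (iter_avg w f n (Suc j) y) (G (Suc j) y) < e"
        using uniform_limitD[OF unif[of "Suc j"] e] unfolding eventually_sequentially by auto
      show "\<exists>no. \<forall>n\<ge>no. dist (iter_avg w f (Suc n) j x) (avg (w j) (G (Suc j)) x) < e"
      proof (intro exI[of _ N] allI impI)
        fix n assume n: "N \<le> n"
        obtain z where "avg (w j) (iter_avg w f n (Suc j)) x - avg (w j) (G (Suc j)) x = iter_avg w f n (Suc j) z - G (Suc j) z"
          using avg_diff_mvt[of "iter_avg w f n (Suc j)" "G (Suc j)", OF isCont_iter_avg[OF f] contG w(1)] by blast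
        then show "dist (iter_avg w f (Suc n) j x) (avg (w j) (G (Suc j)) x) < e"
          using N[OF n, of z] by (simp add: dist_real_def)
      qed
    qed
  qed
  show thesis
  proof (rule that[of G])
    show "(G j has_real_derivative sym_diff_quot (w j) (G (Suc j)) x) (at x)" for j x
    proof -
      have "G j = avg (w j) (G (Suc j))" using G_avg by blast
      then show ?thesis using avg_has_derivative[OF contG] by simp
    qed
    show "\<bar>G j x\<bar> \<le> B" for j x
    proof (rule LIMSEQ_le_const2[OF tendsto_rabs[OF lim]], intro exI[of _ 0] allI impI)
      fix n show "\<bar>iter_avg w f n j x\<bar> \<le> B" using iter_avg_mvt[where f = f and w = w and x = x and n = n and j = j, OF f w(1)] B by auto
    qed
    show "G 0 x = c" if c: "\<And>y. \<bar>y - x\<bar> \<le> suminf w \<Longrightarrow> f y = c" for c x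
    proof (rule LIMSEQ_unique[OF lim])
      have "iter_avg w f n 0 x = c" for n
      proof -
        obtain z where z: "\<bar>z - x\<bar> \<le> (\<Sum>l<n. w l)" "iter_avg w f n 0 x = f z"
          using iter_avg_mvt[where f = f and w = w and x = x and n = n and j = 0, OF f w(1)] by auto
        have "(\<Sum>l<n. w l) \<le> suminf w" using w by (intro sum_le_suminf) (auto simp: less_imp_le)
        then show ?thesis using c z by simp
      qed
      then show "(\<lambda>n. iter_avg w f n 0 x) \<longlonglongrightarrow> c" by simp
    qed
  qed
qed

text \<open>Applied to \<open>G j\<close> from \<open>smoothing_limit\<close>, this gives the
  \<open>j\<close>th derivative of \<open>G 0\<close>: each derivative turns one more average into a
  difference quotient.\<close>

primrec iter_diff :: "(nat \<Rightarrow> real) \<Rightarrow> nat \<Rightarrow> (real \<Rightarrow> real) \<Rightarrow> real \<Rightarrow> real" where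
  "iter_diff w 0 g = g"
| "iter_diff w (Suc j) g = iter_diff w j (sym_diff_quot (w j) g)"

lemma iter_diff_has_derivative:
  assumes "\<And>x. (g has_real_derivative g' x) (at x)"
  shows "(iter_diff w j g has_real_derivative iter_diff w j g' x) (at x)"
  using assms
proof (induction j arbitrary: g g' x)
  case (Suc j)
  show ?case unfolding iter_diff.simps by (rule Suc.IH) (rule sym_diff_quot_has_derivative[OF Suc.prems])
qed simp

lemma iter_diff_bound:
  assumes "\<And>x. \<bar>g x\<bar> \<le> B" "\<And>j. w j > 0"
  shows "\<bar>iter_diff w j g x\<bar> \<le> B * (\<Prod>i<j. 1 / w i)"
  using assms(1)
proof (induction j arbitrary: g x B)
  case (Suc j)
  have "\<bar>sym_diff_quot (w j) g y\<bar> \<le> B * (1 / w j)" for y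
  proof -
    have "\<bar>g (y + w j) - g (y - w j)\<bar> \<le> 2 * B" using Suc.prems[of "y + w j"] Suc.prems[of "y - w j"] by linarith
    then have "\<bar>g (y + w j) - g (y - w j)\<bar> / (2 * w j) \<le> 2 * B / (2 * w j)"
      using assms(2)[of j] by (intro divide_right_mono) auto
    then show ?thesis using assms(2)[of j] by (simp add: sym_diff_quot_def abs_divide)
  qed
  from Suc.IH[OF this] show ?case by (simp add: mult_ac)
qed simp

section \<open>Optimal cutoff functions\<close>

lemma iter_partial_tensor:
  fixes \<psi> :: "nat \<Rightarrow> real \<Rightarrow> real" and p :: "real^'n::finite"
  assumes \<psi>: "\<And>j x. (\<psi> j has_real_derivative \<psi> (Suc j) x) (at x)"
  shows "iter_partial is (\<lambda>x. \<Prod>i\<in>UNIV. \<psi> 0 (x $ i - p $ i))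
     = (\<lambda>x. \<Prod>i\<in>UNIV. \<psi> (count (mset is) i) (x $ i - p $ i))"
    and "smooth_on UNIV (\<lambda>x. \<Prod>i\<in>UNIV. \<psi> 0 (x $ i - p $ i))"
proof -
  have d: "((\<lambda>x. \<Prod>i\<in>UNIV. \<psi> (a i) (x $ i - p $ i)) has_derivative
     (\<lambda>h. \<Sum>i\<in>UNIV. (h $ i * \<psi> (Suc (a i)) (x $ i - p $ i)) * (\<Prod>j\<in>UNIV - {i}. \<psi> (a j) (x $ j - p $ j)))) (at x)" for a x
  proof (rule has_derivative_prod)
    fix i :: 'n
    have "((\<lambda>x :: real^'n. x $ i - p $ i) has_derivative (\<lambda>h. h $ i)) (at x)"
      by (auto intro!: derivative_eq_intros bounded_linear.has_derivative[OF bounded_linear_vec_nth])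
    from has_derivative_compose[OF this \<psi>[of "a i" "x $ i - p $ i", unfolded has_field_derivative_def]]
    show "((\<lambda>x. \<psi> (a i) (x $ i - p $ i)) has_derivative (\<lambda>h. h $ i * \<psi> (Suc (a i)) (x $ i - p $ i))) (at x)"
      by (simp add: mult.commute)
  qed
  show 1: "iter_partial is (\<lambda>x. \<Prod>i\<in>UNIV. \<psi> 0 (x $ i - p $ i))
     = (\<lambda>x. \<Prod>i\<in>UNIV. \<psi> (count (mset is) i) (x $ i - p $ i))" for "is"
  proof (induction "is")
    case Nil show ?case by simp
  next
    case (Cons k "is")
    let ?a = "count (mset is)"
    have "partial_deriv k (\<lambda>x. \<Prod>i\<in>UNIV. \<psi> (?a i) (x $ i - p $ i)) x
      = (\<Prod>i\<in>UNIV. \<psi> (count (mset (k # is)) i) (x $ i - p $ i))" for x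
    proof -
      have "partial_deriv k (\<lambda>x. \<Prod>i\<in>UNIV. \<psi> (?a i) (x $ i - p $ i)) x =
        (\<Sum>i\<in>UNIV. (axis k 1 $ i * \<psi> (Suc (?a i)) (x $ i - p $ i)) * (\<Prod>j\<in>UNIV - {i}. \<psi> (?a j) (x $ j - p $ j)))"
        by (rule partial_deriv_eq[OF d])
      also have "\<dots> = \<psi> (Suc (?a k)) (x $ k - p $ k) * (\<Prod>j\<in>UNIV - {k}. \<psi> (?a j) (x $ j - p $ j))"
        by (subst sum.remove[of _ k]) (auto simp: axis_def intro!: sum.neutral)
      also have "\<dots> = (\<Prod>i\<in>UNIV. \<psi> (count (mset (k # is)) i) (x $ i - p $ i))"
        by (subst prod.remove[of UNIV k]) (auto intro!: prod.cong)
      finally show ?thesis .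
    qed
    then show ?case unfolding iter_partial.simps Cons.IH by blast
  qed
  show "smooth_on UNIV (\<lambda>x. \<Prod>i\<in>UNIV. \<psi> 0 (x $ i - p $ i))"
    unfolding smooth_on_def 1 using differentiableI[OF d] by blast
qed

context strongly_regular_seq
begin

text \<open>The derivatives of a trapezoid smoothed by boxes of widths \<open>w i\<close> are
  bounded by products of \<open>1 / w i\<close>. The widths must sum to at most a fixed part of
  \<open>r\<close>, while these products exceed the \<open>C\<^sub>M\<close> weights by no more than
  \<open>1 / hM M (lam * r)\<close>, with \<open>\<sigma>\<close> independent of
  \<open>r\<close>.\<close>

lemma bump_1d:
  assumes lam: "lam > 0"
  shows "\<exists>\<sigma>>0. \<forall>r>0. \<exists>\<psi>.
     (\<forall>j x. (\<psi> j has_real_derivative \<psi> (Suc j) x) (at x)) \<and>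
     (\<forall>x. \<bar>x\<bar> \<le> r / 8 \<longrightarrow> \<psi> 0 x = 1) \<and> (\<forall>x. \<bar>x\<bar> \<ge> r \<longrightarrow> \<psi> 0 x = 0) \<and>
     (\<forall>j x. \<bar>\<psi> j x\<bar> \<le> \<sigma> ^ j * fact j * M j / hM M (lam * r))"
proof -
  obtain A where A: "A > 0" and sA: "\<And>k. summable (\<lambda>j. M (j + k) / (real (j + k + 1) * M (j + k + 1)))"
    and bA: "\<And>k. (\<Sum>j. M (j + k) / (real (j + k + 1) * M (j + k + 1))) \<le> A * (M k / M (k + 1))"
    using ratio_tail_sum by blast
  \<comment> \<open>Replacing \<open>lam\<close> by \<open>exp 1 * lam\<close> gains the factor
    \<open>exp 1 ^ k\<close> in \<open>Hk\<close>, which pays for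
    \<open>power_le_fact_exp\<close>.\<close>
  define lam' where "lam' = exp 1 * lam"
  have lam': "lam' > 0" using lam by (simp add: lam'_def)
  \<comment> \<open>Makes the bound \<open>c * A * t\<close> for the tail of the widths equal to
    \<open>r / 8\<close>.\<close>
  define c where "c = 1 / (8 * A * lam')"
  have c: "c > 0" using A lam' by (simp add: c_def)
  \<comment> \<open>Dominates both \<open>8 * lam'\<close>, the cost per derivative up to order
    \<open>k\<close>, and \<open>1 / c = 8 * A * lam'\<close>, the cost beyond.\<close>
  define \<sigma> where "\<sigma> = 8 * lam' * max 1 A"
  have \<sigma>: "\<sigma> > 0" using lam' by (simp add: \<sigma>_def)
  show ?thesis
  proof (intro exI[of _ \<sigma>] conjI allI impI \<sigma>)
    fix r :: real assume r: "r > 0"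
    define t where "t = lam' * r"
    have t: "t > 0" using lam' r by (simp add: t_def)
    obtain k where k1: "M (Suc k) / M k * t > 1" and k2: "\<And>j. t ^ k * M k \<le> t ^ j * M j"
      using optimal_index[OF t] by blast
    \<comment> \<open>\<open>k\<close> realises the infimum \<open>hM M t\<close>; the first \<open>k\<close> box widths are equal and share a fixed part of
      the radius, the remaining ones are proportional to the terms of the series in the strong
      regularity condition, whose tail from \<open>k\<close> on is thereby at most a fixed part of the radius.\<close>
    define w where "w = (\<lambda>i. if i < k then r / (8 * real k) else c * (M i / (real (i + 1) * M (i + 1))))"
    have w: "w i > 0" for i using r c M_pos by (auto simp: w_def)
    have wk: "w (i + k) = c * (M (i + k) / (real (i + k + 1) * M (i + k + 1)))" for i by (simp add: w_def)
    have "summable (\<lambda>i. w (i + k))" unfolding wk by (intro summable_mult sA)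
    then have sw: "summable w" by (simp add: summable_iff_shift)
    have sumw: "suminf w \<le> r / 4"
    proof -
      have "suminf w = (\<Sum>i. w (i + k)) + (\<Sum>i<k. w i)" by (rule suminf_split_initial_segment[OF sw])
      also have "(\<Sum>i<k. w i) \<le> r / 8"
        by (cases "k = 0") (use r in \<open>auto simp: w_def\<close>)
      also have "(\<Sum>i. w (i + k)) = c * (\<Sum>i. M (i + k) / (real (i + k + 1) * M (i + k + 1)))"
        unfolding wk by (rule suminf_mult[OF sA])
      also have "\<dots> \<le> c * (A * (M k / M (k + 1)))" using c bA by (intro mult_left_mono) auto
      also have "\<dots> \<le> c * (A * t)"
      proof -
        have "M k / M (k + 1) \<le> t" using k1 M_pos[of k] M_pos[of "Suc k"] by (simp add: field_simps)
        then show ?thesis using c A by (intro mult_left_mono) auto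
      qed
      also have "\<dots> = r / 8" using A lam' by (simp add: c_def t_def)
      finally show ?thesis by simp
    qed
    \<comment> \<open>A trapezoid equal to 1 up to \<open>3 / 8 * r\<close> and to 0 from
      \<open>5 / 8 * r\<close> on. Averages of total width at most \<open>r / 4\<close> keep the
      value 1 up to \<open>r / 8\<close> and the value 0 from \<open>r\<close> on.\<close>
    define f where "f = (\<lambda>x. max 0 (min 1 (5 / 2 - 4 * \<bar>x\<bar> / r)))"
    have f_cont: "isCont f x" for x unfolding f_def by (intro continuous_intros) (use r in auto)
    have f_lip: "\<bar>f x - f y\<bar> \<le> 4 / r * \<bar>x - y\<bar>" for x y
    proof -
      have "\<bar>f x - f y\<bar> \<le> \<bar>4 * \<bar>x\<bar> / r - 4 * \<bar>y\<bar> / r\<bar>" unfolding f_def by linarith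
      also have "4 * \<bar>x\<bar> / r - 4 * \<bar>y\<bar> / r = 4 / r * (\<bar>x\<bar> - \<bar>y\<bar>)" by (simp add: algebra_simps diff_divide_distrib)
      also have "\<bar>\<dots>\<bar> = 4 / r * \<bar>\<bar>x\<bar> - \<bar>y\<bar>\<bar>" unfolding abs_mult using r by simp
      also have "\<dots> \<le> 4 / r * \<bar>x - y\<bar>" using r by (intro mult_left_mono abs_triangle_ineq3) simp
      finally show ?thesis .
    qed
    have f_bd: "\<bar>f x\<bar> \<le> 1" for x by (auto simp: f_def)
    obtain G where G: "\<And>j x. (G j has_real_derivative sym_diff_quot (w j) (G (Suc j)) x) (at x)"
      and Gb: "\<And>j x. \<bar>G j x\<bar> \<le> 1"
      and Gc: "\<And>c x. (\<And>y. \<bar>y - x\<bar> \<le> suminf w \<Longrightarrow> f y = c) \<Longrightarrow> G 0 x = c"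
      using smoothing_limit[of f w "4 / r" 1, OF f_cont w sw f_lip _ f_bd] r by auto
    define \<psi> where "\<psi> = (\<lambda>j. iter_diff w j (G j))"
    define H where "H = hM M (lam * r)"
    have H: "H > 0" unfolding H_def using lam r by (intro hM_pos) auto
    have Hk: "H * exp 1 ^ k \<le> t ^ k * M k"
    proof -
      have "H \<le> (lam * r) ^ k * M k" unfolding H_def using lam r by (intro hM_le) auto
      then have "H * exp 1 ^ k \<le> (lam * r) ^ k * M k * exp 1 ^ k" by (intro mult_right_mono) auto
      also have "\<dots> = t ^ k * M k" by (simp add: t_def lam'_def power_mult_distrib)
      finally show ?thesis .
    qed
    \<comment> \<open>Here \<open>H * exp 1 ^ k \<le> t ^ k * M k \<le> t ^ j * M j\<close>, the
      second step by optimality of \<open>k\<close>.\<close>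
    have small: "(\<Prod>i<j. 1 / w i) \<le> (8 * lam') ^ j * fact j * M j / H" if j: "j \<le> k" for j
    proof -
      have "(\<Prod>i<j. 1 / w i) = (\<Prod>i<j. 8 * real k / r)"
        using j by (intro prod.cong) (auto simp: w_def)
      also have "\<dots> = (8 * lam') ^ j * real k ^ j / t ^ j"
        using r lam' by (simp add: t_def power_mult_distrib power_divide)
      also have "\<dots> \<le> (8 * lam') ^ j * (fact j * exp 1 ^ k) / t ^ j"
        using lam' t power_le_fact_exp[of k j] by (intro divide_right_mono mult_left_mono) auto
      also have "\<dots> \<le> (8 * lam') ^ j * fact j * (M j / H)"
      proof -
        have "exp 1 ^ k * H \<le> M j * t ^ j" using Hk k2[of j] by (simp add: mult.commute)
        then have "exp 1 ^ k / t ^ j \<le> M j / H" using H t by (simp add: pos_divide_le_eq pos_le_divide_eq)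
        then have "(8 * lam') ^ j * fact j * (exp 1 ^ k / t ^ j) \<le> (8 * lam') ^ j * fact j * (M j / H)"
          using lam' by (intro mult_left_mono) auto
        then show ?thesis by (simp add: mult.assoc)
      qed
      finally show ?thesis by simp
    qed
    \<comment> \<open>Beyond \<open>k\<close> the reciprocal widths are \<open>1 / c\<close> times
      the successive ratios of \<open>i! * M i\<close>, so the product telescopes.\<close>
    have large: "(\<Prod>i<k + l. 1 / w i) = (\<Prod>i<k. 1 / w i) * (1 / c) ^ l * (fact (k + l) / fact k) * (M (k + l) / M k)" for l
    proof (induction l)
      case 0 then show ?case using M_pos[of k] by simp
    next
      case (Suc l)
      have "1 / w (k + l) = 1 / c * (real (Suc (k + l)) * (M (Suc (k + l)) / M (k + l)))"
        by (simp add: w_def)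
      moreover have "fact (k + Suc l) = real (Suc (k + l)) * fact (k + l)" by simp
      moreover have "P * Q * (F / F') * (m / m') * (a * (n * (m'' / m))) = P * (a * Q) * (n * F / F') * (m'' / m')"
        if "m > 0" for P Q F F' m m' m'' a n :: real using that by simp
      ultimately show ?case using Suc M_pos[of "k + l"]
        by (simp only: add_Suc_right prod.lessThan_Suc power_Suc)
    qed
    have prod_bd: "(\<Prod>i<j. 1 / w i) \<le> \<sigma> ^ j * fact j * M j / H" for j
    proof (cases "j \<le> k")
      case True
      have "(8 * lam') ^ j \<le> \<sigma> ^ j" using lam' by (intro power_mono) (auto simp: \<sigma>_def)
      then have "(8 * lam') ^ j * fact j * M j / H \<le> \<sigma> ^ j * fact j * M j / H"
        using H M_nonneg by (intro divide_right_mono mult_right_mono) auto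
      then show ?thesis using small[OF True] by simp
    next
      case False
      then obtain l where l: "j = k + l" using le_Suc_ex by (meson nat_le_linear)
      have "(\<Prod>i<j. 1 / w i) \<le> ((8 * lam') ^ k * fact k * M k / H) * (1 / c) ^ l * (fact j / fact k) * (M j / M k)"
        unfolding l large using small[OF order.refl] c M_nonneg by (intro mult_right_mono) auto
      also have "\<dots> = ((8 * lam') ^ k * (1 / c) ^ l) * fact j * M j / H"
      proof -
        have "(a * F * m / h) * b * (F' / F) * (m' / m) = (a * b) * F' * m' / h"
          if "F > 0" "m > 0" for a b F F' m m' h :: real using that by simp
        then show ?thesis using M_pos[of k] by (simp only: fact_gt_zero)
      qed
      also have "\<dots> \<le> (\<sigma> ^ k * \<sigma> ^ l) * fact j * M j / H"
      proof (intro divide_right_mono mult_right_mono mult_mono power_mono)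
        show "1 / c \<le> \<sigma>" using A lam' by (simp add: c_def \<sigma>_def mult_ac)
      qed (use lam' c \<sigma> H M_nonneg in \<open>auto simp: \<sigma>_def\<close>)
      finally show ?thesis by (simp add: l power_add)
    qed
    show "\<exists>\<psi>. (\<forall>j x. (\<psi> j has_real_derivative \<psi> (Suc j) x) (at x)) \<and>
     (\<forall>x. \<bar>x\<bar> \<le> r / 8 \<longrightarrow> \<psi> 0 x = 1) \<and> (\<forall>x. \<bar>x\<bar> \<ge> r \<longrightarrow> \<psi> 0 x = 0) \<and>
     (\<forall>j x. \<bar>\<psi> j x\<bar> \<le> \<sigma> ^ j * fact j * M j / hM M (lam * r))"
    proof (intro exI[of _ \<psi>] conjI allI impI)
      show "(\<psi> j has_real_derivative \<psi> (Suc j) x) (at x)" for j x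
        unfolding \<psi>_def iter_diff.simps by (rule iter_diff_has_derivative[OF G])
      show "\<psi> 0 x = 1" if x: "\<bar>x\<bar> \<le> r / 8" for x
        unfolding \<psi>_def iter_diff.simps
      proof (rule Gc)
        fix y assume "\<bar>y - x\<bar> \<le> suminf w"
        then have "\<bar>y\<bar> \<le> 3 / 8 * r" using x sumw by linarith
        then have "4 * \<bar>y\<bar> / r \<le> 3 / 2" using r by (simp add: field_simps)
        then show "f y = 1" by (simp add: f_def)
      qed
      show "\<psi> 0 x = 0" if x: "\<bar>x\<bar> \<ge> r" for x
        unfolding \<psi>_def iter_diff.simps
      proof (rule Gc)
        fix y assume "\<bar>y - x\<bar> \<le> suminf w"
        then have "\<bar>y\<bar> \<ge> 3 / 4 * r" using x sumw by linarith
        then have "4 * \<bar>y\<bar> / r \<ge> 3" using r by (simp add: field_simps)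
        then show "f y = 0" by (simp add: f_def)
      qed
      show "\<bar>\<psi> j x\<bar> \<le> \<sigma> ^ j * fact j * M j / hM M (lam * r)" for j x
        using iter_diff_bound[of "G j" 1 w j x, OF Gb w] prod_bd[of j] by (simp add: \<psi>_def H_def)
    qed
  qed
qed

lemma prod_weight_le:
  assumes "finite S"
  shows "(\<Prod>i\<in>S. fact (a i) * M (a i)) \<le> fact (\<Sum>i\<in>S. a i) * M (\<Sum>i\<in>S. a i)"
  using assms
proof (induction S rule: finite_induct)
  case empty then show ?case by (simp add: M_0)
next
  case (insert i S)
  have "(\<Prod>i\<in>insert i S. fact (a i) * M (a i)) \<le> fact (a i) * M (a i) * (fact (\<Sum>i\<in>S. a i) * M (\<Sum>i\<in>S. a i))"
    unfolding prod.insert[OF insert.hyps] using insert.IH M_nonneg by (intro mult_left_mono) auto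
  also have "\<dots> \<le> fact (\<Sum>i\<in>insert i S. a i) * M (\<Sum>i\<in>insert i S. a i)"
    unfolding sum.insert[OF insert.hyps] by (rule weight_mult_le)
  finally show ?case .
qed

text \<open>A product of one-dimensional bumps of radius \<open>r / CARD('n)\<close>: by the
  \<open>l1\<close> bound on the norm, a point at distance at least \<open>r\<close> has some
  coordinate outside its interval.\<close>

lemma bump:
  assumes lam: "lam > 0"
  shows "\<exists>\<sigma>>0. \<forall>x0 :: real^'n::finite. \<forall>r>0. \<exists>\<beta>. smooth_on UNIV \<beta> \<and>
     (\<exists>e>0. \<forall>y\<in>ball x0 e. \<beta> y = 1) \<and> (\<forall>y. dist x0 y \<ge> r \<longrightarrow> \<beta> y = 0) \<and>
     (\<forall>is x. \<bar>iter_partial is \<beta> x\<bar> \<le> \<sigma> ^ length is * fact (length is) * M (length is) / hM M (lam * r))"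
proof -
  define N where "N = CARD('n)"
  have N: "N > 0" by (simp add: N_def)
  obtain B where B: "B \<ge> 1" "\<And>t. t > 0 \<Longrightarrow> hM M t \<le> hM M (B * t) ^ N" using hM_power by blast
  \<comment> \<open>The factor \<open>N\<close> undoes the shrinking of the radius to
    \<open>r / N\<close>; \<open>B\<close> turns the \<open>N\<close>th power of \<open>hM\<close>
    in the denominator into \<open>hM M (lam * r)\<close>.\<close>
  have "B * lam * real N > 0" using B lam N by simp
  from bump_1d[OF this] obtain \<sigma> where \<sigma>: "\<sigma> > 0" and ex: "\<forall>r>0. \<exists>\<psi>.
     (\<forall>j x. (\<psi> j has_real_derivative \<psi> (Suc j) x) (at x)) \<and>
     (\<forall>x. \<bar>x\<bar> \<le> r / 8 \<longrightarrow> \<psi> 0 x = 1) \<and> (\<forall>x. \<bar>x\<bar> \<ge> r \<longrightarrow> \<psi> 0 x = 0) \<and>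
     (\<forall>j x. \<bar>\<psi> j x\<bar> \<le> \<sigma> ^ j * fact j * M j / hM M (B * lam * real N * r))"
    by blast
  show ?thesis
  proof (intro exI[of _ \<sigma>] conjI allI impI \<sigma>)
    fix x0 :: "real^'n" and r :: real assume r: "r > 0"
    define \<rho> where "\<rho> = r / real N"
    have \<rho>: "\<rho> > 0" "real N * \<rho> = r" using r N by (auto simp: \<rho>_def)
    define H where "H = hM M (B * (lam * r))"
    have H: "H > 0" unfolding H_def using B lam r by (intro hM_pos) auto
    have Hr: "hM M (B * lam * real N * \<rho>) = H" using \<rho>(2) by (simp add: H_def mult.assoc)
    obtain \<psi> where \<psi>: "\<And>j x. (\<psi> j has_real_derivative \<psi> (Suc j) x) (at x)"
      and \<psi>1: "\<And>x. \<bar>x\<bar> \<le> \<rho> / 8 \<Longrightarrow> \<psi> 0 x = 1" and \<psi>0: "\<And>x. \<bar>x\<bar> \<ge> \<rho> \<Longrightarrow> \<psi> 0 x = 0"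
      and \<psi>b: "\<And>j x. \<bar>\<psi> j x\<bar> \<le> \<sigma> ^ j * fact j * M j / H"
      using ex[rule_format, OF \<rho>(1)] unfolding Hr by blast
    define \<beta> where "\<beta> = (\<lambda>x :: real^'n. \<Prod>i\<in>UNIV. \<psi> 0 (x $ i - x0 $ i))"
    note tens = iter_partial_tensor(1)[where \<psi> = \<psi> and p = x0, OF \<psi>, folded \<beta>_def]
      iter_partial_tensor(2)[where \<psi> = \<psi> and p = x0, OF \<psi>, folded \<beta>_def]
    show "\<exists>\<beta>. smooth_on UNIV \<beta> \<and>
     (\<exists>e>0. \<forall>y\<in>ball x0 e. \<beta> y = 1) \<and> (\<forall>y. dist x0 y \<ge> r \<longrightarrow> \<beta> y = 0) \<and>
     (\<forall>is x. \<bar>iter_partial is \<beta> x\<bar> \<le> \<sigma> ^ length is * fact (length is) * M (length is) / hM M (lam * r))"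
    proof (intro exI[of _ \<beta>] conjI allI impI)
      show "smooth_on UNIV \<beta>" by (rule tens(2))
      show "\<exists>e>0. \<forall>y\<in>ball x0 e. \<beta> y = 1"
      proof (intro exI[of _ "\<rho> / 8"] conjI ballI)
        fix y assume "y \<in> ball x0 (\<rho> / 8)"
        then have "\<bar>y $ i - x0 $ i\<bar> \<le> \<rho> / 8" for i
          using component_le_norm_cart[of "y - x0" i] by (simp add: dist_norm norm_minus_commute)
        then show "\<beta> y = 1" using \<psi>1 by (simp add: \<beta>_def)
      qed (use \<rho> in auto)
      show "\<beta> y = 0" if y: "dist x0 y \<ge> r" for y
      proof -
        have "\<exists>i. \<bar>y $ i - x0 $ i\<bar> \<ge> \<rho>"
        proof (rule ccontr)
          assume "\<not> ?thesis"
          then have "\<bar>(y - x0) $ i\<bar> < \<rho>" for i by (simp add: not_le)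
          then have "(\<Sum>i\<in>UNIV. \<bar>(y - x0) $ i\<bar>) < (\<Sum>i\<in>(UNIV :: 'n set). \<rho>)" by (intro sum_strict_mono) auto
          also have "\<dots> = r" using \<rho>(2) by (simp add: N_def)
          finally show False using norm_le_l1_cart[of "y - x0"] y by (simp add: dist_norm norm_minus_commute)
        qed
        then obtain i where "\<psi> 0 (y $ i - x0 $ i) = 0" using \<psi>0 by blast
        then show ?thesis unfolding \<beta>_def by (intro prod_zero) auto
      qed
      fix "is" :: "'n list" and x
      let ?a = "count (mset is)"
      have len: "length is = (\<Sum>i\<in>UNIV. ?a i)" by (rule length_eq_sum_count)
      have "\<bar>iter_partial is \<beta> x\<bar> = (\<Prod>i\<in>UNIV. \<bar>\<psi> (?a i) (x $ i - x0 $ i)\<bar>)"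
        unfolding tens(1) by (rule abs_prod)
      also have "\<dots> \<le> (\<Prod>i\<in>UNIV. \<sigma> ^ ?a i * (fact (?a i) * M (?a i)) / H)"
        using \<psi>b by (intro prod_mono) (auto simp: mult.assoc)
      also have "\<dots> = \<sigma> ^ length is * (\<Prod>i\<in>UNIV. fact (?a i) * M (?a i)) / H ^ N"
        unfolding prod_dividef prod.distrib len power_sum by (simp add: N_def)
      also have "\<dots> \<le> \<sigma> ^ length is * (fact (length is) * M (length is)) / hM M (lam * r)"
      proof (intro frac_le mult_left_mono mult_nonneg_nonneg)
        show "(\<Prod>i\<in>UNIV. fact (?a i) * M (?a i)) \<le> fact (length is) * M (length is)"
          unfolding len by (rule prod_weight_le) simp
        show "hM M (lam * r) \<le> H ^ N" unfolding H_def using lam r by (intro B(2)) auto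
        show "0 < hM M (lam * r)" using lam r by (intro hM_pos) auto
      qed (use \<sigma> M_nonneg in auto)
      finally show "\<bar>iter_partial is \<beta> x\<bar> \<le> \<sigma> ^ length is * fact (length is) * M (length is) / hM M (lam * r)"
        by (simp add: mult.assoc)
    qed
  qed
qed

end

section \<open>The equivalences\<close>

context strongly_regular_seq
begin

lemma division_imp_lojasiewicz:
  fixes \<phi> :: "real^'n::finite \<Rightarrow> real"
  assumes O: "open \<Omega>" and \<phi>: "\<phi> \<in> CM M \<Omega>"
    and incl: "flat_ideal M \<Omega> (zero_set \<Omega> \<phi>) \<subseteq> mult_set \<Omega> \<phi> (CM M \<Omega>)"
  shows "CM_lojasiewicz M \<Omega> \<phi>"
proof -
  define X where "X = zero_set \<Omega> \<phi>"
  define V where "V = \<Omega> - X"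
  have X: "X \<subseteq> \<Omega>" by (simp add: X_def zero_set_subset)
  have s\<phi>: "smooth_on \<Omega> \<phi>" using \<phi> by (simp add: CM_def)
  have V: "open V" "smooth_on V (\<lambda>y. 1 / \<phi> y)"
    using open_minus_zero_set[OF O s\<phi>] smooth_on_reciprocal[OF O s\<phi>] by (auto simp: V_def X_def)
  have "\<exists>C>0. \<exists>\<tau>>0. \<forall>x\<in>K - X. \<forall>is. \<bar>iter_partial is (\<lambda>y. 1 / \<phi> y) x\<bar> \<le>
          C * \<tau> ^ length is * fact (length is) * M (length is) /
          (if X = {} then 1 else hM M (lam * infdist x X))"
    if K: "compact K" "K \<subseteq> \<Omega>" and lam: "lam > 0" for K lam
  proof (cases "X = {}")
    \<comment> \<open>Without zeros the constant 1 lies in the flat ideal, so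
      \<open>1 / \<phi>\<close> itself agrees on \<open>\<Omega>\<close> with a function of the
      class.\<close>
    case True
    have "(\<lambda>y. 1) \<in> CM M \<Omega>"
      unfolding CM_iff[OF O]
    proof (intro conjI allI impI smooth_on_const)
      show "\<exists>C>0. \<exists>\<sigma>>0. \<forall>x\<in>K. \<forall>is. \<bar>iter_partial is (\<lambda>y. 1) x\<bar> \<le> C * \<sigma> ^ length is * fact (length is) * M (length is)" for K :: "(real^'n) set"
        by (rule exI[of _ 1], rule conjI, simp, rule exI[of _ 1])
          (use M_0 M_nonneg in \<open>auto simp: iter_partial_const\<close>)
    qed
    then have "(\<lambda>y. 1) \<in> flat_ideal M \<Omega> (zero_set \<Omega> \<phi>)" using True by (simp add: flat_ideal_def X_def)
    then obtain g where g: "g \<in> CM M \<Omega>" and fg: "\<And>y. y \<in> \<Omega> \<Longrightarrow> 1 = \<phi> y * g y"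
      using incl unfolding mult_set_def by blast
    have eq: "iter_partial is g x = iter_partial is (\<lambda>y. 1 / \<phi> y) x" if "x \<in> \<Omega>" for x "is"
    proof (rule iter_partial_cong[OF O _ that])
      fix y assume y: "y \<in> \<Omega>"
      have "\<phi> y \<noteq> 0" using fg[OF y] by auto
      then show "g y = 1 / \<phi> y" using fg[OF y] by (simp add: eq_divide_eq mult.commute)
    qed
    obtain C \<sigma> where pos: "C > 0" "\<sigma> > 0"
      and bg: "\<And>x is. x \<in> K \<Longrightarrow> \<bar>iter_partial is g x\<bar> \<le> C * \<sigma> ^ length is * fact (length is) * M (length is)"
      using CM_bounds[OF O g K] by blast
    have "\<forall>x\<in>K - X. \<forall>is. \<bar>iter_partial is (\<lambda>y. 1 / \<phi> y) x\<bar> \<le>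
          C * \<sigma> ^ length is * fact (length is) * M (length is) /
          (if X = {} then 1 else hM M (lam * infdist x X))"
    proof (intro ballI allI)
      fix x "is" assume x: "x \<in> K - X"
      then have "x \<in> \<Omega>" using K by blast
      from bg[of x "is", unfolded eq[OF this]] show "\<bar>iter_partial is (\<lambda>y. 1 / \<phi> y) x\<bar> \<le>
          C * \<sigma> ^ length is * fact (length is) * M (length is) /
          (if X = {} then 1 else hM M (lam * infdist x X))" using True x by simp
    qed
    then show ?thesis using pos by blast
  next
    case False
    \<comment> \<open>The cutoff has radius \<open>d / 2\<close>, so that it vanishes on a
      neighbourhood of \<open>X\<close>; the 2 restores \<open>hM M (lam * d)\<close>.\<close>
    have "2 * lam > 0" using lam by simp
    from bump[OF this] obtain \<sigma> where \<sigma>: "\<sigma> > 0" and ex: "\<forall>x0 :: real^'n. \<forall>r>0. \<exists>\<beta>. smooth_on UNIV \<beta> \<and>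
     (\<exists>e>0. \<forall>y\<in>ball x0 e. \<beta> y = 1) \<and> (\<forall>y. dist x0 y \<ge> r \<longrightarrow> \<beta> y = 0) \<and>
     (\<forall>is x. \<bar>iter_partial is \<beta> x\<bar> \<le> \<sigma> ^ length is * fact (length is) * M (length is) / hM M (2 * lam * r))"
      by blast
    obtain C \<tau> where pos: "C > 0" "\<tau> > 0" and
      ub: "\<And>x is f. x \<in> K - X \<Longrightarrow> f \<in> flat_ball \<sigma> X \<Longrightarrow>
       \<bar>iter_partial is (\<lambda>y. f y * (1 / \<phi> y)) x\<bar> \<le> C * \<tau> ^ length is * fact (length is) * M (length is)"
      using uniform_quotient_bound[OF O \<phi> incl K \<sigma>, folded X_def] by blast
    have "\<bar>iter_partial is (\<lambda>y. 1 / \<phi> y) x\<bar> \<le> C * \<tau> ^ length is * fact (length is) * M (length is) / hM M (lam * infdist x X)"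
      if x: "x \<in> K - X" for x "is"
    proof -
      define d where "d = infdist x X"
      have d: "d > 0" unfolding d_def
        using infdist_zero_set_pos[OF O s\<phi>, of x] x K False by (auto simp: X_def)
      define H where "H = hM M (lam * d)"
      have H: "H > 0" unfolding H_def using lam d by (intro hM_pos) auto
      have "d / 2 > 0" using d by simp
      from ex[rule_format, OF this, of x] obtain \<beta> e where s: "smooth_on UNIV \<beta>" and e: "e > 0" "\<And>y. y \<in> ball x e \<Longrightarrow> \<beta> y = 1"
        and z: "\<And>y. dist x y \<ge> d / 2 \<Longrightarrow> \<beta> y = 0"
        and b: "\<And>is y. \<bar>iter_partial is \<beta> y\<bar> \<le> \<sigma> ^ length is * fact (length is) * M (length is) / H"
        unfolding H_def by (auto simp: mult.assoc)
      \<comment> \<open>Scaling by \<open>H\<close> puts the cutoff into the fixed ball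
        \<open>flat_ball \<sigma> X\<close>; the zero summand matches the shape of
        \<open>iter_partial_linear\<close>.\<close>
      define f where "f = (\<lambda>y. H * \<beta> y + 0 * \<beta> y)"
      have fi: "iter_partial is f y = H * iter_partial is \<beta> y" for "is" y
        unfolding f_def using iter_partial_linear(1)[OF open_UNIV s s, of y "is" H 0] by simp
      have "f \<in> flat_ball \<sigma> X"
        unfolding flat_ball_def
      proof (intro CollectI conjI allI ballI)
        show "smooth_on UNIV f" unfolding f_def by (rule smooth_on_linear[OF open_UNIV s s])
        show "\<bar>iter_partial is f y\<bar> \<le> \<sigma> ^ length is * fact (length is) * M (length is)" for "is" y
          using b[of "is" y] H by (simp add: fi abs_mult pos_le_divide_eq mult.commute)
        show "iter_partial is f a = 0" if a: "a \<in> X" for a "is"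
        proof -
          have "d \<le> dist x a" unfolding d_def using a by (rule infdist_le)
          then have "a \<in> - cball x (d / 2)" using d by auto
          then have "iter_partial is \<beta> a = iter_partial is (\<lambda>y. 0) a"
            by (rule iter_partial_cong[rotated 2]) (auto intro!: z)
          then show ?thesis by (simp add: fi iter_partial_const)
        qed
      qed
      then have "\<bar>iter_partial is (\<lambda>y. f y * (1 / \<phi> y)) x\<bar> \<le> C * \<tau> ^ length is * fact (length is) * M (length is)"
        using x by (intro ub)
      moreover have "iter_partial is (\<lambda>y. f y * (1 / \<phi> y)) x = H * iter_partial is (\<lambda>y. 1 / \<phi> y) x"
      proof -
        have xV: "x \<in> V" using x K by (auto simp: V_def)
        have "iter_partial is (\<lambda>y. f y * (1 / \<phi> y)) x = iter_partial is (\<lambda>y. H * (1 / \<phi> y) + 0 * (1 / \<phi> y)) x"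
          by (rule iter_partial_cong[of "ball x e"]) (use e in \<open>auto simp: f_def\<close>)
        then show ?thesis using iter_partial_linear(1)[OF V(1) V(2) V(2) xV, of "is" H 0] by simp
      qed
      ultimately show ?thesis using H by (simp add: abs_mult H_def d_def pos_le_divide_eq mult.commute)
    qed
    then have "\<forall>x\<in>K - X. \<forall>is. \<bar>iter_partial is (\<lambda>y. 1 / \<phi> y) x\<bar> \<le>
          C * \<tau> ^ length is * fact (length is) * M (length is) /
          (if X = {} then 1 else hM M (lam * infdist x X))" using False by simp
    then show ?thesis using pos by blast
  qed
  then show ?thesis
    unfolding CM_lojasiewicz_iff[OF V[unfolded V_def X_def]] X_def by blast
qed

end

theorem theorem3p4:
  fixes M :: "nat \<Rightarrow> real" and \<Omega> :: "(real^'n::finite) set" and \<phi> :: "real^'n \<Rightarrow> real"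
  assumes "strongly_regular M"
    and "open \<Omega>"
    and "\<phi> \<in> CM M \<Omega>"
    and "\<exists>x\<in>\<Omega>. \<phi> x \<noteq> 0"
  defines "X \<equiv> zero_set \<Omega> \<phi>"
    and "Xinf \<equiv> flat_points \<Omega> \<phi>"
    and "I \<equiv> mult_set \<Omega> \<phi> (CM M \<Omega>)"
  shows "(CM_lojasiewicz M \<Omega> \<phi> \<longleftrightarrow>
           (flat_ideal M \<Omega> X \<subseteq> I \<and> frontier X \<inter> \<Omega> \<subseteq> closure (X - Xinf)))
       \<and> (CM_lojasiewicz M \<Omega> \<phi> \<longleftrightarrow>
           flat_ideal M \<Omega> X = mult_set \<Omega> \<phi> (flat_ideal M \<Omega> X))"
proof -
  interpret strongly_regular_seq M by unfold_locales (rule assms(1))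
  have sub: "mult_set \<Omega> \<phi> (flat_ideal M \<Omega> X) \<subseteq> I"
    by (auto simp: I_def mult_set_def flat_ideal_def)
  have A: "CM_lojasiewicz M \<Omega> \<phi>" if "flat_ideal M \<Omega> X \<subseteq> I"
    using division_imp_lojasiewicz[OF assms(2,3)] that by (simp add: X_def I_def)
  have C: "flat_ideal M \<Omega> X = mult_set \<Omega> \<phi> (flat_ideal M \<Omega> X)" if "CM_lojasiewicz M \<Omega> \<phi>"
    using lojasiewicz_division[OF assms(2,3) that] mult_flat_ideal_subset[OF assms(2,3) zero_set_subset]
    unfolding X_def by blast
  have D: "frontier X \<inter> \<Omega> \<subseteq> closure (X - Xinf)" if "CM_lojasiewicz M \<Omega> \<phi>"
    using lojasiewicz_nonflat_dense[OF assms(2,3) that] by (simp add: X_def Xinf_def)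
  \<comment> \<open>The equality of ideals returns to the Lojasiewicz condition through
    \<open>sub\<close> and \<open>A\<close>.\<close>
  show ?thesis using sub A C D by blast
qed

end
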